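(* Let $N, l$ be positive integers and let $\mathcal{E}$ be a complex Hilbert space. Let $Z\in\mathcal{B}_N(\mathcal{E})$ and let $B_k\in\mathcal{L}(\mathcal{E}_k,\mathcal{E})$, $0\le k\le l$, be given. Let $U_\infty,V_\infty:\bigoplus_{k=0}^l\mathcal{E}_k\to\bigoplus_{k=0}^\infty\mathcal{E}_k$ be the operators associated with $Z$ and $B_0,\ldots,B_l$ by $$U_\infty^*=\left[F^{(l)}_\sigma U\right]_{|\sigma|=0}^\infty,\qquad V_\infty^*=\left[F^{(l)}_\sigma V\right]_{|\sigma|=0}^\infty,$$ where $U=[I_{\mathcal E}\ 0\ \ldots\ 0]^*$ and $V=[B_0\ B_1\ \ldots\ B_l]^*$ are operators from $\mathcal{E}$ to $\bigoplus_{k=0}^l\mathcal{E}_k$. Then there exists $T\in\mathcal{S}(\mathcal{H},\mathcal{E})$ such that $$\left[D_\sigma T_Z\right]_{|\sigma|=k}=B_k,\qquad k=0,\ldots,l,$$ if and only if the operator $U_\infty^*U_\infty-V_\infty^*V_\infty$ is positive (i.e. positive semidefinite).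
   Context: $\mathcal{L}(\cdot,\cdot)$ denotes bounded linear operators and $\mathcal{H}=\mathbb{C}^N$ (it enters only through $N$). For $Z=[Z_1\ \ldots\ Z_N]\in\mathcal{L}(\mathcal{E})^N$ put $(Z|Z)=\sum_{k=1}^N Z_k^*Z_k$, and let $\mathcal{B}_N(\mathcal{E})=\{Z\in\mathcal{L}(\mathcal{E})^N : (Z|Z)<I_{\mathcal{E}}\}$, where $<$ means that $I_{\mathcal E}-(Z|Z)$ is positive and boundedly invertible. $\mathbb{F}_N^+$ is the unital free semigroup on generators $1,\ldots,N$; $|\sigma|$ is the length of a word $\sigma$; words are ordered by length and, within a given length, lexicographically. Define $\mathcal{E}_0=\mathcal{E}$ and $\mathcal{E}_k=\mathcal{E}_{k-1}^{\oplus N}$ ($N$ summands) for $k\ge 1$. Thus $\mathcal{E}_k=\bigoplus_{|\sigma|=k}\mathcal{E}$, with summands indexed by words of length $k$ in lexicographic order (the outermost summand index being the first letter). For an operator $X$, $X^{\oplus N}$ is the direct sum of $N$ copies of $X$. $\mathcal{U}_{\mathcal T}(\mathcal{H},\mathcal{E})$ is the set of upper triangular operators $T=[T_{ij}]_{i,j=0}^\infty\in\mathcal{L}(\bigoplus_{k=0}^\infty\mathcal{E}_k)$, $T_{ij}\in\mathcal{L}(\mathcal{E}_j,\mathcal{E}_i)$, $T_{ij}=0$ for $i>j$, such that $T_{ij}=T_{i-1,j-1}^{\oplus N}$ for all $1\le i\le j$. $\mathcal{S}(\mathcal{H},\mathcal{E})$ is the set of contractions in $\mathcal{U}_{\mathcal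 T}(\mathcal{H},\mathcal{E})$. For $1\le k\le N$ let $E_k:\mathcal{E}\to\mathcal{E}_1=\mathcal{E}^{\oplus N}$ be the column operator with $I_{\mathcal E}$ in the $k$th position and $0$ elsewhere. Given $Z\in\mathcal{B}_N(\mathcal{E})$ and $l$, let $F_k^{(l)}=[X_{ij}]_{i,j=0}^l\in\mathcal{L}(\bigoplus_{m=0}^l\mathcal{E}_m)$ be the lower triangular operator with $X_{00}=Z_k^*$, $X_{10}=E_k$, $X_{i0}=0$ for $i>1$, $X_{ij}=0$ for $i<j$, and $X_{ij}=X_{i-1,j-1}^{\oplus N}$ for $i\ge j\ge 1$. For $\sigma=i_1\cdots i_k$ set $F^{(l)}_\sigma=F^{(l)}_{i_1}\cdots F^{(l)}_{i_k}$, and $F^{(l)}_\emptyset=I$. For an operator $G:\mathcal{E}\to\bigoplus_{m=0}^l\mathcal{E}_m$, $[F^{(l)}_\sigma G]_{|\sigma|=0}^\infty$ denotes the (bounded) row operator $\bigoplus_{k=0}^\infty\mathcal{E}_k\to\bigoplus_{m=0}^l\mathcal{E}_m$ whose entry at the summand $\mathcal{E}$ indexed by $\sigma$ is $F^{(l)}_\sigma G$. Partial derivatives: for the operator $U$ of the claim, the component of $U_\infty^*=[F^{(l)}_\sigma U]_{|\sigma|=0}^\infty$ in the summand $\mathcal{E}$ of $\bigoplus_{m=0}^l\mathcal{E}_m$ indexed by a word $\tau$ ($|\tau|\le l$) is a bounded row operator $L(\tau,Z):\bigoplus_{k=0}^\infty\mathcal{E}_k\to\mathcal{E}$; that is, the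 columns of $U_\infty$ are the operators $L(\tau,Z)^*$, $|\tau|\le l$. (For $\tau=\emptyset$ this is $L(Z)=[Z^*_\sigma]_{|\sigma|=0}^\infty$ with $Z^*_\sigma=Z^*_{i_1}\cdots Z^*_{i_k}$ for $\sigma=i_1\cdots i_k$, $Z^*_\emptyset=I_{\mathcal E}$. The operator $L(\tau,Z)$ does not depend on the choice of $l\ge|\tau|$.) For $T\in\mathcal{U}_{\mathcal T}(\mathcal{H},\mathcal{E})$ define $D_\tau T_Z=P_{\mathcal E}\,T\,L(\tau,Z)^*\in\mathcal{L}(\mathcal{E})$, where $P_{\mathcal E}$ is the orthogonal projection of $\bigoplus_{k=0}^\infty\mathcal{E}_k$ onto $\mathcal{E}=\mathcal{E}_0$; in particular $D_\emptyset T_Z=T(Z)=P_{\mathcal E}TL(Z)^*$. $[D_\sigma T_Z]_{|\sigma|=k}$ is the row operator from $\mathcal{E}_k=\bigoplus_{|\sigma|=k}\mathcal{E}$ to $\mathcal{E}$ with these entries. *)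

theory Defs
  imports "HOL-Analysis.Analysis"
begin

section \<open>Complex Hilbert spaces\<close>

text \<open>The inner product is linear in the first argument.\<close>

class complex_hilbert_space = banach +
  fixes scaleC :: "complex \<Rightarrow> 'a \<Rightarrow> 'a" (infixr "*\<^sub>C" 75)
    and cinner :: "'a \<Rightarrow> 'a \<Rightarrow> complex"
  assumes scaleC_of_real: "complex_of_real r *\<^sub>C x = r *\<^sub>R x"
    and scaleC_add_right: "c *\<^sub>C (x + y) = c *\<^sub>C x + c *\<^sub>C y"
    and scaleC_add_left: "(c + d) *\<^sub>C x = c *\<^sub>C x + d *\<^sub>C x"
    and scaleC_scaleC: "c *\<^sub>C (d *\<^sub>C x) = (c * d) *\<^sub>C x"
    and cinner_commute: "cinner x y = cnj (cinner y x)"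
    and cinner_add_left: "cinner (x + y) z = cinner x z + cinner y z"
    and cinner_scaleC_left: "cinner (c *\<^sub>C x) y = c * cinner x y"
    and cinner_self: "cinner x x = complex_of_real ((norm x)\<^sup>2)"

lemma cinner_add_right:
  "cinner x (y + z) = cinner x y + cinner x (z :: 'a::complex_hilbert_space)"
  by (metis cinner_add_left cinner_commute complex_cnj_add)

lemma cinner_scaleC_right:
  "cinner x (c *\<^sub>C y) = cnj c * cinner x (y :: 'a::complex_hilbert_space)"
  by (metis cinner_scaleC_left cinner_commute complex_cnj_mult)

lemma Re_cinner_self: "Re (cinner x x) = (norm (x :: 'a::complex_hilbert_space))\<^sup>2"
  by (simp only: cinner_self Re_complex_of_real)

lemma norm_scaleC: "norm (c *\<^sub>C x) = cmod c * norm (x :: 'a::complex_hilbert_space)"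
proof -
  have "complex_of_real ((norm (c *\<^sub>C x))\<^sup>2) = c * cnj c * complex_of_real ((norm x)\<^sup>2)"
    by (simp only: cinner_self [symmetric] cinner_scaleC_left cinner_scaleC_right)
      (simp add: mult_ac)
  also have "\<dots> = complex_of_real ((cmod c * norm x)\<^sup>2)"
    by (simp add: complex_norm_square [symmetric] power_mult_distrib)
  finally have "(norm (c *\<^sub>C x))\<^sup>2 = (cmod c * norm x)\<^sup>2"
    using of_real_eq_iff by blast
  then show ?thesis
    by (simp add: power2_eq_iff_nonneg)
qed

lemma cinner_norm_le: "cmod (cinner x y) \<le> norm x * norm (y :: 'a::complex_hilbert_space)"
proof -
  have Re_le: "Re (cinner u y) \<le> norm u * norm y" for u :: 'a
  proof -
    have "(norm (u + y))\<^sup>2 \<le> (norm u + norm y)\<^sup>2"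
      by (simp add: norm_triangle_ineq power_mono)
    moreover have "Re (cinner y u) = Re (cinner u y)"
      by (metis cinner_commute complex_cnj(1) cnj.sel(1))
    then have "(norm (u + y))\<^sup>2 = (norm u)\<^sup>2 + 2 * Re (cinner u y) + (norm y)\<^sup>2"
      by (simp add: Re_cinner_self [symmetric] cinner_add_left cinner_add_right)
    ultimately show ?thesis
      by (simp add: power2_sum)
  qed
  show ?thesis
  proof (cases "cinner x y = 0")
    case False
    define c where "c = cnj (cinner x y) / cmod (cinner x y)"
    have c: "cmod c = 1"
      using False by (simp add: c_def norm_divide)
    have "c * cinner x y = complex_of_real (cmod (cinner x y))"
      using False
      by (simp add: c_def mult.commute [of "cnj _"] complex_norm_square [symmetric] power2_eq_square)
    then have "cmod (cinner x y) = Re (cinner (c *\<^sub>C x) y)"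
      by (simp add: cinner_scaleC_left)
    also have "\<dots> \<le> norm x * norm y"
      using Re_le [of "c *\<^sub>C x"] c by (simp add: norm_scaleC)
    finally show ?thesis .
  qed simp
qed


section \<open>Hilbert space direct sums of copies of a Hilbert space\<close>

typedef (overloaded) ('i, 'a) ell2 =
  "{f :: 'i \<Rightarrow> 'a::complex_hilbert_space. (\<lambda>i. (norm (f i))\<^sup>2) summable_on UNIV}"
  morphisms coord Abs_ell2
  by (rule exI [of _ "\<lambda>_. 0"]) simp

setup_lifting type_definition_ell2

lemma ell2_summable: "(\<lambda>i. (norm (coord x i))\<^sup>2) summable_on UNIV"
  using coord [of x] by simp

lemma ell2_eqI: "(\<And>i. coord x i = coord y i) \<Longrightarrow> x = y"
  by (meson coord_inject ext)

lemma square_summable_add: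
  fixes f g :: "'i \<Rightarrow> 'a::real_normed_vector"
  assumes "(\<lambda>i. (norm (f i))\<^sup>2) summable_on A" "(\<lambda>i. (norm (g i))\<^sup>2) summable_on A"
  shows "(\<lambda>i. (norm (f i + g i))\<^sup>2) summable_on A"
proof (rule summable_on_comparison_test)
  show "(\<lambda>i. 2 * (norm (f i))\<^sup>2 + 2 * (norm (g i))\<^sup>2) summable_on A"
    by (intro summable_on_add summable_on_cmult_right assms)
  fix i
  have "(norm (f i + g i))\<^sup>2 \<le> (norm (f i) + norm (g i))\<^sup>2"
    by (simp add: norm_triangle_ineq power_mono)
  also have "\<dots> \<le> 2 * (norm (f i))\<^sup>2 + 2 * (norm (g i))\<^sup>2"
    using sum_squares_bound [of "norm (f i)" "norm (g i)"] by (simp add: power2_sum)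
  finally show "(norm (f i + g i))\<^sup>2 \<le> 2 * (norm (f i))\<^sup>2 + 2 * (norm (g i))\<^sup>2" .
qed simp

lemma square_summable_bounded:
  fixes f :: "'i \<Rightarrow> 'a::real_normed_vector"
  assumes "\<And>F. finite F \<Longrightarrow> L2_set (\<lambda>i. norm (f i)) F \<le> C"
  shows "(\<lambda>i. (norm (f i))\<^sup>2) summable_on UNIV"
    and "sqrt (\<Sum>\<^sub>\<infinity>i. (norm (f i))\<^sup>2) \<le> C"
proof -
  have C: "0 \<le> C"
    using assms [of "{}"] by simp
  have le: "(\<Sum>i\<in>F. (norm (f i))\<^sup>2) \<le> C\<^sup>2" if "finite F" for F
    using assms [OF that] C unfolding L2_set_def
    by (metis real_sqrt_le_iff real_sqrt_unique)
  show s: "(\<lambda>i. (norm (f i))\<^sup>2) summable_on UNIV"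
    by (rule nonneg_bdd_above_summable_on) (auto intro!: bdd_aboveI2 le)
  have "(\<Sum>\<^sub>\<infinity>i. (norm (f i))\<^sup>2) \<le> C\<^sup>2"
    by (rule infsum_le_finite_sums [OF s]) (rule le)
  then show "sqrt (\<Sum>\<^sub>\<infinity>i. (norm (f i))\<^sup>2) \<le> C"
    by (simp add: C real_le_lsqrt)
qed

instantiation ell2 :: (type, complex_hilbert_space) ab_group_add
begin

lift_definition zero_ell2 :: "('a, 'b) ell2" is "\<lambda>_. 0"
  by simp

lift_definition plus_ell2 :: "('a, 'b) ell2 \<Rightarrow> ('a, 'b) ell2 \<Rightarrow> ('a, 'b) ell2"
  is "\<lambda>f g i. f i + g i"
  by (rule square_summable_add)

lift_definition uminus_ell2 :: "('a, 'b) ell2 \<Rightarrow> ('a, 'b) ell2" is "\<lambda>f i. - f i"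
  by simp

definition minus_ell2 :: "('a, 'b) ell2 \<Rightarrow> ('a, 'b) ell2 \<Rightarrow> ('a, 'b) ell2"
  where "minus_ell2 x y = x + (- y)"

instance
  by standard (transfer; simp add: minus_ell2_def algebra_simps fun_eq_iff; fail |
      simp add: minus_ell2_def)+

end

lemma coord_zero [simp]: "coord 0 i = 0"
  and coord_add [simp]: "coord (x + y) i = coord x i + coord y i"
  and coord_uminus [simp]: "coord (- x) i = - coord x i"
  by (simp_all add: zero_ell2.rep_eq plus_ell2.rep_eq uminus_ell2.rep_eq)

lemma coord_diff [simp]: "coord (x - y) i = coord x i - coord y i"
  unfolding minus_ell2_def coord_add coord_uminus by (rule add_uminus_conv_diff)

instantiation ell2 :: (type, complex_hilbert_space) real_vector
begin

lift_definition scaleR_ell2 :: "real \<Rightarrow> ('a, 'b) ell2 \<Rightarrow> ('a, 'b) ell2"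
  is "\<lambda>r f i. r *\<^sub>R f i"
  unfolding norm_scaleR power_mult_distrib by (rule summable_on_cmult_right)

lemma coord_scaleR: "coord (r *\<^sub>R x) i = r *\<^sub>R coord (x :: ('a, 'b) ell2) i"
  by (simp add: scaleR_ell2.rep_eq)

instance
  by standard (rule ell2_eqI, simp add: coord_scaleR scaleR_add_right scaleR_add_left)+

end

instantiation ell2 :: (type, complex_hilbert_space) real_normed_vector
begin

definition norm_ell2 :: "('a, 'b) ell2 \<Rightarrow> real"
  where "norm_ell2 x = sqrt (\<Sum>\<^sub>\<infinity>i. (norm (coord x i))\<^sup>2)"

definition sgn_ell2 :: "('a, 'b) ell2 \<Rightarrow> ('a, 'b) ell2"
  where "sgn_ell2 x = x /\<^sub>R norm x"

definition dist_ell2 :: "('a, 'b) ell2 \<Rightarrow> ('a, 'b) ell2 \<Rightarrow> real"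
  where "dist_ell2 x y = norm (x - y)"

definition uniformity_ell2 :: "(('a, 'b) ell2 \<times> ('a, 'b) ell2) filter"
  where "uniformity_ell2 = (INF e\<in>{0<..}. principal {(x, y). dist x y < e})"

definition open_ell2 :: "('a, 'b) ell2 set \<Rightarrow> bool"
  where "open_ell2 U \<longleftrightarrow> (\<forall>x\<in>U. \<forall>\<^sub>F (x', y) in uniformity. x' = x \<longrightarrow> y \<in> U)"

lemma L2_set_le_norm:
  fixes x :: "('a, 'b) ell2"
  assumes "finite F"
  shows "L2_set (\<lambda>i. norm (coord x i)) F \<le> norm x"
  unfolding L2_set_def norm_ell2_def
  by (intro real_sqrt_le_mono finite_sum_le_infsum ell2_summable) (use assms in auto)

instance
proof
  fix x y :: "('a, 'b) ell2" and a :: real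
  show "norm x = 0 \<longleftrightarrow> x = 0"
  proof
    assume "norm x = 0"
    then have "(norm (coord x i))\<^sup>2 = 0" for i
      by (intro nonneg_infsum_le_0D [OF _ ell2_summable]) (auto simp: norm_ell2_def)
    then show "x = 0"
      by (intro ell2_eqI) simp
  qed (simp add: norm_ell2_def)
  show "norm (x + y) \<le> norm x + norm y"
    unfolding norm_ell2_def [of "x + y"]
  proof (rule square_summable_bounded(2))
    fix F :: "'a set"
    assume F: "finite F"
    have "L2_set (\<lambda>i. norm (coord (x + y) i)) F
        \<le> L2_set (\<lambda>i. norm (coord x i) + norm (coord y i)) F"
      by (rule L2_set_mono) (auto simp: norm_triangle_ineq)
    also have "\<dots> \<le> norm x + norm y"
      using L2_set_triangle_ineq [of "\<lambda>i. norm (coord x i)" "\<lambda>i. norm (coord y i)" F]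
        L2_set_le_norm [OF F, of x] L2_set_le_norm [OF F, of y]
      by linarith
    finally show "L2_set (\<lambda>i. norm (coord (x + y) i)) F \<le> norm x + norm y" .
  qed
  show "norm (a *\<^sub>R x) = \<bar>a\<bar> * norm x"
    by (simp add: norm_ell2_def coord_scaleR power_mult_distrib infsum_cmult_right' real_sqrt_mult)
qed (simp_all add: sgn_ell2_def dist_ell2_def uniformity_ell2_def open_ell2_def)

end

lemma norm_coord_le: "norm (coord x i) \<le> norm x"
  using L2_set_le_norm [of "{i}" x] by simp

instance ell2 :: (type, complex_hilbert_space) banach
proof
  fix X :: "nat \<Rightarrow> ('a, 'b) ell2"
  assume X: "Cauchy X"
  have "Cauchy (\<lambda>n. coord (X n) i)" for i
  proof (rule metric_CauchyI)
    fix e :: real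
    assume "e > 0"
    then obtain M where M: "\<forall>m\<ge>M. \<forall>n\<ge>M. dist (X m) (X n) < e"
      using metric_CauchyD [OF X] by blast
    have "dist (coord (X m) i) (coord (X n) i) < e" if "m \<ge> M" "n \<ge> M" for m n
    proof -
      have "dist (coord (X m) i) (coord (X n) i) \<le> dist (X m) (X n)"
        using norm_coord_le [of "X m - X n" i] by (simp add: dist_norm)
      also have "\<dots> < e"
        using M that by blast
      finally show ?thesis .
    qed
    then show "\<exists>M. \<forall>m\<ge>M. \<forall>n\<ge>M. dist (coord (X m) i) (coord (X n) i) < e"
      by (intro exI [of _ M] allI impI)
  qed
  then have conv: "convergent (\<lambda>n. coord (X n) i)" for i
    by (simp only: Cauchy_convergent_iff)
  define l where "l = (\<lambda>i. lim (\<lambda>n. coord (X n) i))"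
  have l: "(\<lambda>n. coord (X n) i) \<longlonglongrightarrow> l i" for i
    unfolding l_def using conv [of i] by (simp only: convergent_LIMSEQ_iff)
  have bound: "L2_set (\<lambda>i. norm (coord (X m) i - l i)) F \<le> e"
    if "\<forall>m\<ge>M. \<forall>n\<ge>M. dist (X m) (X n) < e" "m \<ge> M" "finite F" for M m e F
  proof (rule tendsto_upperbound)
    show "(\<lambda>n. L2_set (\<lambda>i. norm (coord (X m) i - coord (X n) i)) F)
        \<longlonglongrightarrow> L2_set (\<lambda>i. norm (coord (X m) i - l i)) F"
      unfolding L2_set_def by (intro tendsto_intros l)
    have "L2_set (\<lambda>i. norm (coord (X m) i - coord (X n) i)) F \<le> e" if "n \<ge> M" for n
    proof -
      have "dist (X m) (X n) < e"
        using \<open>\<forall>m\<ge>M. \<forall>n\<ge>M. dist (X m) (X n) < e\<close> \<open>m \<ge> M\<close> that by blast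
      then show ?thesis
        using L2_set_le_norm [OF \<open>finite F\<close>, of "X m - X n"] by (simp add: dist_norm)
    qed
    then show "\<forall>\<^sub>F n in sequentially.
        L2_set (\<lambda>i. norm (coord (X m) i - coord (X n) i)) F \<le> e"
      by (rule eventually_sequentiallyI)
  qed simp
  obtain M1 where M1: "\<forall>m\<ge>M1. \<forall>n\<ge>M1. dist (X m) (X n) < 1"
    using metric_CauchyD [OF X zero_less_one] by blast
  have "(\<lambda>i. (norm (coord (X M1) i - l i))\<^sup>2) summable_on UNIV"
    using bound [OF M1 order_refl] by (rule square_summable_bounded(1))
  from square_summable_add [OF ell2_summable [of "- X M1"] this]
  have "(\<lambda>i. (norm (l i))\<^sup>2) summable_on UNIV"
    by simp
  then have coord_l: "coord (Abs_ell2 l) = l"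
    by (simp add: Abs_ell2_inverse)
  have "X \<longlonglongrightarrow> Abs_ell2 l"
  proof (rule metric_LIMSEQ_I)
    fix e :: real
    assume "e > 0"
    then obtain M where M: "\<forall>m\<ge>M. \<forall>n\<ge>M. dist (X m) (X n) < e / 2"
      using metric_CauchyD [OF X, of "e / 2"] by auto
    have "norm (X m - Abs_ell2 l) \<le> e / 2" if "m \<ge> M" for m
      unfolding norm_ell2_def
      by (rule square_summable_bounded(2)) (simp only: coord_diff coord_l bound [OF M that])
    then show "\<exists>M. \<forall>m\<ge>M. dist (X m) (Abs_ell2 l) < e"
      using \<open>e > 0\<close> by (intro exI [of _ M]) (fastforce simp: dist_norm)
  qed
  then show "convergent X"
    by (rule convergentI)
qed

lemma cinner_summable:
  "(\<lambda>i. cinner (coord x i) (coord y i)) summable_on UNIV"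
proof (rule abs_summable_summable, rule Infinite_Sum.abs_summable_on_comparison_test')
  show "(\<lambda>i. (norm (coord x i))\<^sup>2 + (norm (coord y i))\<^sup>2) summable_on UNIV"
    by (intro summable_on_add ell2_summable)
  fix i
  have "2 * (norm (coord x i) * norm (coord y i)) \<le> (norm (coord x i))\<^sup>2 + (norm (coord y i))\<^sup>2"
    using sum_squares_bound [of "norm (coord x i)" "norm (coord y i)"] by simp
  moreover have "0 \<le> norm (coord x i) * norm (coord y i)"
    by simp
  ultimately show "cmod (cinner (coord x i) (coord y i))
      \<le> (norm (coord x i))\<^sup>2 + (norm (coord y i))\<^sup>2"
    using cinner_norm_le [of "coord x i" "coord y i"] by linarith
qed

instantiation ell2 :: (type, complex_hilbert_space) complex_hilbert_space
begin

lift_definition scaleC_ell2 :: "complex \<Rightarrow> ('a, 'b) ell2 \<Rightarrow> ('a, 'b) ell2"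
  is "\<lambda>c f i. c *\<^sub>C f i"
  unfolding norm_scaleC power_mult_distrib by (rule summable_on_cmult_right)

definition cinner_ell2 :: "('a, 'b) ell2 \<Rightarrow> ('a, 'b) ell2 \<Rightarrow> complex"
  where "cinner_ell2 x y = (\<Sum>\<^sub>\<infinity>i. cinner (coord x i) (coord y i))"

lemma coord_scaleC: "coord (c *\<^sub>C x) i = c *\<^sub>C coord (x :: ('a, 'b) ell2) i"
  by (simp add: scaleC_ell2.rep_eq)

instance
proof
  fix x y z :: "('a, 'b) ell2" and r :: real and c d :: complex
  show "complex_of_real r *\<^sub>C x = r *\<^sub>R x"
    by (rule ell2_eqI) (simp add: coord_scaleC coord_scaleR scaleC_of_real)
  show "c *\<^sub>C (x + y) = c *\<^sub>C x + c *\<^sub>C y"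
    by (rule ell2_eqI) (simp add: coord_scaleC scaleC_add_right)
  show "(c + d) *\<^sub>C x = c *\<^sub>C x + d *\<^sub>C x"
    by (rule ell2_eqI) (simp add: coord_scaleC scaleC_add_left)
  show "c *\<^sub>C (d *\<^sub>C x) = (c * d) *\<^sub>C x"
    by (rule ell2_eqI) (simp add: coord_scaleC scaleC_scaleC)
  show "cinner x y = cnj (cinner y x)"
    unfolding cinner_ell2_def infsum_cnj [symmetric]
    by (subst cinner_commute) (rule refl)
  show "cinner (x + y) z = cinner x z + cinner y z"
    by (simp add: cinner_ell2_def cinner_add_left infsum_add cinner_summable)
  show "cinner (c *\<^sub>C x) y = c * cinner x y"
    by (simp add: cinner_ell2_def coord_scaleC cinner_scaleC_left infsum_cmult_right')
  have "(norm x)\<^sup>2 = (\<Sum>\<^sub>\<infinity>i. (norm (coord x i))\<^sup>2)"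
    by (simp add: norm_ell2_def infsum_nonneg)
  then have "((\<lambda>i. cinner (coord x i) (coord x i)) has_sum complex_of_real ((norm x)\<^sup>2)) UNIV"
    using has_sum_infsum [OF ell2_summable [of x]]
    by (simp only: cinner_self has_sum_of_real_iff)
  then show "cinner x x = complex_of_real ((norm x)\<^sup>2)"
    unfolding cinner_ell2_def by (rule infsumI)
qed

end

lift_definition restrict_to :: "'i set \<Rightarrow> ('i, 'a::complex_hilbert_space) ell2 \<Rightarrow> ('i, 'a) ell2"
  is "\<lambda>W f i. if i \<in> W then f i else 0"
  by (erule summable_on_comparison_test) auto

lift_definition single :: "'i \<Rightarrow> 'a::complex_hilbert_space \<Rightarrow> ('i, 'a) ell2"
  is "\<lambda>i e j. if j = i then e else 0"
proof -
  fix i :: 'i and e :: 'a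
  have "(\<lambda>j. (norm (if j = i then e else 0))\<^sup>2) summable_on {i}"
    by simp
  then show "(\<lambda>j. (norm (if j = i then e else 0))\<^sup>2) summable_on UNIV"
    by (rule summable_on_cong_neutral [THEN iffD1, rotated -1]) auto
qed

text \<open>The direct sum of the copies of \<open>'a\<close> indexed by \<open>W\<close>, as a closed subspace.\<close>

definition sum_space :: "'i set \<Rightarrow> ('i, 'a::complex_hilbert_space) ell2 set"
  where "sum_space W = {x. \<forall>i. i \<notin> W \<longrightarrow> coord x i = 0}"


section \<open>Bounded operators between closed subspaces\<close>

text \<open>An operator is a function of which only the values on its domain \<open>S\<close> matter.\<close>

definition bounded_ops ::
    "'a::complex_hilbert_space set \<Rightarrow> 'b::complex_hilbert_space set \<Rightarrow> ('a \<Rightarrow> 'b) set"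
  where "bounded_ops S R = {A.
    (\<forall>x\<in>S. A x \<in> R) \<and>
    (\<forall>x\<in>S. \<forall>y\<in>S. A (x + y) = A x + A y) \<and>
    (\<forall>c. \<forall>x\<in>S. A (c *\<^sub>C x) = c *\<^sub>C A x) \<and>
    (\<exists>K. \<forall>x\<in>S. norm (A x) \<le> K * norm x)}"

definition adj ::
    "'a::complex_hilbert_space set \<Rightarrow> ('a \<Rightarrow> 'b::complex_hilbert_space) \<Rightarrow> 'b \<Rightarrow> 'a"
  where "adj S A y = (THE z. z \<in> S \<and> (\<forall>x\<in>S. cinner (A x) y = cinner x z))"

definition positive_op :: "'a::complex_hilbert_space set \<Rightarrow> ('a \<Rightarrow> 'a) \<Rightarrow> bool"
  where "positive_op S A \<longleftrightarrow> A \<in> bounded_ops S S \<and>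
    (\<forall>x\<in>S. Im (cinner (A x) x) = 0 \<and> 0 \<le> Re (cinner (A x) x))"

definition boundedly_invertible :: "'a::complex_hilbert_space set \<Rightarrow> ('a \<Rightarrow> 'a) \<Rightarrow> bool"
  where "boundedly_invertible S A \<longleftrightarrow>
    (\<exists>C\<in>bounded_ops S S. \<forall>x\<in>S. C (A x) = x \<and> A (C x) = x)"

definition op_ball :: "nat \<Rightarrow> (nat \<Rightarrow> 'e::complex_hilbert_space \<Rightarrow> 'e) set"
  where "op_ball N = {Z.
    (\<forall>k\<in>{1..N}. Z k \<in> bounded_ops UNIV UNIV) \<and>
    (let D = (\<lambda>x. x - (\<Sum>k=1..N. adj UNIV (Z k) (Z k x)))
     in positive_op UNIV D \<and> boundedly_invertible UNIV D)}"


section \<open>The spaces indexed by words\<close>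

text \<open>
  Since the summands are indexed by the words themselves, the lexicographic order is not needed.
  The space \<open>E\<close> is both the type \<open>'e\<close> and the summand \<open>level N 0\<close> at the empty word.
\<close>

type_synonym 'e fock = "(nat list, 'e) ell2"

definition words :: "nat \<Rightarrow> nat list set"
  where "words N = lists {1..N}"

definition words_len :: "nat \<Rightarrow> nat \<Rightarrow> nat list set"
  where "words_len N k = {\<sigma> \<in> words N. length \<sigma> = k}"

definition fock :: "nat \<Rightarrow> 'e::complex_hilbert_space fock set"
  where "fock N = sum_space (words N)"

definition level :: "nat \<Rightarrow> nat \<Rightarrow> 'e::complex_hilbert_space fock set"
  where "level N k = sum_space (words_len N k)"

definition fock_upto :: "nat \<Rightarrow> nat \<Rightarrow> 'e::complex_hilbert_space fock set"
  where "fock_upto N l = sum_space {\<sigma> \<in> words N. length \<sigma> \<le> l}"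

text \<open>
  Projection onto, and inclusion of, the \<open>a\<close>-th summand of \<open>N\<close> copies of \<open>level N k\<close>,
  which together form \<open>level N (Suc k)\<close>: the outermost summand index is the first letter.
\<close>

lift_definition comp_proj :: "nat \<Rightarrow> 'e::complex_hilbert_space fock \<Rightarrow> 'e fock"
  is "\<lambda>a f \<sigma>. f (a # \<sigma>)"
proof -
  fix a and f :: "nat list \<Rightarrow> 'e"
  assume "(\<lambda>\<sigma>. (norm (f \<sigma>))\<^sup>2) summable_on UNIV"
  then have "(\<lambda>\<sigma>. (norm (f \<sigma>))\<^sup>2) summable_on range ((#) a)"
    by (rule summable_on_subset_banach) simp
  then show "(\<lambda>\<sigma>. (norm (f (a # \<sigma>)))\<^sup>2) summable_on UNIV"
    by (subst (asm) summable_on_reindex) (simp_all add: comp_def)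
qed

lift_definition comp_incl :: "nat \<Rightarrow> 'e::complex_hilbert_space fock \<Rightarrow> 'e fock"
  is "\<lambda>a f \<sigma>. case \<sigma> of [] \<Rightarrow> 0 | b # \<tau> \<Rightarrow> if b = a then f \<tau> else 0"
proof -
  fix a and f :: "nat list \<Rightarrow> 'e"
  let ?g = "\<lambda>\<sigma>. case \<sigma> of [] \<Rightarrow> 0 | b # \<tau> \<Rightarrow> if b = a then f \<tau> else 0"
  assume "(\<lambda>\<sigma>. (norm (f \<sigma>))\<^sup>2) summable_on UNIV"
  then have "(\<lambda>\<sigma>. (norm (?g \<sigma>))\<^sup>2) summable_on range ((#) a)"
    by (subst summable_on_reindex) (simp_all add: comp_def)
  then show "(\<lambda>\<sigma>. (norm (?g \<sigma>))\<^sup>2) summable_on UNIV"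
    by (rule summable_on_cong_neutral [THEN iffD1, rotated -1]) (auto split: list.splits)
qed

text \<open>The direct sum of \<open>N\<close> copies of \<open>X\<close>.\<close>

definition ampl ::
    "nat \<Rightarrow> ('e fock \<Rightarrow> 'e fock) \<Rightarrow> 'e::complex_hilbert_space fock \<Rightarrow> 'e fock"
  where "ampl N X x = (\<Sum>a=1..N. comp_incl a (X (comp_proj a x)))"


section \<open>Upper triangular operators and the Schur class\<close>

text \<open>The matrix entry \<open>T\<^sub>i\<^sub>j\<close>, extended by 0 from \<open>level N j\<close> to all vectors.\<close>

definition entry ::
    "nat \<Rightarrow> ('e fock \<Rightarrow> 'e fock) \<Rightarrow> nat \<Rightarrow> nat \<Rightarrow> 'e::complex_hilbert_space fock \<Rightarrow> 'e fock"
  where "entry N T i j x = restrict_to (words_len N i) (T (restrict_to (words_len N j) x))"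

definition upper_triangular_ops :: "nat \<Rightarrow> ('e::complex_hilbert_space fock \<Rightarrow> 'e fock) set"
  where "upper_triangular_ops N = {T \<in> bounded_ops (fock N) (fock N).
    (\<forall>i j. i > j \<longrightarrow> (\<forall>x\<in>level N j. entry N T i j x = 0)) \<and>
    (\<forall>i j. 1 \<le> i \<and> i \<le> j \<longrightarrow>
      (\<forall>x\<in>level N j. entry N T i j x = ampl N (entry N T (i - 1) (j - 1)) x))}"

definition schur_class :: "nat \<Rightarrow> ('e::complex_hilbert_space fock \<Rightarrow> 'e fock) set"
  where "schur_class N = {T \<in> upper_triangular_ops N. \<forall>x\<in>fock N. norm (T x) \<le> norm x}"


section \<open>The operators associated with the data\<close>

text \<open>
  The matrix \<open>[X\<^sub>i\<^sub>j]\<close> whose corner is \<open>F\<^sub>k\<close>. The last two equations give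
  \<open>X\<^sub>i\<^sub>j = 0\<close> for all \<open>i < j\<close>.
\<close>

fun F_entry ::
    "nat \<Rightarrow> (nat \<Rightarrow> 'e \<Rightarrow> 'e) \<Rightarrow> nat \<Rightarrow> nat \<Rightarrow> nat \<Rightarrow> 'e::complex_hilbert_space fock \<Rightarrow> 'e fock"
  where
    "F_entry N Z k 0 0 x = single [] (adj UNIV (Z k) (coord x []))"
  | "F_entry N Z k (Suc 0) 0 x = single [k] (coord x [])"
  | "F_entry N Z k (Suc (Suc i)) 0 x = 0"
  | "F_entry N Z k 0 (Suc j) x = 0"
  | "F_entry N Z k (Suc i) (Suc j) x = ampl N (F_entry N Z k i j) x"

definition F_op ::
    "nat \<Rightarrow> nat \<Rightarrow> (nat \<Rightarrow> 'e \<Rightarrow> 'e) \<Rightarrow> nat \<Rightarrow> 'e::complex_hilbert_space fock \<Rightarrow> 'e fock"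
  where "F_op N l Z k x = (\<Sum>i\<le>l. \<Sum>j\<le>l. F_entry N Z k i j (restrict_to (words_len N j) x))"

definition F_word ::
    "nat \<Rightarrow> nat \<Rightarrow> (nat \<Rightarrow> 'e \<Rightarrow> 'e) \<Rightarrow> nat list \<Rightarrow> 'e::complex_hilbert_space fock \<Rightarrow> 'e fock"
  where "F_word N l Z \<sigma> = foldr (\<lambda>i A. F_op N l Z i \<circ> A) \<sigma> id"

text \<open>The row operator \<open>[F\<^sub>\<sigma> G]\<^sub>\<sigma>\<close> on \<open>fock N\<close>.\<close>

definition F_row ::
    "nat \<Rightarrow> nat \<Rightarrow> (nat \<Rightarrow> 'e \<Rightarrow> 'e) \<Rightarrow> ('e \<Rightarrow> 'e fock) \<Rightarrow> 'e::complex_hilbert_space fock \<Rightarrow> 'e fock"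
  where "F_row N l Z G x = (\<Sum>\<^sub>\<infinity>\<sigma>\<in>words N. F_word N l Z \<sigma> (G (coord x \<sigma>)))"

definition U_col :: "'e::complex_hilbert_space \<Rightarrow> 'e fock"
  where "U_col e = single [] e"

definition V_col ::
    "nat \<Rightarrow> nat \<Rightarrow> (nat \<Rightarrow> 'e fock \<Rightarrow> 'e) \<Rightarrow> 'e::complex_hilbert_space \<Rightarrow> 'e fock"
  where "V_col N l B e = (\<Sum>m\<le>l. adj (level N m) (B m) e)"

definition U_inf ::
    "nat \<Rightarrow> nat \<Rightarrow> (nat \<Rightarrow> 'e \<Rightarrow> 'e) \<Rightarrow> 'e::complex_hilbert_space fock \<Rightarrow> 'e fock"
  where "U_inf N l Z = adj (fock N) (F_row N l Z U_col)"

definition V_inf ::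
    "nat \<Rightarrow> nat \<Rightarrow> (nat \<Rightarrow> 'e \<Rightarrow> 'e) \<Rightarrow> (nat \<Rightarrow> 'e fock \<Rightarrow> 'e) \<Rightarrow>
      'e::complex_hilbert_space fock \<Rightarrow> 'e fock"
  where "V_inf N l Z B = adj (fock N) (F_row N l Z (V_col N l B))"


section \<open>Partial derivatives\<close>

text \<open>
  The row \<open>L(\<tau>, Z)\<close> is the \<open>\<tau>\<close>-component of the row \<open>U_inf\<^sup>*\<close>; it does not depend on
  the choice of \<open>l \<ge> length \<tau>\<close>, and \<open>l = length \<tau>\<close> is taken.
\<close>

definition L_row ::
    "nat \<Rightarrow> (nat \<Rightarrow> 'e \<Rightarrow> 'e) \<Rightarrow> nat list \<Rightarrow> 'e::complex_hilbert_space fock \<Rightarrow> 'e"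
  where "L_row N Z \<tau> x = coord (F_row N (length \<tau>) Z U_col x) \<tau>"

definition partial_deriv ::
    "nat \<Rightarrow> (nat \<Rightarrow> 'e \<Rightarrow> 'e) \<Rightarrow> ('e fock \<Rightarrow> 'e fock) \<Rightarrow> nat list \<Rightarrow> 'e::complex_hilbert_space \<Rightarrow> 'e"
  where "partial_deriv N Z T \<tau> e = coord (T (adj (fock N) (L_row N Z \<tau>) e)) []"

definition deriv_row ::
    "nat \<Rightarrow> (nat \<Rightarrow> 'e \<Rightarrow> 'e) \<Rightarrow> ('e fock \<Rightarrow> 'e fock) \<Rightarrow> nat \<Rightarrow> 'e::complex_hilbert_space fock \<Rightarrow> 'e"
  where "deriv_row N Z T k x = (\<Sum>\<sigma>\<in>words_len N k. partial_deriv N Z T \<sigma> (coord x \<sigma>))"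

end

theory Submission
  imports Defs
begin

text \<open>
  The operators \<open>T\<close> of the Schur class are exactly the contractions commuting with the backward shifts
  \<open>comp_proj a\<close>, and the derivative conditions say that \<open>T U\<^sub>\<infinity> = V\<^sub>\<infinity>\<close>. So positivity is necessary.
  Conversely, factor \<open>U\<^sub>\<infinity>\<^sup>* U\<^sub>\<infinity> - V\<^sub>\<infinity>\<^sup>* V\<^sub>\<infinity> = \<Gamma>\<^sup>* \<Gamma>\<close>. As \<open>comp_proj a \<circ> U\<^sub>\<infinity> = U\<^sub>\<infinity> F\<^sub>a\<^sup>*\<close>, and likewise
  for \<open>V\<^sub>\<infinity>\<close>, this yields
  \<open>\<parallel>\<Gamma> h\<parallel>\<^sup>2 + \<parallel>V\<^sup>* h\<parallel>\<^sup>2 = (\<Sum>a. \<parallel>\<Gamma> F\<^sub>a\<^sup>* h\<parallel>\<^sup>2) + \<parallel>U\<^sup>* h\<parallel>\<^sup>2\<close>. The resulting isometry (a lurking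
  isometry) extends to a contraction, whose transfer function is the required \<open>T\<close>.
\<close>

section \<open>Hilbert space geometry\<close>

text \<open>The derivatives at \<open>Z\<close> prescribe only the coordinate of
  \<open>T (U_inf N l Z h)\<close> at the empty word. Stripping a letter \<open>a\<close> from both
  sides replaces \<open>h\<close> by \<open>F_adj Z a h\<close>, so the shifts carry the
  prescription to every word. The norm identity arises by splitting the norms of
  \<open>U_inf h\<close> and \<open>V_inf h\<close> by the first letter and subtracting. Two
  obstacles shape the rest. For the boundedness of \<open>U_inf\<close>, the part of
  \<open>F_adj\<close> coming from \<open>Z\<close> is jointly a strict contraction, but a shift is
  added to it. The shift shortens words, so weights growing geometrically with the length make it
  small on words of length at most \<open>l\<close>, and orbits decay. For the transfer function,
  the system feeds the states at longer words into shorter ones and has no initial state. States are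
  therefore limits of truncations, with errors bounded by the tail of the input; that \<Gamma> is
  dominated by \<open>U_inf\<close> makes \<Gamma> h the limit along \<open>U_inf h\<close>. The
  isometry is extended by zero off the closure of its domain. The result is only a contraction, but
  this keeps the state space, whereas a unitary extension might have to enlarge it.\<close>

lemma scaleC_zero_left [simp]: "0 *\<^sub>C (x :: 'a::complex_hilbert_space) = 0"
  using scaleC_of_real [of 0 x] by simp

lemma scaleC_minus_one: "(- 1) *\<^sub>C (x :: 'a::complex_hilbert_space) = - x"
  using scaleC_of_real [of "- 1" x] by simp

lemma scaleC_zero_right [simp]: "c *\<^sub>C (0 :: 'a::complex_hilbert_space) = 0"
  using scaleC_add_right [of c 0 "0 :: 'a"] by simp

lemma scaleC_diff_right: "c *\<^sub>C (x - y :: 'a::complex_hilbert_space) = c *\<^sub>C x - c *\<^sub>C y"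
  using scaleC_add_right [of c "x - y" y] by simp

lemma scaleC_sum_right:
  "c *\<^sub>C (\<Sum>i\<in>I. f i :: 'a::complex_hilbert_space) = (\<Sum>i\<in>I. c *\<^sub>C f i)"
  by (induction I rule: infinite_finite_induct) (simp_all add: scaleC_add_right)

lemma scaleR_scaleC_commute:
  "c *\<^sub>C (r *\<^sub>R (x :: 'a::complex_hilbert_space)) = r *\<^sub>R (c *\<^sub>C x)"
  by (simp add: scaleC_of_real [symmetric] scaleC_scaleC mult.commute)

lemma cinner_zero_left [simp]: "cinner 0 (y :: 'a::complex_hilbert_space) = 0"
  using cinner_add_left [of 0 0 y] by simp

lemma cinner_zero_right [simp]: "cinner (y :: 'a::complex_hilbert_space) 0 = 0"
  using cinner_add_right [of y 0 0] by simp

lemma cinner_diff_left: "cinner (x - y) (z :: 'a::complex_hilbert_space) = cinner x z - cinner y z"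
  using cinner_add_left [of "x - y" y z] by simp

lemma cinner_diff_right: "cinner z (x - y :: 'a::complex_hilbert_space) = cinner z x - cinner z y"
  using cinner_add_right [of z "x - y" y] by simp

lemma cinner_sum_left:
  "cinner (\<Sum>i\<in>I. f i) (z :: 'a::complex_hilbert_space) = (\<Sum>i\<in>I. cinner (f i) z)"
  by (induction I rule: infinite_finite_induct) (simp_all add: cinner_add_left)

lemma cinner_sum_right:
  "cinner (z :: 'a::complex_hilbert_space) (\<Sum>i\<in>I. f i) = (\<Sum>i\<in>I. cinner z (f i))"
  by (induction I rule: infinite_finite_induct) (simp_all add: cinner_add_right)

lemma cinner_scaleR_left: "cinner (r *\<^sub>R x) (y :: 'a::complex_hilbert_space) = r * cinner x y"
  by (simp add: scaleC_of_real [symmetric] cinner_scaleC_left)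

lemma cinner_scaleR_right: "cinner x (r *\<^sub>R y :: 'a::complex_hilbert_space) = r * cinner x y"
  by (simp add: scaleC_of_real [symmetric] cinner_scaleC_right)

lemma Re_cinner_commute: "Re (cinner x y) = Re (cinner y (x :: 'a::complex_hilbert_space))"
  by (metis cinner_commute complex_cnj(1) cnj.sel(1))

lemma norm_add_sq:
  "(norm (x + y))\<^sup>2 = (norm x)\<^sup>2 + 2 * Re (cinner x y) + (norm (y :: 'a::complex_hilbert_space))\<^sup>2"
  by (simp add: Re_cinner_self [symmetric] cinner_add_left cinner_add_right Re_cinner_commute [of y x])

lemma norm_diff_sq:
  "(norm (x - y))\<^sup>2 = (norm x)\<^sup>2 - 2 * Re (cinner x y) + (norm (y :: 'a::complex_hilbert_space))\<^sup>2"
  by (simp add: Re_cinner_self [symmetric] cinner_diff_left cinner_diff_right Re_cinner_commute [of y x])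

lemma parallelogram_law:
  "(norm (x + y))\<^sup>2 + (norm (x - y :: 'a::complex_hilbert_space))\<^sup>2 = 2 * (norm x)\<^sup>2 + 2 * (norm y)\<^sup>2"
  by (simp add: norm_add_sq norm_diff_sq)

lemma bounded_linear_scaleC: "bounded_linear (\<lambda>x :: 'a::complex_hilbert_space. c *\<^sub>C x)"
  by (rule bounded_linear_intro [where K = "cmod c"])
    (auto simp: scaleC_add_right scaleR_scaleC_commute norm_scaleC)

text \<open>The difference \<open>x - y\<close> is itself one of the test vectors.\<close>

lemma cinner_ext_left:
  fixes x y :: "'a::complex_hilbert_space"
  assumes "\<And>z. z \<in> S \<Longrightarrow> cinner x z = cinner y z" "x - y \<in> S"
  shows "x = y"
proof -
  have "cinner (x - y) (x - y) = 0"
    using assms(1) [OF assms(2)] by (simp add: cinner_diff_left)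
  then show ?thesis
    by (simp add: cinner_self)
qed

lemma cinner_ext_right:
  fixes x y :: "'a::complex_hilbert_space"
  assumes "\<And>z. z \<in> S \<Longrightarrow> cinner z x = cinner z y" "x - y \<in> S"
  shows "x = y"
  using assms by (intro cinner_ext_left [of S]) (metis cinner_commute)+

section \<open>Complex subspaces, linear maps and bounded operators on them\<close>

definition csubspace :: "'a::complex_hilbert_space set \<Rightarrow> bool"
  where "csubspace S \<longleftrightarrow> 0 \<in> S \<and> (\<forall>x\<in>S. \<forall>y\<in>S. x + y \<in> S) \<and> (\<forall>c. \<forall>x\<in>S. c *\<^sub>C x \<in> S)"

lemma csubspace_UNIV [simp]: "csubspace UNIV"
  by (simp add: csubspace_def)

context
  fixes S :: "'a::complex_hilbert_space set"
  assumes S: "csubspace S"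
begin

lemma csubspace_zero: "0 \<in> S"
  and csubspace_add: "x \<in> S \<Longrightarrow> y \<in> S \<Longrightarrow> x + y \<in> S"
  and csubspace_scaleC: "x \<in> S \<Longrightarrow> c *\<^sub>C x \<in> S"
  using S by (auto simp: csubspace_def)

lemma csubspace_uminus: "x \<in> S \<Longrightarrow> - x \<in> S"
  using csubspace_scaleC [of x "- 1"] by (simp add: scaleC_minus_one)

lemma csubspace_diff: "x \<in> S \<Longrightarrow> y \<in> S \<Longrightarrow> x - y \<in> S"
  using csubspace_add [of x "- y"] csubspace_uminus [of y] by simp

lemma csubspace_scaleR: "x \<in> S \<Longrightarrow> r *\<^sub>R x \<in> S"
  using csubspace_scaleC [of x "complex_of_real r"] by (simp add: scaleC_of_real)

lemma csubspace_sum: "(\<And>i. i \<in> I \<Longrightarrow> f i \<in> S) \<Longrightarrow> (\<Sum>i\<in>I. f i) \<in> S"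
  by (induction I rule: infinite_finite_induct) (auto intro: csubspace_zero csubspace_add)

end

text \<open>Linearity is separated from \<open>bounded_ops\<close> for maps such as the factor
  \<Gamma>, for which no bound is carried along.\<close>

definition clinear_on :: "'a::complex_hilbert_space set \<Rightarrow> ('a \<Rightarrow> 'b::complex_hilbert_space) \<Rightarrow> bool"
  where "clinear_on S A \<longleftrightarrow>
    (\<forall>x\<in>S. \<forall>y\<in>S. A (x + y) = A x + A y) \<and> (\<forall>c. \<forall>x\<in>S. A (c *\<^sub>C x) = c *\<^sub>C A x)"

lemma clinear_onI:
  assumes "\<And>x y. x \<in> S \<Longrightarrow> y \<in> S \<Longrightarrow> A (x + y) = A x + A y"
    and "\<And>c x. x \<in> S \<Longrightarrow> A (c *\<^sub>C x) = c *\<^sub>C A x"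
  shows "clinear_on S A"
  using assms by (simp add: clinear_on_def)

lemma clinear_on_add: "clinear_on S A \<Longrightarrow> x \<in> S \<Longrightarrow> y \<in> S \<Longrightarrow> A (x + y) = A x + A y"
  and clinear_on_scaleC: "clinear_on S A \<Longrightarrow> x \<in> S \<Longrightarrow> A (c *\<^sub>C x) = c *\<^sub>C A x"
  by (simp_all add: clinear_on_def)

lemma clinear_on_zero: "clinear_on S A \<Longrightarrow> x \<in> S \<Longrightarrow> A 0 = 0"
  using clinear_on_scaleC [of S A x 0] by simp

lemma clinear_on_uminus: "clinear_on S A \<Longrightarrow> x \<in> S \<Longrightarrow> A (- x) = - A x"
  using clinear_on_scaleC [of S A x "- 1"] by (simp add: scaleC_minus_one)

lemma clinear_on_diff:
  "csubspace S \<Longrightarrow> clinear_on S A \<Longrightarrow> x \<in> S \<Longrightarrow> y \<in> S \<Longrightarrow> A (x - y) = A x - A y"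
  using clinear_on_add [of S A x "- y"] by (simp add: csubspace_uminus clinear_on_uminus)

lemma clinear_on_scaleR: "clinear_on S A \<Longrightarrow> x \<in> S \<Longrightarrow> A (r *\<^sub>R x) = r *\<^sub>R A x"
  using clinear_on_scaleC [of S A x "complex_of_real r"] by (simp add: scaleC_of_real)

lemma clinear_on_sum:
  assumes "csubspace S" "clinear_on S A" "\<And>i. i \<in> I \<Longrightarrow> f i \<in> S"
  shows "A (\<Sum>i\<in>I. f i) = (\<Sum>i\<in>I. A (f i))"
  using assms(3)
proof (induction I rule: infinite_finite_induct)
  case (insert i I)
  then show ?case
    using assms(1,2) by (simp add: clinear_on_add csubspace_sum)
qed (use assms in \<open>auto intro: clinear_on_zero csubspace_zero\<close>)

lemma clinear_on_compose:
  "clinear_on S A \<Longrightarrow> clinear_on R C \<Longrightarrow> (\<And>x. x \<in> S \<Longrightarrow> A x \<in> R) \<Longrightarrow> clinear_on S (\<lambda>x. C (A x))"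
  by (simp add: clinear_on_def)

lemma bounded_ops_iff: "A \<in> bounded_ops S R \<longleftrightarrow>
    (\<forall>x\<in>S. A x \<in> R) \<and> clinear_on S A \<and> (\<exists>K. \<forall>x\<in>S. norm (A x) \<le> K * norm x)"
  unfolding bounded_ops_def clinear_on_def by auto

lemma bounded_opsI:
  assumes "\<And>x. x \<in> S \<Longrightarrow> A x \<in> R" "clinear_on S A" "\<And>x. x \<in> S \<Longrightarrow> norm (A x) \<le> K * norm x"
  shows "A \<in> bounded_ops S R"
  using assms by (auto simp: bounded_ops_iff)

lemma bounded_ops_mem: "A \<in> bounded_ops S R \<Longrightarrow> x \<in> S \<Longrightarrow> A x \<in> R"
  and bounded_ops_clinear_on: "A \<in> bounded_ops S R \<Longrightarrow> clinear_on S A"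
  by (simp_all add: bounded_ops_iff)

text \<open>The normalisation \<open>K \<ge> 1\<close> makes division by \<open>K\<close> possible
  in \<open>positive_op_factor\<close> and \<open>op_ball_gap\<close>.\<close>

lemma bounded_ops_bound:
  assumes "A \<in> bounded_ops S R"
  obtains K where "K \<ge> 1" "\<And>x. x \<in> S \<Longrightarrow> norm (A x) \<le> K * norm x"
proof -
  obtain K where K: "\<And>x. x \<in> S \<Longrightarrow> norm (A x) \<le> K * norm x"
    using assms by (auto simp: bounded_ops_iff)
  have "norm (A x) \<le> max K 1 * norm x" if "x \<in> S" for x
    using K [OF that] by (smt (verit) mult_right_mono norm_ge_zero)
  then show ?thesis
    using that [of "max K 1"] by simp
qed

lemma bounded_ops_bounded_linear: "A \<in> bounded_ops UNIV R \<Longrightarrow> bounded_linear A"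
  using bounded_ops_bound [of A UNIV R] bounded_ops_clinear_on [of A UNIV R]
  by (metis (no_types) UNIV_I bounded_linear_intro clinear_on_add clinear_on_scaleR mult.commute)

lemma bounded_ops_compose:
  assumes "A \<in> bounded_ops S R" "C \<in> bounded_ops R Q"
  shows "(\<lambda>x. C (A x)) \<in> bounded_ops S Q"
proof -
  obtain K1 where K1: "K1 \<ge> 1" "\<And>x. x \<in> S \<Longrightarrow> norm (A x) \<le> K1 * norm x"
    using bounded_ops_bound [OF assms(1)] by metis
  obtain K2 where K2: "K2 \<ge> 1" "\<And>x. x \<in> R \<Longrightarrow> norm (C x) \<le> K2 * norm x"
    using bounded_ops_bound [OF assms(2)] by metis
  show ?thesis
  proof (rule bounded_opsI [where K = "K2 * K1"])
    fix x assume x: "x \<in> S"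
    have "norm (C (A x)) \<le> K2 * norm (A x)"
      using K2 bounded_ops_mem [OF assms(1) x] by blast
    also have "\<dots> \<le> K2 * (K1 * norm x)"
      using K1 K2 x by (intro mult_left_mono) auto
    finally show "norm (C (A x)) \<le> K2 * K1 * norm x"
      by simp
  qed (use assms in \<open>auto simp: bounded_ops_iff intro: clinear_on_compose\<close>)
qed

lemma bounded_ops_diff:
  assumes "A \<in> bounded_ops S R" "C \<in> bounded_ops S R" "csubspace R"
  shows "(\<lambda>x. A x - C x) \<in> bounded_ops S R"
proof -
  obtain K1 where K1: "\<And>x. x \<in> S \<Longrightarrow> norm (A x) \<le> K1 * norm x"
    using bounded_ops_bound [OF assms(1)] by metis
  obtain K2 where K2: "\<And>x. x \<in> S \<Longrightarrow> norm (C x) \<le> K2 * norm x"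
    using bounded_ops_bound [OF assms(2)] by metis
  show ?thesis
  proof (rule bounded_opsI [where K = "K1 + K2"])
    fix x assume x: "x \<in> S"
    show "norm (A x - C x) \<le> (K1 + K2) * norm x"
      using K1 [OF x] K2 [OF x] norm_triangle_ineq4 [of "A x" "C x"] by (simp add: distrib_right)
  next
    show "clinear_on S (\<lambda>x. A x - C x)"
      using clinear_on_add [OF bounded_ops_clinear_on [OF assms(1)]]
        clinear_on_add [OF bounded_ops_clinear_on [OF assms(2)]]
        clinear_on_scaleC [OF bounded_ops_clinear_on [OF assms(1)]]
        clinear_on_scaleC [OF bounded_ops_clinear_on [OF assms(2)]]
      by (intro clinear_onI) (simp_all add: scaleC_diff_right)
  qed (use assms in \<open>auto simp: bounded_ops_iff intro: csubspace_diff\<close>)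
qed

text \<open>The representing vector minimises \<open>J z = \<parallel>z\<parallel>\<^sup>2 - 2 Re (f z)\<close>.\<close>

lemma riesz_representation:
  fixes f :: "'a::complex_hilbert_space \<Rightarrow> complex"
  assumes S: "csubspace S" "closed S"
    and add: "\<And>x y. x \<in> S \<Longrightarrow> y \<in> S \<Longrightarrow> f (x + y) = f x + f y"
    and scale: "\<And>c x. x \<in> S \<Longrightarrow> f (c *\<^sub>C x) = c * f x"
    and bound: "\<And>x. x \<in> S \<Longrightarrow> cmod (f x) \<le> K * norm x"
  shows "\<exists>z\<in>S. \<forall>x\<in>S. f x = cinner x z"
proof -
  define J where "J z = (norm z)\<^sup>2 - 2 * Re (f z)" for z
  have scaleR: "f (r *\<^sub>R x) = of_real r * f x" if "x \<in> S" for r x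
    using scale [OF that, of "of_real r"] by (simp add: scaleC_of_real)
  have "- K\<^sup>2 \<le> J z" if "z \<in> S" for z
  proof -
    have "Re (f z) \<le> K * norm z"
      using bound [OF that] complex_Re_le_cmod [of "f z"] by linarith
    then show ?thesis
      using zero_le_power2 [of "norm z - K"] by (simp add: J_def power2_diff algebra_simps)
  qed
  then have bdd: "bdd_below (J ` S)"
    by (auto intro!: bdd_belowI2)
  define m where "m = Inf (J ` S)"
  have m_le: "m \<le> J z" if "z \<in> S" for z
    unfolding m_def using bdd that by (intro cInf_lower) auto
  have "\<exists>z\<in>S. J z < m + inverse (real (Suc n))" for n
  proof -
    have "\<exists>y\<in>J ` S. y < m + inverse (real (Suc n))"
      unfolding m_def using csubspace_zero [OF S(1)]
      by (intro cInf_lessD) (auto simp del: of_nat_Suc)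
    then show ?thesis by blast
  qed
  then obtain z where z: "\<And>n. z n \<in> S" "\<And>n. J (z n) < m + inverse (real (Suc n))"
    by metis
  \<comment> \<open>The parallelogram law; the linear part of \<open>J\<close> cancels, so only
    values of \<open>J\<close> remain.\<close>
  have mid: "(norm (x - y))\<^sup>2 = 2 * J x + 2 * J y - 4 * J ((1/2) *\<^sub>R (x + y))" if "x \<in> S" "y \<in> S" for x y
  proof -
    have "f ((1/2) *\<^sub>R (x + y)) = of_real (1/2) * (f x + f y)"
      using that by (simp only: scaleR csubspace_add [OF S(1)] add)
    then have "Re (f ((1/2) *\<^sub>R (x + y))) = (Re (f x) + Re (f y)) / 2"
      by (simp only: times_complex.sel plus_complex.sel Re_complex_of_real Im_complex_of_real mult_zero_left diff_zero times_divide_eq_left mult_1_left)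
    moreover have "(norm ((1/2) *\<^sub>R (x + y)))\<^sup>2 = (norm (x + y))\<^sup>2 / 4"
      by (simp add: power_divide)
    ultimately show ?thesis
      using parallelogram_law [of x y] by (simp add: J_def)
  qed
  \<comment> \<open>Two near-minimisers are close, because \<open>J\<close> at their midpoint is at
    least \<open>m\<close>.\<close>
  have close: "(norm (z i - z j))\<^sup>2 \<le> 4 * inverse (real (Suc n))" if "i \<ge> n" "j \<ge> n" for i j n
  proof -
    have "inverse (real (Suc i)) \<le> inverse (real (Suc n))" "inverse (real (Suc j)) \<le> inverse (real (Suc n))"
      using that by (simp_all add: le_imp_inverse_le)
    moreover have "m \<le> J ((1/2) *\<^sub>R (z i + z j))"
      by (intro m_le csubspace_scaleR [OF S(1)] csubspace_add [OF S(1)] z)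
    ultimately show ?thesis
      using z(2) [of i] z(2) [of j] mid [OF z(1) z(1), of i j] by linarith
  qed
  have "Cauchy z"
  proof (rule metric_CauchyI)
    fix e :: real assume e: "0 < e"
    then obtain n where n: "inverse (real (Suc n)) < e\<^sup>2 / 4"
      using reals_Archimedean [of "e\<^sup>2 / 4"] by auto
    show "\<exists>M. \<forall>m\<ge>M. \<forall>n\<ge>M. dist (z m) (z n) < e"
    proof (intro exI [of _ n] allI impI)
      fix i j assume "n \<le> i" "n \<le> j"
      then have "(norm (z i - z j))\<^sup>2 < e\<^sup>2"
        using close [of n i j] n by linarith
      then show "dist (z i) (z j) < e"
        using e by (simp add: dist_norm power2_less_imp_less)
    qed
  qed
  then obtain w where w: "z \<longlonglongrightarrow> w"
    using Cauchy_convergent_iff convergent_def by blast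
  have wS: "w \<in> S"
    using closed_sequentially [OF S(2) _ w] z(1) by blast
  have fdiff: "f (x - y) = f x - f y" if "x \<in> S" "y \<in> S" for x y
    using add [of "x - y" y] that csubspace_diff [OF S(1)] by simp
  have "(\<lambda>n. f (z n)) \<longlonglongrightarrow> f w"
  proof (rule Lim_transform_bound [of _ "\<lambda>n. K * norm (z n - w)" , THEN LIM_zero_cancel])
    show "\<forall>\<^sub>F n in sequentially. norm (f (z n) - f w) \<le> norm (K * norm (z n - w))"
    proof (intro always_eventually allI)
      show "norm (f (z n) - f w) \<le> norm (K * norm (z n - w))" for n
        using bound [OF csubspace_diff [OF S(1) z(1) wS], of n] abs_ge_self [of "K * norm (z n - w)"]
        unfolding fdiff [OF z(1) wS, symmetric] real_norm_def by linarith
    qed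
    show "(\<lambda>n. K * norm (z n - w)) \<longlonglongrightarrow> 0"
      using tendsto_mult_right_zero tendsto_norm_zero [OF LIM_zero [OF w]] by blast
  qed
  then have "(\<lambda>n. J (z n)) \<longlonglongrightarrow> J w"
    unfolding J_def by (intro tendsto_intros w)
  moreover have "(\<lambda>n. m + inverse (real (Suc n))) \<longlonglongrightarrow> m + 0"
    by (intro tendsto_intros LIMSEQ_inverse_real_of_nat)
  ultimately have "J w \<le> m + 0"
    by (rule LIMSEQ_le) (use z(2) in \<open>auto intro: less_imp_le\<close>)
  then have min: "J w \<le> J x" if "x \<in> S" for x
    using m_le [OF that] by simp
  have Re: "Re (f x) = Re (cinner x w)" if x: "x \<in> S" for x
  proof (rule ccontr)
    define d where "d = Re (f x) - Re (cinner x w)"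
    assume "Re (f x) \<noteq> Re (cinner x w)"
    then have d: "d \<noteq> 0" by (simp add: d_def)
    \<comment> \<open>The quadratic in \<open>t\<close> is minimal at
      \<open>d / (norm x)\<^sup>2\<close>. Adding 1 to the denominator covers \<open>x = 0\<close>
      and still gives a decrease.\<close>
    define t where "t = d / ((norm x)\<^sup>2 + 1)"
    have pos: "(norm x)\<^sup>2 + 1 > 0"
      by (simp add: add_nonneg_pos)
    have "J (w + t *\<^sub>R x) = J w + t\<^sup>2 * (norm x)\<^sup>2 - 2 * t * d"
      using x wS by (simp add: J_def norm_add_sq cinner_scaleR_right add csubspace_scaleR [OF S(1)]
          scaleR d_def Re_cinner_commute [of w x] power_mult_distrib algebra_simps)
    then have "2 * t * d \<le> t\<^sup>2 * (norm x)\<^sup>2"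
      using min [of "w + t *\<^sub>R x"] x wS by (simp add: csubspace_add [OF S(1)] csubspace_scaleR [OF S(1)])
    also have "\<dots> \<le> t\<^sup>2 * ((norm x)\<^sup>2 + 1)"
      by (intro mult_left_mono) auto
    also have "\<dots> = t * d"
      using pos by (simp add: t_def power2_eq_square)
    finally have "t * d \<le> 0" by linarith
    moreover have "t * d = d\<^sup>2 / ((norm x)\<^sup>2 + 1)"
      by (simp add: t_def power2_eq_square)
    ultimately show False
      using d pos by (simp add: divide_le_0_iff)
  qed
  have "f x = cinner x w" if x: "x \<in> S" for x
  proof (rule complex_eqI)
    \<comment> \<open>Multiplication by \<i> turns imaginary parts into real ones, up to
      sign.\<close>
    have "Re (f (\<i> *\<^sub>C x)) = Re (cinner (\<i> *\<^sub>C x) w)"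
      using x by (intro Re csubspace_scaleC [OF S(1)])
    then show "Im (f x) = Im (cinner x w)"
      by (simp add: scale [OF x] cinner_scaleC_left)
  qed (rule Re [OF x])
  with wS show ?thesis by blast
qed

section \<open>Adjoints, orthogonal projections and extension of contractions\<close>

lemma adj_ex1:
  assumes S: "csubspace S" "closed S" and A: "A \<in> bounded_ops S R"
  shows "\<exists>!z. z \<in> S \<and> (\<forall>x\<in>S. cinner (A x) y = cinner x z)"
proof -
  obtain K where K: "K \<ge> 1" "\<And>x. x \<in> S \<Longrightarrow> norm (A x) \<le> K * norm x"
    using bounded_ops_bound [OF A] by metis
  \<comment> \<open>The functional represented is \<open>x \<mapsto> cinner (A x) y\<close>.
    Together with uniqueness this makes the description in \<open>adj\<close> denote.\<close>
  have "\<exists>z\<in>S. \<forall>x\<in>S. cinner (A x) y = cinner x z"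
  proof (rule riesz_representation [OF S, where K = "K * norm y"])
    fix x assume "x \<in> S"
    then have "norm (A x) * norm y \<le> K * norm x * norm y"
      by (intro mult_right_mono K) auto
    then show "cmod (cinner (A x) y) \<le> K * norm y * norm x"
      using cinner_norm_le [of "A x" y] by (simp add: mult_ac)
  qed (simp_all add: clinear_on_add [OF bounded_ops_clinear_on [OF A]] cinner_add_left
      clinear_on_scaleC [OF bounded_ops_clinear_on [OF A]] cinner_scaleC_left)
  moreover have "z = z'" if "z \<in> S" "z' \<in> S" "\<forall>x\<in>S. cinner x z = cinner x z'" for z z'
    using that by (intro cinner_ext_right [of S]) (auto intro: csubspace_diff [OF S(1)])
  ultimately show ?thesis
    by (metis (no_types, lifting))
qed

lemma adj_mem: "csubspace S \<Longrightarrow> closed S \<Longrightarrow> A \<in> bounded_ops S R \<Longrightarrow> adj S A y \<in> S"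
  and cinner_adj: "csubspace S \<Longrightarrow> closed S \<Longrightarrow> A \<in> bounded_ops S R \<Longrightarrow> x \<in> S \<Longrightarrow>
    cinner (A x) y = cinner x (adj S A y)"
  unfolding adj_def using theI' [OF adj_ex1 [of S A R y]] by auto

lemma cinner_adj_left:
  "csubspace S \<Longrightarrow> closed S \<Longrightarrow> A \<in> bounded_ops S R \<Longrightarrow> x \<in> S \<Longrightarrow>
    cinner (adj S A y) x = cinner y (A x)"
  by (metis cinner_adj cinner_commute)

text \<open>An adjoint is identified from its defining identity alone; the adjoints of
  \<open>F_row\<close> and \<open>L_row\<close> are computed in this way.\<close>

lemma adj_eqI:
  assumes "csubspace S" "z \<in> S" "\<And>x. x \<in> S \<Longrightarrow> cinner (A x) y = cinner x z"
  shows "adj S A y = z"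
  unfolding adj_def
proof (rule the_equality)
  fix z' assume "z' \<in> S \<and> (\<forall>x\<in>S. cinner (A x) y = cinner x z')"
  then show "z' = z"
    using assms by (intro cinner_ext_right [of S]) (auto intro: csubspace_diff)
qed (use assms in auto)

lemma adj_bounded_ops:
  assumes S: "csubspace S" "closed S" and A: "A \<in> bounded_ops S R"
  shows "adj S A \<in> bounded_ops UNIV S"
proof -
  note adj = adj_mem [OF S A] cinner_adj [OF S A]
  obtain K where K: "K \<ge> 1" "\<And>x. x \<in> S \<Longrightarrow> norm (A x) \<le> K * norm x"
    using bounded_ops_bound [OF A] by metis
  show ?thesis
  proof (rule bounded_opsI [where K = K])
    show "clinear_on UNIV (adj S A)"
      by (intro clinear_onI adj_eqI)
        (auto simp: S adj cinner_add_right cinner_scaleC_right csubspace_add csubspace_scaleC)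
    fix y
    let ?z = "adj S A y"
    have "(norm ?z)\<^sup>2 = Re (cinner (A ?z) y)"
      by (simp add: adj Re_cinner_self)
    also have "\<dots> \<le> norm (A ?z) * norm y"
      using complex_Re_le_cmod cinner_norm_le order_trans by blast
    also have "\<dots> \<le> K * norm ?z * norm y"
      by (intro mult_right_mono K adj) auto
    finally have "norm ?z * norm ?z \<le> norm ?z * (K * norm y)"
      by (simp add: power2_eq_square mult_ac)
    then show "norm ?z \<le> K * norm y"
      using K(1) by (cases "norm ?z = 0") auto
  qed (rule adj)
qed

text \<open>The projection of \<open>x\<close> is the vector representing
  \<open>m \<mapsto> cinner m x\<close> on \<open>S\<close>.\<close>

lemma orthogonal_projection:
  fixes x :: "'a::complex_hilbert_space"
  assumes S: "csubspace S" "closed S"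
  shows "\<exists>p\<in>S. \<forall>m\<in>S. cinner m x = cinner m p"
  by (rule riesz_representation [OF S, where K = "norm x"])
    (auto simp: cinner_add_left cinner_scaleC_left intro: cinner_norm_le [THEN order_trans])

text \<open>Applied to differences, \<open>le\<close> shows that \<open>G h \<mapsto> R h\<close> is
  a well-defined contraction on the range of \<open>G\<close>. It extends by continuity to the
  closure, and composing with the orthogonal projection makes it zero on the complement.\<close>

lemma contraction_extension:
  fixes G :: "'h::complex_hilbert_space \<Rightarrow> 'x::complex_hilbert_space"
    and R :: "'h \<Rightarrow> 'y::complex_hilbert_space"
  assumes S: "csubspace S" and G: "clinear_on S G" and R: "clinear_on S R"
    and le: "\<And>h. h \<in> S \<Longrightarrow> norm (R h) \<le> norm (G h)"
  obtains W where "clinear_on UNIV W" "\<And>x. norm (W x) \<le> norm x" "\<And>h. h \<in> S \<Longrightarrow> W (G h) = R h"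
proof -
  \<comment> \<open>The closure of the graph of \<open>G h \<mapsto> R h\<close>. Working with a
    relation avoids choosing preimages under \<open>G\<close>, and linearity can be checked before
    single-valuedness.\<close>
  define L where "L p w \<longleftrightarrow> (\<exists>h. (\<forall>n. h n \<in> S) \<and> (\<lambda>n. G (h n)) \<longlonglongrightarrow> p \<and> (\<lambda>n. R (h n)) \<longlonglongrightarrow> w)"
    for p w
  have L_base: "L (G h) (R h)" if "h \<in> S" for h
    unfolding L_def using that by (intro exI [of _ "\<lambda>_. h"]) simp
  have L_add: "L (p + p') (w + w')" if L: "L p w" "L p' w'" for p p' w w'
  proof -
    obtain h h' where h: "\<And>n. h n \<in> S" "(\<lambda>n. G (h n)) \<longlonglongrightarrow> p" "(\<lambda>n. R (h n)) \<longlonglongrightarrow> w"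
      and h': "\<And>n. h' n \<in> S" "(\<lambda>n. G (h' n)) \<longlonglongrightarrow> p'" "(\<lambda>n. R (h' n)) \<longlonglongrightarrow> w'"
      using L unfolding L_def by blast
    have "(\<lambda>n. G (h n + h' n)) \<longlonglongrightarrow> p + p'" "(\<lambda>n. R (h n + h' n)) \<longlonglongrightarrow> w + w'"
      using h h' by (simp_all add: clinear_on_add [OF G] clinear_on_add [OF R] tendsto_add)
    then show ?thesis
      unfolding L_def using h h' csubspace_add [OF S] by (intro exI [of _ "\<lambda>n. h n + h' n"]) simp
  qed
  have L_scale: "L (c *\<^sub>C p) (c *\<^sub>C w)" if L: "L p w" for c p w
  proof -
    obtain h where h: "\<And>n. h n \<in> S" "(\<lambda>n. G (h n)) \<longlonglongrightarrow> p" "(\<lambda>n. R (h n)) \<longlonglongrightarrow> w"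
      using L unfolding L_def by blast
    have "(\<lambda>n. G (c *\<^sub>C h n)) \<longlonglongrightarrow> c *\<^sub>C p" "(\<lambda>n. R (c *\<^sub>C h n)) \<longlonglongrightarrow> c *\<^sub>C w"
      using h bounded_linear.tendsto [OF bounded_linear_scaleC]
      by (simp_all add: clinear_on_scaleC [OF G] clinear_on_scaleC [OF R])
    then show ?thesis
      unfolding L_def using h csubspace_scaleC [OF S] by (intro exI [of _ "\<lambda>n. c *\<^sub>C h n"]) simp
  qed
  have L_norm: "norm w \<le> norm p" if L: "L p w" for p w
  proof -
    obtain h where h: "\<And>n. h n \<in> S" "(\<lambda>n. G (h n)) \<longlonglongrightarrow> p" "(\<lambda>n. R (h n)) \<longlonglongrightarrow> w"
      using L unfolding L_def by blast
    show ?thesis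
      by (rule LIMSEQ_le [OF tendsto_norm [OF h(3)] tendsto_norm [OF h(2)]]) (simp add: le h(1))
  qed
  \<comment> \<open>The graph contains the pair of 0 and \<open>w - w'\<close>, so the norm bound
    forces \<open>w = w'\<close>.\<close>
  have L_unique: "w = w'" if "L p w" "L p w'" for p w w'
    using L_norm [OF L_add [OF that(1) L_scale [OF that(2), of "- 1"]]] by (simp add: scaleC_minus_one)
  define M where "M = closure (G ` S)"
  have M_iff: "p \<in> M \<longleftrightarrow> (\<exists>w. L p w)" for p
  proof
    assume "p \<in> M"
    then obtain y where y: "\<And>n. y n \<in> G ` S" "y \<longlonglongrightarrow> p"
      unfolding M_def closure_sequential by blast
    have "\<forall>n. \<exists>x. x \<in> S \<and> y n = G x"
      using y(1) by blast
    then obtain h where h: "\<And>n. h n \<in> S" "\<And>n. y n = G (h n)"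
      by metis
    have "Cauchy (\<lambda>n. R (h n))"
    proof (rule metric_CauchyI)
      fix e :: real assume "0 < e"
      then obtain N where N: "\<And>m n. m \<ge> N \<Longrightarrow> n \<ge> N \<Longrightarrow> dist (y m) (y n) < e"
        using metric_CauchyD [OF LIMSEQ_imp_Cauchy [OF y(2)]] by blast
      have "dist (R (h m)) (R (h n)) \<le> dist (y m) (y n)" for m n
        using le [OF csubspace_diff [OF S h(1) h(1)], of m n]
        by (simp add: h(2) dist_norm clinear_on_diff [OF S R h(1) h(1)] clinear_on_diff [OF S G h(1) h(1)])
      then show "\<exists>N. \<forall>m\<ge>N. \<forall>n\<ge>N. dist (R (h m)) (R (h n)) < e"
        using N by (intro exI [of _ N] allI impI) (rule le_less_trans)
    qed
    then obtain w where "(\<lambda>n. R (h n)) \<longlonglongrightarrow> w"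
      using Cauchy_convergent_iff convergent_def by blast
    moreover have "y = (\<lambda>n. G (h n))"
      using h(2) by (rule ext)
    ultimately show "\<exists>w. L p w"
      unfolding L_def using h(1) y(2) by blast
  next
    assume "\<exists>w. L p w"
    then obtain h where "\<And>n. h n \<in> S" "(\<lambda>n. G (h n)) \<longlonglongrightarrow> p"
      unfolding L_def by blast
    then show "p \<in> M"
      unfolding M_def closure_sequential by (intro exI [of _ "\<lambda>n. G (h n)"]) simp
  qed
  have M: "csubspace M"
    unfolding csubspace_def
  proof (intro conjI ballI allI)
    show "0 \<in> M"
      using L_base [OF csubspace_zero [OF S]] clinear_on_zero [OF G csubspace_zero [OF S]] M_iff by metis
    show "x + y \<in> M" if "x \<in> M" "y \<in> M" for x y
      using that L_add unfolding M_iff by blast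
    show "c *\<^sub>C x \<in> M" if "x \<in> M" for c x
      using that L_scale unfolding M_iff by blast
  qed
  have "closed M" by (simp add: M_def)
  then obtain P where P: "\<And>x. P x \<in> M" "\<And>x m. m \<in> M \<Longrightarrow> cinner m x = cinner m (P x)"
    using orthogonal_projection [OF M] by metis
  have P_eqI: "P x = p" if "p \<in> M" "\<And>m. m \<in> M \<Longrightarrow> cinner m x = cinner m p" for x p
    using that P(1) by (intro cinner_ext_right [of M]) (auto simp: P(2) [symmetric] intro: csubspace_diff [OF M])
  have P_norm: "norm (P x) \<le> norm x" for x
  proof -
    have "(norm (P x))\<^sup>2 = Re (cinner (P x) x)"
      by (simp add: P(1) P(2) [of "P x", symmetric] Re_cinner_self [symmetric])
    also have "\<dots> \<le> norm (P x) * norm x"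
      using complex_Re_le_cmod cinner_norm_le order_trans by blast
    finally show ?thesis
      by (cases "norm (P x) = 0") (auto simp: power2_eq_square)
  qed
  have "\<exists>w. L (P x) w" for x
    using P(1) unfolding M_iff .
  then obtain W where W: "\<And>x. L (P x) (W x)"
    by metis
  show ?thesis
  proof (rule that)
    show "clinear_on UNIV W"
    proof (rule clinear_onI)
      fix x y
      have "P (x + y) = P x + P y"
        by (intro P_eqI) (simp_all add: P(1) P(2) [symmetric] csubspace_add [OF M] cinner_add_right)
      then show "W (x + y) = W x + W y"
        using L_unique [OF W [of "x + y"]] L_add [OF W [of x] W [of y]] by simp
    next
      fix c x
      have "P (c *\<^sub>C x) = c *\<^sub>C P x"
        by (intro P_eqI) (simp_all add: P(1) P(2) [symmetric] csubspace_scaleC [OF M] cinner_scaleC_right)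
      then show "W (c *\<^sub>C x) = c *\<^sub>C W x"
        using L_unique [OF W [of "c *\<^sub>C x"]] L_scale [OF W [of x]] by simp
    qed
    show "norm (W x) \<le> norm x" for x
      using L_norm [OF W] P_norm order_trans by blast
    fix h assume h: "h \<in> S"
    have "P (G h) = G h"
      using L_base [OF h] M_iff by (intro P_eqI) auto
    then show "W (G h) = R h"
      using L_unique [OF W [of "G h"]] L_base [OF h] by simp
  qed
qed


section \<open>Factorisation of positive operators\<close>

text \<open>Polarisation: realness of the quadratic form at \<open>x + y\<close> compares the
  imaginary parts, and at \<open>x + \<i> *\<^sub>C y\<close> the real parts.\<close>

lemma positive_op_symmetric:
  assumes S: "csubspace S" and A: "positive_op S A" and x: "x \<in> S" and y: "y \<in> S"
  shows "cinner (A x) y = cinner x (A y)"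
proof -
  have lin: "clinear_on S A" and real: "\<And>x. x \<in> S \<Longrightarrow> Im (cinner (A x) x) = 0"
    using A by (auto simp: positive_op_def bounded_ops_iff)
  note [simp] = clinear_on_add [OF lin] clinear_on_scaleC [OF lin]
  have 1: "Im (cinner (A x) y) + Im (cinner (A y) x) = 0"
    using real [of "x + y"] real [of x] real [of y] x y csubspace_add [OF S x y]
    by (simp add: cinner_add_left cinner_add_right)
  have 2: "Re (cinner (A y) x) - Re (cinner (A x) y) = 0"
    using real [of "x + \<i> *\<^sub>C y"] real [of x] real [of y] x y csubspace_scaleC [OF S y, of \<i>]
      csubspace_add [OF S x csubspace_scaleC [OF S y, of \<i>]]
    by (simp add: cinner_add_left cinner_add_right cinner_scaleC_left cinner_scaleC_right)
  have "cinner (A x) y = cnj (cinner (A y) x)"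
    using 1 2 by (intro complex_eqI) auto
  then show ?thesis
    using cinner_commute [of x "A y"] by simp
qed

text \<open>\<open>A - A\<^sup>2 = A (1 - A) A + (1 - A) A (1 - A)\<close>\<close>

lemma norm_sq_le_of_le_one:
  assumes S: "csubspace S" and A: "positive_op S A"
    and le: "\<And>x. x \<in> S \<Longrightarrow> Re (cinner (A x) x) \<le> (norm x)\<^sup>2" and x: "x \<in> S"
  shows "(norm (A x))\<^sup>2 \<le> Re (cinner (A x) x)"
proof -
  have lin: "clinear_on S A" and mem: "\<And>x. x \<in> S \<Longrightarrow> A x \<in> S"
    using A by (auto simp: positive_op_def bounded_ops_iff)
  \<comment> \<open>The summand \<open>(1 - A) A (1 - A)\<close>; the other summand is nonnegative
    by \<open>le\<close> at \<open>A x\<close>.\<close>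
  have "0 \<le> Re (cinner (A (x - A x)) (x - A x))"
    using A csubspace_diff [OF S x mem [OF x]] by (auto simp: positive_op_def)
  also have "\<dots> = Re (cinner (A x) x) - 2 * (norm (A x))\<^sup>2 + Re (cinner (A (A x)) (A x))"
    using positive_op_symmetric [OF S A mem [OF x] x]
    by (simp add: clinear_on_diff [OF S lin x mem [OF x]] cinner_diff_left cinner_diff_right Re_cinner_self)
  finally show ?thesis
    using le [OF mem [OF x]] by simp
qed

text \<open>
  Iterating \<open>A\<^sub>n\<^sub>+\<^sub>1 = A\<^sub>n - A\<^sub>n\<^sup>2\<close> from a contraction \<open>A\<^sub>0\<close> gives \<open>A\<^sub>0 = \<Sum> A\<^sub>n\<^sup>2\<close>, so that
  \<open>\<Gamma> x = (A\<^sub>n x)\<^sub>n\<close> satisfies \<open>\<Gamma>\<^sup>*\<Gamma> = A\<^sub>0\<close>; this replaces the square root.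
\<close>

lemma positive_op_factor_contraction:
  fixes A :: "'a::complex_hilbert_space \<Rightarrow> 'a"
  assumes S: "csubspace S" and A: "positive_op S A"
    and le: "\<And>x. x \<in> S \<Longrightarrow> Re (cinner (A x) x) \<le> (norm x)\<^sup>2"
  obtains \<Gamma> :: "'a \<Rightarrow> (nat, 'a) ell2"
    where "clinear_on S \<Gamma>" "\<And>x. x \<in> S \<Longrightarrow> (norm (\<Gamma> x))\<^sup>2 = Re (cinner (A x) x)"
proof -
  define I where "I = rec_nat A (\<lambda>_ X x. X x - X (X x))"
  have I_0: "I 0 = A" and I_Suc: "I (Suc n) = (\<lambda>x. I n x - I n (I n x))" for n
    by (simp_all add: I_def)
  have I: "positive_op S (I n) \<and> (\<forall>x\<in>S. Re (cinner (I n x) x) \<le> (norm x)\<^sup>2)" for n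
  proof (induction n)
    case 0
    then show ?case using A le by (simp add: I_0)
  next
    case (Suc n)
    then have pos: "positive_op S (I n)" and le1: "\<And>x. x \<in> S \<Longrightarrow> Re (cinner (I n x) x) \<le> (norm x)\<^sup>2"
      by auto
    have op: "I n \<in> bounded_ops S S" and im: "\<And>x. x \<in> S \<Longrightarrow> Im (cinner (I n x) x) = 0"
      using pos by (auto simp: positive_op_def)
    \<comment> \<open>Positivity of the next iterate thus amounts to
      \<open>norm_sq_le_of_le_one\<close> for the present one.\<close>
    have eq: "cinner (I (Suc n) x) x = cinner (I n x) x - of_real ((norm (I n x))\<^sup>2)" if "x \<in> S" for x
      using positive_op_symmetric [OF S pos bounded_ops_mem [OF op that] that]
      by (simp add: I_Suc cinner_diff_left cinner_self)
    have "I (Suc n) \<in> bounded_ops S S"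
      unfolding I_Suc by (intro bounded_ops_diff bounded_ops_compose [OF op op] op S)
    moreover have "Re (cinner (I n x) x) - (norm (I n x))\<^sup>2 \<le> (norm x)\<^sup>2" if "x \<in> S" for x
      using le1 [OF that] by (smt (verit) zero_le_power2)
    ultimately show ?case
      using norm_sq_le_of_le_one [OF S pos le1] im unfolding positive_op_def
      by (simp add: eq)
  qed
  have I_lin: "clinear_on S (I n)" and I_mem: "x \<in> S \<Longrightarrow> I n x \<in> S" for n x
    using I [of n] by (auto simp: positive_op_def bounded_ops_iff)
  have telescope: "(\<Sum>n<m. (norm (I n x))\<^sup>2) = Re (cinner (A x) x) - Re (cinner (I m x) x)" if "x \<in> S" for m x
  proof (induction m)
    case (Suc m)
    have "Re (cinner (I m (I m x)) x) = (norm (I m x))\<^sup>2"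
      using positive_op_symmetric [OF S _ I_mem [OF that] that, of "I m" m] I [of m]
      by (simp add: Re_cinner_self)
    then show ?case
      using Suc by (simp add: I_Suc cinner_diff_left)
  qed (simp add: I_0)
  have sums: "(\<lambda>n. (norm (I n x))\<^sup>2) sums Re (cinner (A x) x)" if x: "x \<in> S" for x
  proof -
    have "summable (\<lambda>n. (norm (I n x))\<^sup>2)"
    proof (rule summableI_nonneg_bounded)
      show "(\<Sum>n<m. (norm (I n x))\<^sup>2) \<le> Re (cinner (A x) x)" for m
        using telescope [OF x, of m] I [of m] x by (simp add: positive_op_def)
    qed simp
    \<comment> \<open>The terms of a convergent series tend to 0, so \<open>I n x\<close> does, and
      with it the remainder \<open>cinner (I n x) x\<close> of the telescoping sum.\<close>
    then have "(\<lambda>n. sqrt ((norm (I n x))\<^sup>2)) \<longlonglongrightarrow> sqrt 0"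
      by (intro tendsto_real_sqrt summable_LIMSEQ_zero)
    then have "(\<lambda>n. norm (I n x) * norm x) \<longlonglongrightarrow> 0"
      by (intro tendsto_mult_left_zero) simp
    then have "(\<lambda>n. cmod (cinner (I n x) x)) \<longlonglongrightarrow> 0"
      by (rule Lim_null_comparison [where g = "\<lambda>n. norm (I n x) * norm x", rotated])
        (simp add: cinner_norm_le)
    then have "(\<lambda>n. cinner (I n x) x) \<longlonglongrightarrow> 0"
      by (simp only: tendsto_norm_zero_iff)
    then have "(\<lambda>n. Re (cinner (I n x) x)) \<longlonglongrightarrow> Re 0"
      by (rule tendsto_Re)
    then have "(\<lambda>m. Re (cinner (A x) x) - Re (cinner (I m x) x)) \<longlonglongrightarrow> Re (cinner (A x) x) - Re 0"
      by (intro tendsto_diff tendsto_const)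
    then show ?thesis
      by (simp add: sums_def telescope [OF x])
  qed
  then have has: "((\<lambda>n. (norm (I n x))\<^sup>2) has_sum Re (cinner (A x) x)) UNIV" if "x \<in> S" for x
    using that by (intro sums_nonneg_imp_has_sum) auto
  define \<Gamma> where "\<Gamma> x = Abs_ell2 (\<lambda>n. I n x)" for x
  have coord: "coord (\<Gamma> x) n = I n x" if "x \<in> S" for x n
    unfolding \<Gamma>_def using has [OF that] by (subst Abs_ell2_inverse) (auto simp: has_sum_imp_summable)
  show ?thesis
  proof (rule that)
    show "clinear_on S \<Gamma>"
      by (intro clinear_onI ell2_eqI)
        (simp_all add: coord coord_scaleC S csubspace_add csubspace_scaleC
          clinear_on_add [OF I_lin] clinear_on_scaleC [OF I_lin])
    show "(norm (\<Gamma> x))\<^sup>2 = Re (cinner (A x) x)" if "x \<in> S" for x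
      using infsumI [OF has [OF that]] that I [of 0]
      by (simp add: norm_ell2_def coord positive_op_def I_0)
  qed
qed

text \<open>Division by a norm bound \<open>K\<close> reduces this to the contractive case; the
  factor is then multiplied by \<open>sqrt K\<close>.\<close>

lemma positive_op_factor:
  fixes A :: "'a::complex_hilbert_space \<Rightarrow> 'a"
  assumes S: "csubspace S" and A: "positive_op S A"
  obtains \<Gamma> :: "'a \<Rightarrow> (nat, 'a) ell2"
    where "clinear_on S \<Gamma>" "\<And>x. x \<in> S \<Longrightarrow> (norm (\<Gamma> x))\<^sup>2 = Re (cinner (A x) x)"
proof -
  have op: "A \<in> bounded_ops S S"
    using A by (simp add: positive_op_def)
  obtain K where K: "K \<ge> 1" "\<And>x. x \<in> S \<Longrightarrow> norm (A x) \<le> K * norm x"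
    using bounded_ops_bound [OF op] by metis
  define A' where "A' x = (1 / K) *\<^sub>R A x" for x
  have "norm (A' x) \<le> norm x" if "x \<in> S" for x
    using K(1) K(2) [OF that] by (simp add: A'_def field_simps)
  moreover have "clinear_on S A'"
    using clinear_on_add [OF bounded_ops_clinear_on [OF op]] clinear_on_scaleC [OF bounded_ops_clinear_on [OF op]]
    by (intro clinear_onI) (simp_all add: A'_def scaleR_add_right scaleR_scaleC_commute)
  ultimately have op': "A' \<in> bounded_ops S S"
    using bounded_ops_mem [OF op] by (intro bounded_opsI [where K = 1]) (auto simp: A'_def csubspace_scaleR [OF S])
  have cinner: "cinner (A' x) x = of_real (1 / K) * cinner (A x) x" for x
    by (simp only: A'_def cinner_scaleR_left)
  have le: "Re (cinner (A' x) x) \<le> (norm x)\<^sup>2" if "x \<in> S" for x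
  proof -
    have "Re (cinner (A' x) x) \<le> norm (A' x) * norm x"
      using complex_Re_le_cmod cinner_norm_le order_trans by blast
    also have "\<dots> \<le> norm x * norm x"
      by (intro mult_right_mono \<open>\<And>x. x \<in> S \<Longrightarrow> norm (A' x) \<le> norm x\<close> that) auto
    finally show ?thesis by (simp add: power2_eq_square)
  qed
  have "positive_op S A'"
    using op' A K(1) by (auto simp: positive_op_def cinner simp del: of_real_divide)
  then obtain \<Gamma> :: "'a \<Rightarrow> (nat, 'a) ell2" where \<Gamma>: "clinear_on S \<Gamma>"
    "\<And>x. x \<in> S \<Longrightarrow> (norm (\<Gamma> x))\<^sup>2 = Re (cinner (A' x) x)"
    using positive_op_factor_contraction [OF S _ le] by metis
  show ?thesis
  proof (rule that)
    show "clinear_on S (\<lambda>x. sqrt K *\<^sub>R \<Gamma> x)"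
      using clinear_on_add [OF \<Gamma>(1)] clinear_on_scaleC [OF \<Gamma>(1)]
      by (intro clinear_onI) (simp_all add: scaleR_add_right scaleR_scaleC_commute)
    show "(norm (sqrt K *\<^sub>R \<Gamma> x))\<^sup>2 = Re (cinner (A x) x)" if "x \<in> S" for x
      using K(1) by (simp add: power_mult_distrib \<Gamma>(2) [OF that] cinner)
  qed
qed

section \<open>Direct sums of two Hilbert spaces, pairing states with inputs or outputs\<close>

instantiation prod :: (complex_hilbert_space, complex_hilbert_space) complex_hilbert_space
begin

definition scaleC_prod :: "complex \<Rightarrow> 'a \<times> 'b \<Rightarrow> 'a \<times> 'b"
  where "scaleC_prod c x = (c *\<^sub>C fst x, c *\<^sub>C snd x)"

definition cinner_prod :: "'a \<times> 'b \<Rightarrow> 'a \<times> 'b \<Rightarrow> complex"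
  where "cinner_prod x y = cinner (fst x) (fst y) + cinner (snd x) (snd y)"

instance
proof
  fix x y z :: "'a \<times> 'b" and r :: real and c d :: complex
  show "complex_of_real r *\<^sub>C x = r *\<^sub>R x"
    by (simp add: scaleC_prod_def scaleC_of_real scaleR_prod_def)
  show "c *\<^sub>C (x + y) = c *\<^sub>C x + c *\<^sub>C y" "(c + d) *\<^sub>C x = c *\<^sub>C x + d *\<^sub>C x"
    "c *\<^sub>C (d *\<^sub>C x) = (c * d) *\<^sub>C x"
    by (simp_all add: scaleC_prod_def scaleC_add_right scaleC_add_left scaleC_scaleC)
  show "cinner x y = cnj (cinner y x)"
    using cinner_commute [of "fst x"] cinner_commute [of "snd x"] by (simp add: cinner_prod_def)
  show "cinner (x + y) z = cinner x z + cinner y z" "cinner (c *\<^sub>C x) y = c * cinner x y"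
    by (simp_all add: cinner_prod_def cinner_add_left cinner_scaleC_left scaleC_prod_def distrib_left)
  show "cinner x x = complex_of_real ((norm x)\<^sup>2)"
    by (simp add: cinner_prod_def cinner_self norm_prod_def)
qed

end

lemma norm_Pair_sq: "(norm (x, y))\<^sup>2 = (norm x)\<^sup>2 + (norm y)\<^sup>2"
  by (simp add: norm_prod_def)

lemma scaleC_Pair [simp]: "c *\<^sub>C (x, y) = (c *\<^sub>C x, c *\<^sub>C y)"
  by (simp add: scaleC_prod_def)


section \<open>Coordinates\<close>

lemma coord_single: "coord (single i e) j = (if j = i then e else 0)"
  by (simp add: single.rep_eq)

lemma coord_restrict_to: "coord (restrict_to W x) i = (if i \<in> W then coord x i else 0)"
  by (simp add: restrict_to.rep_eq)

lemma restrict_to_empty [simp]: "restrict_to {} x = 0"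
  by (rule ell2_eqI) (simp add: coord_restrict_to)

lemma coord_comp_proj [simp]: "coord (comp_proj a x) \<sigma> = coord x (a # \<sigma>)"
  by (simp add: comp_proj.rep_eq)

lemma coord_comp_incl:
  "coord (comp_incl a x) \<sigma> = (case \<sigma> of [] \<Rightarrow> 0 | b # \<tau> \<Rightarrow> if b = a then coord x \<tau> else 0)"
  by (simp add: comp_incl.rep_eq)

lemma coord_sum: "coord (\<Sum>i\<in>I. f i) j = (\<Sum>i\<in>I. coord (f i) j)"
  by (induction I rule: infinite_finite_induct) simp_all

lemma clinear_on_coord: "clinear_on S (\<lambda>x. coord x i)"
  by (simp add: clinear_on_def coord_scaleC)

lemma clinear_on_comp_proj: "clinear_on S (comp_proj a)"
  by (intro clinear_onI ell2_eqI) (simp_all add: coord_scaleC)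

lemma bounded_linear_coord: "bounded_linear (\<lambda>x. coord x i)"
  by (rule bounded_linear_intro [where K = 1]) (simp_all add: coord_scaleR norm_coord_le)

lemma single_add: "single i (x + y) = single i x + single i y"
  by (rule ell2_eqI) (simp add: coord_single)

lemma single_scaleC: "single i (c *\<^sub>C x) = c *\<^sub>C single i x"
  by (rule ell2_eqI) (simp add: coord_single coord_scaleC)

lemma norm_ell2_sq: "(norm x)\<^sup>2 = (\<Sum>\<^sub>\<infinity>i. (norm (coord x i))\<^sup>2)"
  by (simp add: norm_ell2_def infsum_nonneg)

lemma norm_ell2_sq_eq_sum:
  assumes "finite F" "\<And>i. i \<notin> F \<Longrightarrow> coord x i = 0"
  shows "(norm x)\<^sup>2 = (\<Sum>i\<in>F. (norm (coord x i))\<^sup>2)"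
  unfolding norm_ell2_sq infsum_finite [OF assms(1), symmetric]
  by (intro infsum_cong_neutral) (use assms(2) in auto)

lemma cinner_ell2_eq_sum:
  assumes "finite F" "\<And>i. i \<notin> F \<Longrightarrow> coord x i = 0 \<or> coord y i = 0"
  shows "cinner x y = (\<Sum>i\<in>F. cinner (coord x i) (coord y i))"
  unfolding cinner_ell2_def infsum_finite [OF assms(1), symmetric]
  by (intro infsum_cong_neutral) (use assms(2) in force)+

lemma norm_single [simp]: "norm (single i e) = norm e"
proof -
  have "(norm (single i e))\<^sup>2 = (norm e)\<^sup>2"
    by (subst norm_ell2_sq_eq_sum [of "{i}"]) (simp_all add: coord_single)
  then show ?thesis
    by (simp add: power2_eq_iff_nonneg)
qed

lemma bounded_linear_single: "bounded_linear (single i)"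
  by (rule bounded_linear_intro [where K = 1])
    (auto intro: ell2_eqI simp: coord_single coord_scaleR)

lemma cinner_single_left: "cinner (single i e) y = cinner e (coord y i)"
  by (subst cinner_ell2_eq_sum [of "{i}"]) (simp_all add: coord_single)

lemma cinner_single_right: "cinner y (single i e) = cinner (coord y i) e"
  by (subst cinner_ell2_eq_sum [of "{i}"]) (simp_all add: coord_single)

lemma norm_sum_single_sq:
  assumes "finite I"
  shows "(norm (\<Sum>i\<in>I. single i (f i)))\<^sup>2 = (\<Sum>i\<in>I. (norm (f i))\<^sup>2)"
  by (subst norm_ell2_sq_eq_sum [OF assms])
    (auto simp: coord_sum coord_single assms intro!: sum.cong)

lemma sum_coord_sq_le:
  assumes "finite F"
  shows "(\<Sum>i\<in>F. (norm (coord x i))\<^sup>2) \<le> (norm x)\<^sup>2"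
  unfolding norm_ell2_sq by (intro finite_sum_le_infsum ell2_summable assms) auto

lemma norm_restrict_to_le: "norm (restrict_to W x) \<le> norm x"
proof -
  have "(norm (restrict_to W x))\<^sup>2 \<le> (norm x)\<^sup>2"
    unfolding norm_ell2_sq by (intro infsum_mono ell2_summable) (auto simp: coord_restrict_to)
  then show ?thesis
    by (rule power2_le_imp_le) simp
qed

text \<open>By orthogonality the squared error of a finite partial sum is the tail of the convergent
  series for \<open>(norm x)\<^sup>2\<close>.\<close>

lemma has_sum_single: "((\<lambda>i. single i (coord x i)) has_sum x) UNIV"
  unfolding has_sum_def
proof (rule tendstoI)
  fix e :: real assume e: "0 < e"
  have "((\<lambda>i. (norm (coord x i))\<^sup>2) has_sum (norm x)\<^sup>2) UNIV"
    unfolding norm_ell2_sq by (rule has_sum_infsum [OF ell2_summable])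
  then have "\<forall>\<^sub>F F in finite_subsets_at_top UNIV. dist (\<Sum>i\<in>F. (norm (coord x i))\<^sup>2) ((norm x)\<^sup>2) < e\<^sup>2"
    using e unfolding has_sum_def by (intro tendstoD) auto
  moreover have "\<forall>\<^sub>F F in finite_subsets_at_top (UNIV :: 'a set). finite F"
    by (simp add: eventually_finite_subsets_at_top_weakI)
  ultimately show "\<forall>\<^sub>F F in finite_subsets_at_top UNIV. dist (\<Sum>i\<in>F. single i (coord x i)) x < e"
  proof eventually_elim
    fix F :: "'a set"
    assume F: "dist (\<Sum>i\<in>F. (norm (coord x i))\<^sup>2) ((norm x)\<^sup>2) < e\<^sup>2" "finite F"
    let ?y = "\<Sum>i\<in>F. single i (coord x i)"
    have "Re (cinner ?y x) = (\<Sum>i\<in>F. (norm (coord x i))\<^sup>2)"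
      by (simp add: cinner_sum_left cinner_single_left Re_cinner_self)
    then have "(norm (?y - x))\<^sup>2 = (norm x)\<^sup>2 - (\<Sum>i\<in>F. (norm (coord x i))\<^sup>2)"
      using norm_sum_single_sq [OF F(2)] by (simp add: norm_diff_sq)
    also have "\<dots> < e\<^sup>2"
      using F(1) by (simp add: dist_real_def)
    finally show "dist ?y x < e"
      using e by (simp add: dist_norm power2_less_imp_less)
  qed
qed

section \<open>Coordinate subspaces\<close>

lemma csubspace_sum_space: "csubspace (sum_space W)"
  by (auto simp: csubspace_def sum_space_def coord_scaleC)

lemma closed_sum_space: "closed (sum_space W :: ('i, 'a::complex_hilbert_space) ell2 set)"
proof -
  have "sum_space W = (\<Inter>i\<in>- W. {x :: ('i, 'a) ell2. coord x i = 0})"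
    by (auto simp: sum_space_def)
  moreover have "closed {x :: ('i, 'a) ell2. coord x i = 0}" for i
    by (intro closed_Collect_eq continuous_on_const
        linear_continuous_on bounded_linear_coord)
  ultimately show ?thesis
    by (simp add: closed_INT)
qed

lemma sum_space_mono: "V \<subseteq> W \<Longrightarrow> sum_space V \<subseteq> sum_space W"
  by (auto simp: sum_space_def)

lemma single_in_sum_space: "i \<in> W \<Longrightarrow> single i e \<in> sum_space W"
  by (auto simp: sum_space_def coord_single)

lemma restrict_to_in_sum_space: "V \<inter> U \<subseteq> W \<Longrightarrow> x \<in> sum_space U \<Longrightarrow> restrict_to V x \<in> sum_space W"
  by (auto simp: sum_space_def coord_restrict_to)

lemma sum_space_decompose:
  assumes "finite W" "x \<in> sum_space W"
  shows "x = (\<Sum>i\<in>W. single i (coord x i))"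
  using assms by (intro ell2_eqI) (auto simp: coord_sum coord_single sum_space_def)


section \<open>Words\<close>

lemma Nil_in_words [simp]: "[] \<in> words N"
  by (simp add: words_def)

lemma Cons_in_words [simp]: "a # \<sigma> \<in> words N \<longleftrightarrow> a \<in> {1..N} \<and> \<sigma> \<in> words N"
  by (simp add: words_def)

lemma append_in_words [simp]: "\<sigma> @ \<tau> \<in> words N \<longleftrightarrow> \<sigma> \<in> words N \<and> \<tau> \<in> words N"
  by (auto simp: words_def)

text \<open>The strict bound gives the empty set at \<open>n = 0\<close>, the base case of the
  inductions on the depth. Words of length at most \<open>l\<close> are
  \<open>words_less N (Suc l)\<close>.\<close>

definition words_less :: "nat \<Rightarrow> nat \<Rightarrow> nat list set"
  where "words_less N n = {\<sigma> \<in> words N. length \<sigma> < n}"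

lemma words_less_0 [simp]: "words_less N 0 = {}"
  by (simp add: words_less_def)

lemma words_less_Suc:
  "words_less N (Suc n) = insert [] (\<Union>a\<in>{1..N}. (#) a ` words_less N n)"
proof (rule set_eqI)
  fix \<sigma> show "\<sigma> \<in> words_less N (Suc n) \<longleftrightarrow> \<sigma> \<in> insert [] (\<Union>a\<in>{1..N}. (#) a ` words_less N n)"
    by (cases \<sigma>) (auto simp: words_less_def)
qed

lemma finite_words_less [simp]: "finite (words_less N n)"
  by (induction n) (simp_all add: words_less_Suc)

text \<open>Nonempty words are sorted by their first letter. This turns bounds on sums over words
  into inductions in which one letter is stripped.\<close>

lemma sum_words_less_Suc:
  fixes f :: "nat list \<Rightarrow> 'a::comm_monoid_add"
  shows "(\<Sum>\<sigma>\<in>words_less N (Suc n). f \<sigma>) = f [] + (\<Sum>a=1..N. \<Sum>\<sigma>\<in>words_less N n. f (a # \<sigma>))"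
proof -
  have "(\<Sum>\<sigma>\<in>(\<Union>a\<in>{1..N}. (#) a ` words_less N n). f \<sigma>) = (\<Sum>a=1..N. \<Sum>\<sigma>\<in>(#) a ` words_less N n. f \<sigma>)"
    by (intro sum.UNION_disjoint) auto
  also have "\<dots> = (\<Sum>a=1..N. \<Sum>\<sigma>\<in>words_less N n. f (a # \<sigma>))"
    by (rule sum.cong [OF refl]) (simp add: sum.reindex)
  finally show ?thesis
    unfolding words_less_Suc by (subst sum.insert) auto
qed

text \<open>Through this, partial sums over arbitrary finite sets of words are bounded by sums over
  \<open>words_less\<close>, where induction is available.\<close>

lemma words_less_subset: "finite F \<Longrightarrow> F \<subseteq> words N \<Longrightarrow> \<exists>n. F \<subseteq> words_less N n"
proof -
  assume F: "finite F" "F \<subseteq> words N"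
  have "length \<sigma> < Suc (Max (insert 0 (length ` F)))" if "\<sigma> \<in> F" for \<sigma>
    using F(1) that by (auto simp: less_Suc_eq_le Max_ge_iff)
  with F(2) show ?thesis
    unfolding words_less_def by (intro exI [of _ "Suc (Max (insert 0 (length ` F)))"]) auto
qed

lemma fock_upto_eq: "fock_upto N l = sum_space (words_less N (Suc l))"
  by (simp add: fock_upto_def words_less_def less_Suc_eq_le)

lemma finite_words_len [simp]: "finite (words_len N k)"
  by (rule finite_subset [OF _ finite_words_less [of N "Suc k"]])
    (auto simp: words_len_def words_less_def)

lemma csubspace_fock: "csubspace (fock N)" "csubspace (level N k)" "csubspace (fock_upto N l)"
  and closed_fock: "closed (fock N)" "closed (level N k)" "closed (fock_upto N l)"
  unfolding fock_def level_def fock_upto_def by (simp_all add: csubspace_sum_space closed_sum_space)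

lemma comp_proj_in_fock: "x \<in> fock N \<Longrightarrow> comp_proj a x \<in> fock N"
  by (auto simp: fock_def sum_space_def)

lemma tendsto_restrict_words_less:
  assumes x: "x \<in> fock N"
  shows "(\<lambda>n. restrict_to (words_less N n) x) \<longlonglongrightarrow> x"
proof (rule metric_LIMSEQ_I)
  fix e :: real assume e: "0 < e"
  from tendstoD [OF has_sum_single [of x, unfolded has_sum_def] e]
  obtain F where F: "finite F" "\<And>G. finite G \<Longrightarrow> F \<subseteq> G \<Longrightarrow> dist (\<Sum>i\<in>G. single i (coord x i)) x < e"
    unfolding eventually_finite_subsets_at_top by (metis top_greatest)
  obtain n where n: "F \<inter> words N \<subseteq> words_less N n"
    using words_less_subset [of "F \<inter> words N" N] F(1) by auto
  have "dist (restrict_to (words_less N m) x) x < e" if "m \<ge> n" for m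
  proof -
    \<comment> \<open>The set \<open>F\<close> supplied by the summability may contain lists outside
      \<open>words N\<close>; there \<open>x\<close> vanishes.\<close>
    have "restrict_to (words_less N m) x = (\<Sum>i\<in>F \<union> words_less N m. single i (coord x i))"
    proof (rule ell2_eqI)
      fix i
      have "coord x i = 0" if "i \<in> F" "i \<notin> words_less N m"
        using that n \<open>m \<ge> n\<close> x by (auto simp: fock_def sum_space_def words_less_def)
      then show "coord (restrict_to (words_less N m) x) i = coord (\<Sum>i\<in>F \<union> words_less N m. single i (coord x i)) i"
        using F(1) by (auto simp: coord_restrict_to coord_sum coord_single)
    qed
    then show ?thesis
      using F by simp
  qed
  then show "\<exists>n. \<forall>m\<ge>n. dist (restrict_to (words_less N m) x) x < e" by blast
qed

text \<open>A word is empty or starts with a letter \<open>a\<close>, which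
  \<open>comp_proj a\<close> strips. The energy balances of the realisation and of
  \<open>observe\<close> rest on this identity.\<close>

lemma norm_fock_sq:
  assumes x: "x \<in> fock N"
  shows "(norm x)\<^sup>2 = (norm (coord x []))\<^sup>2 + (\<Sum>a=1..N. (norm (comp_proj a x))\<^sup>2)"
proof -
  have lim: "(\<lambda>n. \<Sum>\<sigma>\<in>words_less N n. (norm (coord y \<sigma>))\<^sup>2) \<longlonglongrightarrow> (norm y)\<^sup>2" if "y \<in> fock N" for y :: "'a fock"
  proof -
    have "(norm (restrict_to (words_less N n) y))\<^sup>2 = (\<Sum>\<sigma>\<in>words_less N n. (norm (coord y \<sigma>))\<^sup>2)" for n
      by (subst norm_ell2_sq_eq_sum [of "words_less N n"]) (simp_all add: coord_restrict_to)
    then show ?thesis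
      using tendsto_power [OF tendsto_norm [OF tendsto_restrict_words_less [OF that]], of 2] by simp
  qed
  have "(\<lambda>n. \<Sum>\<sigma>\<in>words_less N (Suc n). (norm (coord x \<sigma>))\<^sup>2) \<longlonglongrightarrow> (norm x)\<^sup>2"
    by (rule LIMSEQ_Suc [OF lim [OF x]])
  moreover have "(\<lambda>n. \<Sum>\<sigma>\<in>words_less N (Suc n). (norm (coord x \<sigma>))\<^sup>2) \<longlonglongrightarrow>
      (norm (coord x []))\<^sup>2 + (\<Sum>a=1..N. (norm (comp_proj a x))\<^sup>2)"
    unfolding sum_words_less_Suc
    using lim [OF comp_proj_in_fock [OF x]] by (intro tendsto_add tendsto_const tendsto_sum) simp
  ultimately show ?thesis
    by (rule LIMSEQ_unique)
qed

section \<open>Realisation of a contraction\<close>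

text \<open>
  The contraction \<open>W\<close> extending \<open>((\<Gamma> (F\<^sub>a h))\<^sub>a, p h) \<mapsto> (\<Gamma> h, q h)\<close> is the system matrix of a
  multivariable linear system: the vector \<open>x\<close> in the Fock space is the input, the state at the word
  \<open>\<sigma>\<close> is computed from the states at the words \<open>\<sigma> a\<close> and the input at \<open>\<sigma>\<close>, and \<open>T x\<close> is the output.
  By shift invariance it suffices to describe the state at the empty word, \<open>st m x\<close>, where the states at
  the words of length \<open>m\<close> are replaced by zero.
\<close>

lemma contraction_realization:
  fixes S :: "'h::complex_hilbert_space set" and \<Gamma> :: "'h \<Rightarrow> 'k::complex_hilbert_space"
    and p q :: "'h \<Rightarrow> 'e::complex_hilbert_space" and F :: "nat \<Rightarrow> 'h \<Rightarrow> 'h" and u :: "'h \<Rightarrow> 'e fock"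
  assumes S: "csubspace S"
    and lin: "clinear_on S \<Gamma>" "clinear_on S p" "clinear_on S q" "\<And>a. a \<in> {1..N} \<Longrightarrow> clinear_on S (F a)"
    and F: "\<And>a h. a \<in> {1..N} \<Longrightarrow> h \<in> S \<Longrightarrow> F a h \<in> S"
    and u: "\<And>h. h \<in> S \<Longrightarrow> u h \<in> fock N" "\<And>h. h \<in> S \<Longrightarrow> coord (u h) [] = p h"
      "\<And>a h. a \<in> {1..N} \<Longrightarrow> h \<in> S \<Longrightarrow> comp_proj a (u h) = u (F a h)"
    and \<Gamma>_le: "\<And>h. h \<in> S \<Longrightarrow> norm (\<Gamma> h) \<le> norm (u h)"
    and energy: "\<And>h. h \<in> S \<Longrightarrow>
      (norm (\<Gamma> h))\<^sup>2 + (norm (q h))\<^sup>2 \<le> (\<Sum>a=1..N. (norm (\<Gamma> (F a h)))\<^sup>2) + (norm (p h))\<^sup>2"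
  obtains T where "T \<in> bounded_ops (fock N) (fock N)" "\<And>x. x \<in> fock N \<Longrightarrow> norm (T x) \<le> norm x"
    "\<And>a x. a \<in> {1..N} \<Longrightarrow> x \<in> fock N \<Longrightarrow> comp_proj a (T x) = T (comp_proj a x)"
    "\<And>h. h \<in> S \<Longrightarrow> coord (T (u h)) [] = q h"
proof -
  \<comment> \<open>An argument of the system matrix: the states at the one-letter words, stacked in
    one vector, together with the input at the empty word.\<close>
  define inp :: "(nat \<Rightarrow> 'k) \<Rightarrow> 'e \<Rightarrow> (nat, 'k) ell2 \<times> 'e"
    where "inp s e = (\<Sum>a=1..N. single a (s a), e)" for s e
  have inp_norm: "(norm (inp s e))\<^sup>2 = (\<Sum>a=1..N. (norm (s a))\<^sup>2) + (norm e)\<^sup>2" for s e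
    unfolding inp_def norm_Pair_sq by (subst norm_sum_single_sq) simp_all
  have inp_add: "inp (\<lambda>a. s a + s' a) (e + e') = inp s e + inp s' e'" for s s' e e'
    by (simp add: inp_def single_add sum.distrib)
  have inp_scaleC: "inp (\<lambda>a. c *\<^sub>C s a) (c *\<^sub>C e) = c *\<^sub>C inp s e" for c s e
    by (simp add: inp_def single_scaleC scaleC_sum_right)
  have inp_diff: "inp (\<lambda>a. s a - s' a) (e - e') = inp s e - inp s' e'" for s s' e e'
    using inp_add [of s "\<lambda>a. (- 1) *\<^sub>C s' a" e "(- 1) *\<^sub>C e'"] inp_scaleC [of "- 1" s' e']
    by (simp add: scaleC_minus_one)
  have inp_cong: "inp s e = inp s' e" if "\<And>a. a \<in> {1..N} \<Longrightarrow> s a = s' a" for s s' e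
    using that by (simp add: inp_def)
  define G where "G h = inp (\<lambda>a. \<Gamma> (F a h)) (p h)" for h
  have G_lin: "clinear_on S G"
  proof (rule clinear_onI)
    fix x y assume xy: "x \<in> S" "y \<in> S"
    have "inp (\<lambda>a. \<Gamma> (F a (x + y))) (p (x + y)) = inp (\<lambda>a. \<Gamma> (F a x) + \<Gamma> (F a y)) (p (x + y))"
      using xy F by (intro inp_cong) (simp add: clinear_on_add [OF lin(4)] clinear_on_add [OF lin(1)])
    then show "G (x + y) = G x + G y"
      using xy by (simp add: G_def inp_add clinear_on_add [OF lin(2)])
  next
    fix c x assume x: "x \<in> S"
    have "inp (\<lambda>a. \<Gamma> (F a (c *\<^sub>C x))) (p (c *\<^sub>C x)) = inp (\<lambda>a. c *\<^sub>C \<Gamma> (F a x)) (p (c *\<^sub>C x))"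
      using x F by (intro inp_cong) (simp add: clinear_on_scaleC [OF lin(4)] clinear_on_scaleC [OF lin(1)])
    then show "G (c *\<^sub>C x) = c *\<^sub>C G x"
      using x by (simp add: G_def inp_scaleC clinear_on_scaleC [OF lin(2)])
  qed
  have R_lin: "clinear_on S (\<lambda>h. (\<Gamma> h, q h))"
    using lin(1,3) by (simp add: clinear_on_def)
  have le: "norm (\<Gamma> h, q h) \<le> norm (G h)" if "h \<in> S" for h
    using energy [OF that] by - (rule power2_le_imp_le, simp_all add: G_def inp_norm norm_Pair_sq)
  obtain W where W: "clinear_on UNIV W" "\<And>x. norm (W x) \<le> norm x"
    and W_G: "\<And>h. h \<in> S \<Longrightarrow> W (G h) = (\<Gamma> h, q h)"
    using contraction_extension [OF S G_lin R_lin le] by metis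
  have W_bl: "bounded_linear W"
    by (rule bounded_linear_intro [where K = 1])
      (simp_all only: clinear_on_add [OF W(1)] clinear_on_scaleR [OF W(1)] UNIV_I W(2) mult_1_right)
  have W_le: "(norm (fst (W x)))\<^sup>2 + (norm (snd (W x)))\<^sup>2 \<le> (norm x)\<^sup>2" for x
    using power_mono [OF W(2) [of x], of 2] by (simp add: norm_Pair_sq [symmetric])
  define st where "st = rec_nat (\<lambda>_. 0) (\<lambda>_ f x. fst (W (inp (\<lambda>a. f (comp_proj a x)) (coord x []))))"
  have st_0: "st 0 x = 0" and st_Suc: "st (Suc m) x = fst (W (inp (\<lambda>a. st m (comp_proj a x)) (coord x [])))"
    for m and x :: "'e fock"
    by (simp_all add: st_def)
  have lin_step: "clinear_on UNIV (\<lambda>x. W (inp (\<lambda>a. f (comp_proj a x)) (coord x [])))"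
    if "clinear_on UNIV f" for f :: "'e fock \<Rightarrow> 'k"
    using that by (intro clinear_onI)
      (simp_all add: clinear_on_add [OF that] clinear_on_scaleC [OF that] inp_add inp_scaleC coord_scaleC
        clinear_on_add [OF W(1)] clinear_on_scaleC [OF W(1)]
        clinear_on_add [OF clinear_on_comp_proj [of UNIV]] clinear_on_scaleC [OF clinear_on_comp_proj [of UNIV]])
  have st_lin: "clinear_on UNIV (st m)" for m
  proof (induction m)
    case (Suc m)
    show ?case
      unfolding st_Suc using lin_step [OF Suc] by (simp add: clinear_on_def scaleC_prod_def)
  qed (simp add: clinear_on_def st_0)
  \<comment> \<open>The part of the input at depth \<open>n\<close> and beyond, which will dominate
    the truncation error.\<close>
  define rest where "rest n x = x - restrict_to (words_less N n) x" for n and x :: "'e fock"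
  have rest_Suc: "(\<Sum>a=1..N. (norm (rest n (comp_proj a x)))\<^sup>2) = (norm (rest (Suc n) x))\<^sup>2"
    if "x \<in> fock N" for n x
  proof -
    have mem: "rest (Suc n) x \<in> fock N"
      using that by (auto simp: rest_def fock_def sum_space_def coord_restrict_to)
    have "comp_proj a (rest (Suc n) x) = rest n (comp_proj a x)" if "a \<in> {1..N}" for a
      using that by (intro ell2_eqI) (simp add: rest_def coord_restrict_to words_less_def)
    then have "(\<Sum>a=1..N. (norm (rest n (comp_proj a x)))\<^sup>2)
        = (\<Sum>a=1..N. (norm (comp_proj a (rest (Suc n) x)))\<^sup>2)"
      by (intro sum.cong) simp_all
    moreover have "coord (rest (Suc n) x) [] = 0"
      by (simp add: rest_def coord_restrict_to words_less_def)
    ultimately show ?thesis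
      by (simp add: norm_fock_sq [OF mem])
  qed
  \<comment> \<open>By linearity the common input \<open>e\<close> cancels, so the contraction
    \<open>W\<close> sees only the difference of the states.\<close>
  have step: "(norm (fst (W (inp s e)) - fst (W (inp s' e))))\<^sup>2 \<le> (\<Sum>a=1..N. (norm (s a - s' a))\<^sup>2)" for s s' e
  proof -
    have "W (inp s e) - W (inp s' e) = W (inp (\<lambda>a. s a - s' a) 0)"
      using inp_diff [of s s' e e] clinear_on_diff [OF csubspace_UNIV W(1), of "inp s e" "inp s' e"] by simp
    then show ?thesis
      using W_le [of "inp (\<lambda>a. s a - s' a) 0"] by (simp add: inp_norm fst_diff [symmetric]) (smt (verit) zero_le_power2)
  qed
  have st_norm: "norm (st m x) \<le> norm x" if "x \<in> fock N" for m x
    using that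
  proof (induction m arbitrary: x)
    case (Suc m)
    have "(norm (st (Suc m) x))\<^sup>2 \<le> (\<Sum>a=1..N. (norm (st m (comp_proj a x)))\<^sup>2) + (norm (coord x []))\<^sup>2"
      using W_le [of "inp (\<lambda>a. st m (comp_proj a x)) (coord x [])"] unfolding st_Suc inp_norm
      by (smt (verit) zero_le_power2)
    also have "\<dots> \<le> (\<Sum>a=1..N. (norm (comp_proj a x))\<^sup>2) + (norm (coord x []))\<^sup>2"
      by (intro add_right_mono sum_mono power_mono Suc comp_proj_in_fock) auto
    also have "\<dots> = (norm x)\<^sup>2"
      by (simp add: norm_fock_sq [OF Suc.prems])
    finally show ?case
      by (rule power2_le_imp_le) simp
  qed (simp add: st_0)
  \<comment> \<open>The truncations differ only in the states put in at depth \<open>n\<close>,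
    whose norms \<open>st_norm\<close> bounds by the input there; \<open>step\<close> carries the
    error back to the empty word.\<close>
  have st_diff: "norm (st (m + n) x - st n x) \<le> norm (rest n x)" if "x \<in> fock N" for m n x
    using that
  proof (induction n arbitrary: x)
    case (Suc n)
    have "(norm (st (m + Suc n) x - st (Suc n) x))\<^sup>2
        \<le> (\<Sum>a=1..N. (norm (st (m + n) (comp_proj a x) - st n (comp_proj a x)))\<^sup>2)"
      unfolding add_Suc_right st_Suc by (rule step)
    also have "\<dots> \<le> (\<Sum>a=1..N. (norm (rest n (comp_proj a x)))\<^sup>2)"
      by (intro sum_mono power_mono Suc comp_proj_in_fock) auto
    also have "\<dots> = (norm (rest (Suc n) x))\<^sup>2"
      by (rule rest_Suc [OF Suc.prems])
    finally show ?case
      by (rule power2_le_imp_le) simp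
  qed (simp add: st_0 rest_def st_norm)
  \<comment> \<open>The same induction, with \<Gamma> as the exact state: \<open>W_G\<close> says
    that it satisfies the state recursion, and \<open>\<Gamma>_le\<close> replaces
    \<open>st_norm\<close> at depth 0.\<close>
  have st_u: "norm (\<Gamma> h - st n (u h)) \<le> norm (rest n (u h))" if "h \<in> S" for n h
    using that
  proof (induction n arbitrary: h)
    case (Suc n)
    have "\<Gamma> h = fst (W (inp (\<lambda>a. \<Gamma> (F a h)) (coord (u h) [])))"
      using W_G [OF Suc.prems] u(2) [OF Suc.prems] by (simp add: G_def)
    then have "(norm (\<Gamma> h - st (Suc n) (u h)))\<^sup>2
        \<le> (\<Sum>a=1..N. (norm (\<Gamma> (F a h) - st n (comp_proj a (u h))))\<^sup>2)"
      unfolding st_Suc using step [of "\<lambda>a. \<Gamma> (F a h)" "coord (u h) []"] by simp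
    also have "\<dots> \<le> (\<Sum>a=1..N. (norm (rest n (comp_proj a (u h))))\<^sup>2)"
      by (intro sum_mono power_mono) (simp_all add: u(3) Suc F)
    also have "\<dots> = (norm (rest (Suc n) (u h)))\<^sup>2"
      by (intro rest_Suc u Suc.prems)
    finally show ?case
      by (rule power2_le_imp_le) simp
  qed (simp add: st_0 rest_def \<Gamma>_le)
  have rest_0: "(\<lambda>n. norm (rest n x)) \<longlonglongrightarrow> 0" if "x \<in> fock N" for x
    using tendsto_norm [OF tendsto_diff [OF tendsto_const tendsto_restrict_words_less [OF that], of x]]
    by (simp add: rest_def)
  have "Cauchy (\<lambda>n. st n x)" if x: "x \<in> fock N" for x
  proof (rule metric_CauchyI)
    fix e :: real assume "0 < e"
    then obtain M where M: "\<And>n. n \<ge> M \<Longrightarrow> norm (rest n x) < e"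
      using metric_LIMSEQ_D [OF rest_0 [OF x]] by fastforce
    have *: "dist (st m x) (st n x) < e" if "n \<ge> M" "n \<le> m" for m n
      using st_diff [OF x, of "m - n" n] M [OF that(1)] that(2) by (simp add: dist_norm)
    show "\<exists>M. \<forall>m\<ge>M. \<forall>n\<ge>M. dist (st m x) (st n x) < e"
    proof (intro exI [of _ M] allI impI)
      fix m n assume "M \<le> m" "M \<le> n"
      then show "dist (st m x) (st n x) < e"
        using * [of n m] * [of m n] by (cases "n \<le> m") (simp_all add: dist_commute)
    qed
  qed
  then have "\<forall>x\<in>fock N. \<exists>l. (\<lambda>n. st n x) \<longlonglongrightarrow> l"
    using Cauchy_convergent_iff convergent_def by blast
  then obtain s where s: "\<And>x. x \<in> fock N \<Longrightarrow> (\<lambda>n. st n x) \<longlonglongrightarrow> s x"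
    by metis
  \<comment> \<open>The pair of state and output at the empty word, for the limiting states.\<close>
  define sys where "sys x = W (inp (\<lambda>a. s (comp_proj a x)) (coord x []))" for x
  have s_lin: "clinear_on (fock N) s"
  proof (rule clinear_onI)
    fix x y :: "'e fock" assume xy: "x \<in> fock N" "y \<in> fock N"
    show "s (x + y) = s x + s y"
      using LIMSEQ_unique [OF s [OF csubspace_add [OF csubspace_fock(1) xy]]] tendsto_add [OF s [OF xy(1)] s [OF xy(2)]]
      by (simp add: clinear_on_add [OF st_lin])
  next
    fix c and x :: "'e fock" assume x: "x \<in> fock N"
    show "s (c *\<^sub>C x) = c *\<^sub>C s x"
      using LIMSEQ_unique [OF s [OF csubspace_scaleC [OF csubspace_fock(1) x]]]
        bounded_linear.tendsto [OF bounded_linear_scaleC s [OF x]]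
      by (simp add: clinear_on_scaleC [OF st_lin])
  qed
  have sys_lin: "clinear_on (fock N) sys"
    unfolding sys_def
    by (intro clinear_onI)
      (simp_all add: clinear_on_add [OF s_lin] clinear_on_scaleC [OF s_lin] inp_add inp_scaleC coord_scaleC
        clinear_on_add [OF W(1)] clinear_on_scaleC [OF W(1)] comp_proj_in_fock
        clinear_on_add [OF clinear_on_comp_proj [of UNIV]] clinear_on_scaleC [OF clinear_on_comp_proj [of UNIV]])
  have s_sys: "s x = fst (sys x)" if x: "x \<in> fock N" for x
  proof -
    have "(\<lambda>n. fst (W (inp (\<lambda>a. st n (comp_proj a x)) (coord x [])))) \<longlonglongrightarrow> fst (sys x)"
      unfolding sys_def inp_def
      by (intro tendsto_fst bounded_linear.tendsto [OF W_bl] tendsto_Pair tendsto_sum tendsto_const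
          bounded_linear.tendsto [OF bounded_linear_single] s comp_proj_in_fock x)
    then have "(\<lambda>n. st (Suc n) x) \<longlonglongrightarrow> fst (sys x)"
      by (simp only: st_Suc)
    then show ?thesis
      using LIMSEQ_unique LIMSEQ_Suc [OF s [OF x]] by blast
  qed
  have s_norm: "norm (s x) \<le> norm x" if "x \<in> fock N" for x
    using st_norm [OF that] by (intro LIMSEQ_le_const2 [OF tendsto_norm [OF s [OF that]]]) auto
  have sys_energy: "(norm (s x))\<^sup>2 + (norm (snd (sys x)))\<^sup>2
      \<le> (\<Sum>a=1..N. (norm (s (comp_proj a x)))\<^sup>2) + (norm (coord x []))\<^sup>2" if "x \<in> fock N" for x
    using W_le [of "inp (\<lambda>a. s (comp_proj a x)) (coord x [])"]
    unfolding s_sys [OF that] by (simp only: sys_def inp_norm)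
  \<comment> \<open>By shift invariance the output at a word is that at the empty word after
    stripping the letters from the input, first letter first.\<close>
  define out where "out x \<sigma> = snd (sys (foldl (\<lambda>y a. comp_proj a y) x \<sigma>))" for x and \<sigma> :: "nat list"
  have out_Cons: "out x (a # \<sigma>) = out (comp_proj a x) \<sigma>" for x a \<sigma>
    by (simp add: out_def)
  have out_lin: "clinear_on (fock N) (\<lambda>x. out x \<sigma>)" for \<sigma>
  proof (induction \<sigma>)
    case Nil
    show ?case
      using sys_lin by (simp add: out_def clinear_on_def scaleC_prod_def)
  next
    case (Cons a \<sigma>)
    show ?case
      unfolding out_Cons by (rule clinear_on_compose [OF clinear_on_comp_proj Cons comp_proj_in_fock])
  qed
  \<comment> \<open>The energy stored in the state is kept in the claim: in the induction it pays
    for the states entering \<open>sys_energy\<close>.\<close>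
  have out_energy: "(\<Sum>\<sigma>\<in>words_less N n. (norm (out x \<sigma>))\<^sup>2) + (norm (s x))\<^sup>2 \<le> (norm x)\<^sup>2"
    if "x \<in> fock N" for n x
    using that
  proof (induction n arbitrary: x)
    case 0
    then show ?case
      using s_norm [OF 0] by (simp add: power_mono)
  next
    case (Suc n)
    have "(\<Sum>\<sigma>\<in>words_less N (Suc n). (norm (out x \<sigma>))\<^sup>2) + (norm (s x))\<^sup>2
        = (norm (s x))\<^sup>2 + (norm (snd (sys x)))\<^sup>2
          + (\<Sum>a=1..N. \<Sum>\<sigma>\<in>words_less N n. (norm (out (comp_proj a x) \<sigma>))\<^sup>2)"
      by (simp add: sum_words_less_Suc out_Cons) (simp add: out_def)
    also have "\<dots> \<le> (norm (coord x []))\<^sup>2 + (\<Sum>a=1..N.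
        (\<Sum>\<sigma>\<in>words_less N n. (norm (out (comp_proj a x) \<sigma>))\<^sup>2) + (norm (s (comp_proj a x)))\<^sup>2)"
      using sys_energy [OF Suc.prems] by (simp add: sum.distrib)
    also have "\<dots> \<le> (norm (coord x []))\<^sup>2 + (\<Sum>a=1..N. (norm (comp_proj a x))\<^sup>2)"
      by (intro add_left_mono sum_mono Suc.IH comp_proj_in_fock Suc.prems)
    also have "\<dots> = (norm x)\<^sup>2"
      by (rule norm_fock_sq [OF Suc.prems, symmetric])
    finally show ?case .
  qed
  define T where "T x = Abs_ell2 (\<lambda>\<sigma>. if \<sigma> \<in> words N then out x \<sigma> else 0)" for x
  have L2: "L2_set (\<lambda>\<sigma>. norm (if \<sigma> \<in> words N then out x \<sigma> else 0)) A \<le> norm x"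
    if x: "x \<in> fock N" and A: "finite A" for x A
  proof -
    obtain n where n: "A \<inter> words N \<subseteq> words_less N n"
      using words_less_subset [of "A \<inter> words N" N] A by auto
    have "(\<Sum>\<sigma>\<in>A. (norm (if \<sigma> \<in> words N then out x \<sigma> else 0))\<^sup>2) = (\<Sum>\<sigma>\<in>A \<inter> words N. (norm (out x \<sigma>))\<^sup>2)"
      using A by (intro sum.mono_neutral_cong_right) auto
    also have "\<dots> \<le> (\<Sum>\<sigma>\<in>words_less N n. (norm (out x \<sigma>))\<^sup>2)"
      using n by (intro sum_mono2) auto
    also have "\<dots> \<le> (norm x)\<^sup>2"
      using out_energy [OF x, of n] by (smt (verit) zero_le_power2)
    finally show ?thesis
      unfolding L2_set_def by (intro real_le_lsqrt) (auto intro: sum_nonneg)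
  qed
  have T: "coord (T x) \<sigma> = (if \<sigma> \<in> words N then out x \<sigma> else 0)" if "x \<in> fock N" for x \<sigma>
    unfolding T_def using square_summable_bounded(1) [OF L2 [OF that]] by (simp add: Abs_ell2_inverse)
  have T_norm: "norm (T x) \<le> norm x" if "x \<in> fock N" for x
    unfolding norm_ell2_def [of "T x"] T [OF that] by (rule square_summable_bounded(2) [OF L2 [OF that]])
  have s_u: "s (u h) = \<Gamma> h" if "h \<in> S" for h
  proof -
    have "(\<lambda>n. \<Gamma> h - st n (u h)) \<longlonglongrightarrow> 0"
      by (rule Lim_null_comparison [OF _ rest_0 [OF u(1) [OF that]]]) (simp add: st_u [OF that])
    then have "(\<lambda>n. \<Gamma> h - (\<Gamma> h - st n (u h))) \<longlonglongrightarrow> \<Gamma> h - 0"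
      by (intro tendsto_diff tendsto_const)
    then show ?thesis
      using LIMSEQ_unique [OF s [OF u(1) [OF that]]] by simp
  qed
  show ?thesis
  proof (rule that)
    have "clinear_on (fock N) T"
      using clinear_on_add [OF out_lin] clinear_on_scaleC [OF out_lin]
      by (intro clinear_onI ell2_eqI)
        (simp_all add: T coord_scaleC csubspace_add [OF csubspace_fock(1)] csubspace_scaleC [OF csubspace_fock(1)])
    then show "T \<in> bounded_ops (fock N) (fock N)"
      by (intro bounded_opsI [where K = 1]) (simp_all add: T_norm, simp add: fock_def sum_space_def T [unfolded fock_def sum_space_def])
    show "norm (T x) \<le> norm x" if "x \<in> fock N" for x
      by (rule T_norm [OF that])
    show "comp_proj a (T x) = T (comp_proj a x)" if "a \<in> {1..N}" "x \<in> fock N" for a x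
      using that by (intro ell2_eqI) (simp add: T comp_proj_in_fock out_Cons)
    fix h assume h: "h \<in> S"
    \<comment> \<open>Along \<open>u h\<close> the limiting states are values of \<Gamma>, so the
      argument of \<open>W\<close> is one at which its value is prescribed.\<close>
    have "sys (u h) = W (G h)"
      unfolding sys_def G_def u(2) [OF h]
      by (intro arg_cong [where f = W] inp_cong) (simp add: u(3) [OF _ h] s_u F h)
    then show "coord (T (u h)) [] = q h"
      by (simp add: T u(1) h out_def W_G)
  qed
qed

section \<open>Upper triangular operators\<close>

lemma coord_ampl:
  "coord (ampl N X x) \<sigma> =
    (case \<sigma> of [] \<Rightarrow> 0 | a # \<tau> \<Rightarrow> if a \<in> {1..N} then coord (X (comp_proj a x)) \<tau> else 0)"
  by (cases \<sigma>) (simp_all add: ampl_def coord_sum coord_comp_incl)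

lemma coord_entry:
  "coord (entry N T i j x) \<sigma> =
    (if \<sigma> \<in> words_len N i then coord (T (restrict_to (words_len N j) x)) \<sigma> else 0)"
  by (simp add: entry_def coord_restrict_to)

lemma level_subset_fock: "level N k \<subseteq> fock N"
  unfolding level_def fock_def by (rule sum_space_mono) (auto simp: words_len_def)

lemma restrict_to_level: "x \<in> level N k \<Longrightarrow> restrict_to (words_len N k) x = x"
  by (rule ell2_eqI) (auto simp: coord_restrict_to level_def sum_space_def)

lemma comp_proj_level_0: "x \<in> level N 0 \<Longrightarrow> comp_proj a x = 0"
  by (rule ell2_eqI) (auto simp: level_def sum_space_def words_len_def)

lemma comp_proj_level_Suc: "x \<in> level N (Suc k) \<Longrightarrow> comp_proj a x \<in> level N k"
  by (auto simp: level_def sum_space_def words_len_def)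

lemma bounded_linear_comp_proj: "bounded_linear (comp_proj a)"
proof (rule bounded_linear_intro [where K = 1])
  fix x :: "'a fock"
  have "(\<Sum>\<^sub>\<infinity>\<sigma>. (norm (coord x (a # \<sigma>)))\<^sup>2) = (\<Sum>\<^sub>\<infinity>\<sigma>\<in>range ((#) a). (norm (coord x \<sigma>))\<^sup>2)"
    by (subst infsum_reindex) (simp_all add: comp_def)
  also have "\<dots> \<le> (\<Sum>\<^sub>\<infinity>\<sigma>. (norm (coord x \<sigma>))\<^sup>2)"
    by (rule infsum_mono2 [OF summable_on_subset_banach [OF ell2_summable] ell2_summable]) auto
  finally show "norm (comp_proj a x) \<le> norm x * 1"
    by (simp add: norm_ell2_def)
qed (rule ell2_eqI; simp add: coord_scaleR)+

text \<open>The block rule says that below a first letter \<open>a\<close> the matrix repeats itself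
  on the part of the input below \<open>a\<close>. Vanishing below the diagonal says that an input
  at the empty word does not reach the nonempty words.\<close>

lemma upper_triangular_ops_iff:
  assumes T: "T \<in> bounded_ops (fock N) (fock N)"
  shows "T \<in> upper_triangular_ops N \<longleftrightarrow>
    (\<forall>a\<in>{1..N}. \<forall>x\<in>fock N. comp_proj a (T x) = T (comp_proj a x))"
proof
  note lin = bounded_ops_clinear_on [OF T]
  have T0: "T 0 = 0"
    by (rule clinear_on_zero [OF lin csubspace_zero [OF csubspace_fock(1)]])
  {
    assume upper: "T \<in> upper_triangular_ops N"
    \<comment> \<open>If \<open>j = 0\<close>, or if the entry lies below the diagonal, both sides
      vanish; otherwise the block rule applies.\<close>
    have level: "comp_proj a (T x) = T (comp_proj a x)" if a: "a \<in> {1..N}" and x: "x \<in> level N j" for a j x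
    proof (rule ell2_eqI)
      fix \<tau>
      have mem: "T x \<in> fock N" "T (comp_proj a x) \<in> fock N"
        using bounded_ops_mem [OF T] comp_proj_in_fock x level_subset_fock by blast+
      show "coord (comp_proj a (T x)) \<tau> = coord (T (comp_proj a x)) \<tau>"
      proof (cases "\<tau> \<in> words N")
        case False
        then show ?thesis
          using mem by (simp add: fock_def sum_space_def)
      next
        case True
        define i where "i = length \<tau>"
        have \<tau>: "\<tau> \<in> words_len N i" "a # \<tau> \<in> words_len N (Suc i)"
          using True a by (simp_all add: words_len_def i_def)
        have left: "coord (comp_proj a (T x)) \<tau> = coord (entry N T (Suc i) j x) (a # \<tau>)"
          using \<tau> x by (simp add: coord_entry restrict_to_level)
        show ?thesis
        proof (cases j)
          case 0
          then show ?thesis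
            using x upper left by (simp add: upper_triangular_ops_def comp_proj_level_0 T0)
        next
          case (Suc k)
          have c: "comp_proj a x \<in> level N k"
            using x Suc by (simp add: comp_proj_level_Suc)
          have right: "coord (T (comp_proj a x)) \<tau> = coord (entry N T i k (comp_proj a x)) \<tau>"
            using \<tau> c by (simp add: coord_entry restrict_to_level)
          show ?thesis
          proof (cases "i \<le> k")
            case True
            then have "entry N T (Suc i) j x = ampl N (entry N T (Suc i - 1) (j - 1)) x"
              using upper x Suc unfolding upper_triangular_ops_def by fastforce
            then show ?thesis
              using left right a Suc by (simp add: coord_ampl)
          next
            case False
            then show ?thesis
              using upper x c Suc left right by (simp add: upper_triangular_ops_def)
          qed
        qed
      qed
    qed
    obtain K where K: "\<And>x. x \<in> fock N \<Longrightarrow> norm (T x) \<le> K * norm x"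
      using bounded_ops_bound [OF T] by metis
    show "\<forall>a\<in>{1..N}. \<forall>x\<in>fock N. comp_proj a (T x) = T (comp_proj a x)"
    proof (intro ballI)
      fix a and x :: "'a fock" assume a: "a \<in> {1..N}" and x: "x \<in> fock N"
      define y where "y n = restrict_to (words_less N n) x" for n
      have y: "y n \<in> fock N" for n
        unfolding y_def fock_def by (rule restrict_to_in_sum_space [of _ UNIV]) (auto simp: words_less_def sum_space_def)
      \<comment> \<open>Additivity gives commutation on finitely many levels; continuity then gives
        it on the whole space.\<close>
      have T_lim: "(\<lambda>n. T (z n)) \<longlonglongrightarrow> T w" if z: "z \<longlonglongrightarrow> w" "\<And>n. z n \<in> fock N" "w \<in> fock N" for z w
      proof (rule LIM_zero_cancel, rule Lim_null_comparison)
        show "\<forall>\<^sub>F n in sequentially. norm (T (z n) - T w) \<le> K * norm (z n - w)"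
          using K [OF csubspace_diff [OF csubspace_fock(1) z(2,3)]]
          by (simp add: clinear_on_diff [OF csubspace_fock(1) lin z(2,3)])
        show "(\<lambda>n. K * norm (z n - w)) \<longlonglongrightarrow> 0"
          by (intro tendsto_mult_right_zero tendsto_norm_zero LIM_zero z(1))
      qed
      have eq: "comp_proj a (T (y n)) = T (comp_proj a (y n))" for n
      proof (induction n)
        case 0
        have "y 0 \<in> level N 0"
          by (simp add: y_def level_def csubspace_zero [OF csubspace_sum_space])
        then show ?case by (rule level [OF a])
      next
        case (Suc n)
        let ?z = "restrict_to (words_len N n) x"
        have z: "?z \<in> level N n"
          unfolding level_def by (rule restrict_to_in_sum_space [of _ UNIV]) (auto simp: sum_space_def)
        then have z': "?z \<in> fock N"
          using level_subset_fock by blast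
        have "y (Suc n) = y n + ?z"
          unfolding y_def by (rule ell2_eqI) (auto simp: coord_restrict_to words_less_def words_len_def less_Suc_eq)
        then show ?case
          using Suc level [OF a z] y [of n] z'
          by (simp add: clinear_on_add [OF lin] clinear_on_add [OF clinear_on_comp_proj [of UNIV]] comp_proj_in_fock)
      qed
      have lim: "y \<longlonglongrightarrow> x"
        unfolding y_def by (rule tendsto_restrict_words_less [OF x])
      have "(\<lambda>n. comp_proj a (T (y n))) \<longlonglongrightarrow> comp_proj a (T x)"
        by (intro bounded_linear.tendsto [OF bounded_linear_comp_proj] T_lim lim y x)
      moreover have "(\<lambda>n. T (comp_proj a (y n))) \<longlonglongrightarrow> T (comp_proj a x)"
        by (intro T_lim bounded_linear.tendsto [OF bounded_linear_comp_proj] lim comp_proj_in_fock y x)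
      ultimately show "comp_proj a (T x) = T (comp_proj a x)"
        unfolding eq by (rule LIMSEQ_unique)
    qed
  next
    assume comm: "\<forall>a\<in>{1..N}. \<forall>x\<in>fock N. comp_proj a (T x) = T (comp_proj a x)"
    have coord: "coord (T x) (a # \<sigma>) = coord (T (comp_proj a x)) \<sigma>" if "a \<in> {1..N}" "x \<in> fock N" for a x \<sigma>
      using comm that by (metis coord_comp_proj)
    \<comment> \<open>Stripping \<open>j\<close> letters brings \<open>x\<close> to level 0, and one
      further letter annihilates it.\<close>
    have zero: "coord (T x) \<sigma> = 0" if "x \<in> level N j" "\<sigma> \<in> words N" "length \<sigma> > j" for x j \<sigma>
      using that
    proof (induction j arbitrary: x \<sigma>)
      case 0
      then show ?case
        using subsetD [OF level_subset_fock 0(1)] by (cases \<sigma>) (auto simp: coord comp_proj_level_0 T0)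
    next
      case (Suc j)
      then show ?case
        using subsetD [OF level_subset_fock Suc.prems(1)] by (cases \<sigma>) (auto simp: coord comp_proj_level_Suc)
    qed
    have "entry N T i j x = 0" if "i > j" "x \<in> level N j" for i j x
      using that zero [OF that(2)]
      by (intro ell2_eqI) (simp add: coord_entry restrict_to_level, simp add: words_len_def)
    moreover have "entry N T i j x = ampl N (entry N T (i - 1) (j - 1)) x"
      if ij: "1 \<le> i" "i \<le> j" and x: "x \<in> level N j" for i j x
    proof (rule ell2_eqI)
      fix \<sigma>
      obtain k where j: "j = Suc k"
        using ij by (cases j) auto
      show "coord (entry N T i j x) \<sigma> = coord (ampl N (entry N T (i - 1) (j - 1)) x) \<sigma>"
      proof (cases \<sigma>)
        case Nil
        then show ?thesis
          using ij by (auto simp: coord_entry coord_ampl words_len_def)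
      next
        case (Cons a \<tau>)
        have "coord (T x) (a # \<tau>) = coord (T (comp_proj a x)) \<tau>" if "a \<in> {1..N}"
          using coord [OF that] x level_subset_fock by blast
        moreover have "comp_proj a x \<in> level N k"
          using x j by (simp add: comp_proj_level_Suc)
        ultimately show ?thesis
          using ij x j Cons
          by (simp add: coord_entry coord_ampl restrict_to_level) (auto simp: words_len_def)
      qed
    qed
    ultimately show "T \<in> upper_triangular_ops N"
      using T by (simp add: upper_triangular_ops_def)
  }
qed

section \<open>The adjoints of the operators \<open>F\<^sub>\<sigma>\<close>\<close>

text \<open>The operator \<open>D = I - (Z|Z)\<close> lies between 0 and the identity, so
  \<open>norm_sq_le_of_le_one\<close> applies to it. If \<open>K\<close> bounds its inverse, then
  \<open>(norm x)\<^sup>2 \<le> K\<^sup>2 * Re (cinner (D x) x)\<close>, which gives the uniform gap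
  \<open>r = 1 - 1 / K\<^sup>2\<close>.\<close>

lemma op_ball_gap:
  assumes Z: "Z \<in> op_ball N"
  obtains r where "0 \<le> r" "r < 1" "\<And>x. (\<Sum>a=1..N. (norm (Z a x))\<^sup>2) \<le> r * (norm x)\<^sup>2"
proof -
  define D where "D = (\<lambda>x. x - (\<Sum>k=1..N. adj UNIV (Z k) (Z k x)))"
  have Z_op: "\<And>k. k \<in> {1..N} \<Longrightarrow> Z k \<in> bounded_ops UNIV UNIV" and D: "positive_op UNIV D"
    and inv: "boundedly_invertible UNIV D"
    using Z by (simp_all add: op_ball_def D_def Let_def)
  have D_inner: "Re (cinner (D x) x) = (norm x)\<^sup>2 - (\<Sum>a=1..N. (norm (Z a x))\<^sup>2)" for x
  proof -
    have "Re (cinner (adj UNIV (Z a) (Z a x)) x) = (norm (Z a x))\<^sup>2" if "a \<in> {1..N}" for a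
      using cinner_adj_left [OF csubspace_UNIV closed_UNIV Z_op [OF that], of x "Z a x"]
      by (simp add: Re_cinner_self)
    then have "(\<Sum>a=1..N. Re (cinner (adj UNIV (Z a) (Z a x)) x)) = (\<Sum>a=1..N. (norm (Z a x))\<^sup>2)"
      by (rule sum.cong [OF refl])
    then show ?thesis
      by (simp add: D_def cinner_diff_left cinner_sum_left Re_cinner_self)
  qed
  obtain C where C: "C \<in> bounded_ops UNIV UNIV" "\<And>x. C (D x) = x"
    using inv by (auto simp: boundedly_invertible_def)
  obtain K where K: "K \<ge> 1" "\<And>x. norm (C x) \<le> K * norm x"
    using bounded_ops_bound [OF C(1)] by (metis UNIV_I)
  have D_le: "(norm (D x))\<^sup>2 \<le> Re (cinner (D x) x)" for x
    by (rule norm_sq_le_of_le_one [OF csubspace_UNIV D]) (simp_all add: D_inner sum_nonneg)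
  have "(norm x)\<^sup>2 \<le> K\<^sup>2 * ((norm x)\<^sup>2 - (\<Sum>a=1..N. (norm (Z a x))\<^sup>2))" for x
  proof -
    have "(norm x)\<^sup>2 \<le> (K * norm (D x))\<^sup>2"
      using K(2) [of "D x"] C(2) [of x] by (intro power_mono) auto
    also have "\<dots> \<le> K\<^sup>2 * Re (cinner (D x) x)"
      unfolding power_mult_distrib by (intro mult_left_mono D_le) auto
    finally show ?thesis by (simp add: D_inner)
  qed
  then have le: "(\<Sum>a=1..N. (norm (Z a x))\<^sup>2) \<le> (1 - 1 / K\<^sup>2) * (norm x)\<^sup>2" for x
    using K(1) by (simp add: field_simps)
  show ?thesis
    by (rule that [OF _ _ le]) (use K(1) in \<open>auto simp: field_simps\<close>)
qed

text \<open>
  The adjoint of \<open>F_op N l Z a\<close> on \<open>fock_upto N l\<close>, for every \<open>l\<close>: since the coordinates at words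
  longer than \<open>l\<close> vanish there, no truncation is needed.
\<close>

definition F_adj :: "(nat \<Rightarrow> 'e \<Rightarrow> 'e) \<Rightarrow> nat \<Rightarrow> 'e::complex_hilbert_space fock \<Rightarrow> 'e fock"
  where "F_adj Z a h = Abs_ell2 (\<lambda>\<sigma>. Z a (coord h \<sigma>) + coord h (\<sigma> @ [a]))"

text \<open>Taking adjoints reverses the product in \<open>F_word\<close>, so the first letter acts
  first and \<open>foldr\<close> becomes \<open>foldl\<close>.\<close>

definition F_adj_word :: "(nat \<Rightarrow> 'e \<Rightarrow> 'e) \<Rightarrow> nat list \<Rightarrow> 'e::complex_hilbert_space fock \<Rightarrow> 'e fock"
  where "F_adj_word Z \<sigma> h = foldl (\<lambda>h a. F_adj Z a h) h \<sigma>"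

lemma F_adj_word_simps [simp]:
  "F_adj_word Z [] h = h" "F_adj_word Z (a # \<sigma>) h = F_adj_word Z \<sigma> (F_adj Z a h)"
  by (simp_all add: F_adj_word_def)

text \<open>The observability operator of system theory: it records \<open>g\<close> along the orbit
  of \<open>h\<close>. The choices of \<open>g\<close> for \<open>U_inf\<close> and
  \<open>V_inf\<close> are the adjoints of \<open>U_col\<close> and \<open>V_col\<close>.\<close>

definition observe :: "nat \<Rightarrow> (nat \<Rightarrow> 'e \<Rightarrow> 'e) \<Rightarrow> ('e fock \<Rightarrow> 'e) \<Rightarrow> 'e::complex_hilbert_space fock \<Rightarrow> 'e fock"
  where "observe N Z g h = Abs_ell2 (\<lambda>\<sigma>. if \<sigma> \<in> words N then g (F_adj_word Z \<sigma> h) else 0)"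

text \<open>A coordinate moved from \<open>\<sigma> @ [a]\<close> to \<sigma> loses a factor
  \<open>w\<close> in weight.\<close>

definition weighted_sq :: "nat \<Rightarrow> nat \<Rightarrow> real \<Rightarrow> 'e::complex_hilbert_space fock \<Rightarrow> real"
  where "weighted_sq N l w h = (\<Sum>\<sigma>\<in>words_less N (Suc l). w ^ length \<sigma> * (norm (coord h \<sigma>))\<^sup>2)"


text \<open>The cross term is split by Young's inequality. For small \<epsilon> the first vector is
  hardly enlarged; the large factor falls on the second, which will be the shift part.\<close>

lemma norm_add_sq_le:
  fixes x y :: "'a::real_normed_vector"
  assumes "\<epsilon> > 0"
  shows "(norm (x + y))\<^sup>2 \<le> (1 + \<epsilon>) * (norm x)\<^sup>2 + (1 + 1 / \<epsilon>) * (norm y)\<^sup>2"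
proof -
  have "(norm (x + y))\<^sup>2 \<le> (norm x + norm y)\<^sup>2"
    by (simp add: norm_triangle_ineq power_mono)
  also have "\<dots> = (norm x)\<^sup>2 + 2 * norm x * norm y + (norm y)\<^sup>2"
    by (simp add: power2_sum)
  also have "2 * norm x * norm y \<le> \<epsilon> * (norm x)\<^sup>2 + (norm y)\<^sup>2 / \<epsilon>"
  proof -
    have "0 \<le> (\<epsilon> * norm x - norm y)\<^sup>2 / \<epsilon>"
      using assms by simp
    also have "\<dots> = \<epsilon> * (norm x)\<^sup>2 + (norm y)\<^sup>2 / \<epsilon> - 2 * norm x * norm y"
      using assms by (simp add: power2_diff power_mult_distrib field_simps power2_eq_square)
    finally show ?thesis by simp
  qed
  finally show ?thesis
    by (simp add: algebra_simps)
qed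

section \<open>Decay of orbits and boundedness of observation\<close>

context
  fixes N l :: nat and Z :: "nat \<Rightarrow> 'e::complex_hilbert_space \<Rightarrow> 'e"
  assumes Z: "Z \<in> op_ball N"
begin

lemma Z_op: "a \<in> {1..N} \<Longrightarrow> Z a \<in> bounded_ops UNIV UNIV"
  using Z by (simp add: op_ball_def)

lemma Z_lin: "a \<in> {1..N} \<Longrightarrow> clinear_on UNIV (Z a)"
  by (rule bounded_ops_clinear_on [OF Z_op])

lemma Z_zero: "a \<in> {1..N} \<Longrightarrow> Z a 0 = 0"
  using clinear_on_zero [OF Z_lin, of a] by simp

text \<open>On \<open>fock_upto N l\<close> the family inside \<open>Abs_ell2\<close> has finite
  support, hence is square summable.\<close>

lemma coord_F_adj:
  assumes "a \<in> {1..N}" "h \<in> fock_upto N l"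
  shows "coord (F_adj Z a h) \<sigma> = Z a (coord h \<sigma>) + coord h (\<sigma> @ [a])"
proof -
  have "(\<lambda>\<sigma>. (norm (Z a (coord h \<sigma>) + coord h (\<sigma> @ [a])))\<^sup>2) summable_on words_less N (Suc l)"
    by simp
  then have "(\<lambda>\<sigma>. (norm (Z a (coord h \<sigma>) + coord h (\<sigma> @ [a])))\<^sup>2) summable_on UNIV"
    by (rule summable_on_cong_neutral [THEN iffD1, rotated -1])
      (use assms in \<open>auto simp: fock_upto_eq sum_space_def words_less_def Z_zero\<close>)
  then show ?thesis
    by (simp add: F_adj_def Abs_ell2_inverse)
qed

lemma F_adj_mem: "a \<in> {1..N} \<Longrightarrow> h \<in> fock_upto N l \<Longrightarrow> F_adj Z a h \<in> fock_upto N l"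
  unfolding fock_upto_eq sum_space_def
  using coord_F_adj [of a h, unfolded fock_upto_eq sum_space_def]
  by (auto simp: words_less_def Z_zero)

lemma F_adj_lin: "a \<in> {1..N} \<Longrightarrow> clinear_on (fock_upto N l) (F_adj Z a)"
  by (intro clinear_onI ell2_eqI)
    (simp_all add: coord_F_adj csubspace_add [OF csubspace_fock(3)] csubspace_scaleC [OF csubspace_fock(3)]
      clinear_on_add [OF Z_lin] clinear_on_scaleC [OF Z_lin] coord_scaleC scaleC_add_right)

lemma F_adj_word_mem: "\<sigma> \<in> words N \<Longrightarrow> h \<in> fock_upto N l \<Longrightarrow> F_adj_word Z \<sigma> h \<in> fock_upto N l"
  by (induction \<sigma> arbitrary: h) (simp_all add: F_adj_mem)

lemma F_adj_word_lin: "\<sigma> \<in> words N \<Longrightarrow> clinear_on (fock_upto N l) (F_adj_word Z \<sigma>)"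
proof (induction \<sigma>)
  case (Cons a \<sigma>)
  then show ?case
    unfolding F_adj_word_simps by (intro clinear_on_compose [OF F_adj_lin Cons.IH F_adj_mem]) auto
qed (simp add: clinear_on_def)

text \<open>A large weight \<open>w\<close> makes the shift part of the operators small.\<close>

lemma weighted_sq_F_adj:
  obtains w q where "w \<ge> 1" "0 \<le> q" "q < 1"
    "\<And>h. h \<in> fock_upto N l \<Longrightarrow> (\<Sum>a=1..N. weighted_sq N l w (F_adj Z a h)) \<le> q * weighted_sq N l w h"
proof -
  obtain r where r: "0 \<le> r" "r < 1" "\<And>x. (\<Sum>a=1..N. (norm (Z a x))\<^sup>2) \<le> r * (norm x)\<^sup>2"
    using op_ball_gap [OF Z] by metis
  \<comment> \<open>With this \<epsilon> the part from \<open>Z\<close> contributes at most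
    \<open>(1 + r) / 2\<close>, and \<open>w\<close> is chosen so that the shift contributes
    \<open>(1 - r) / 4\<close>. Hence \<open>q \<le> (3 + r) / 4 < 1\<close>.\<close>
  define \<epsilon> where "\<epsilon> = (1 - r) / 2"
  define w where "w = 4 * (1 + 1 / \<epsilon>) / (1 - r)"
  define q where "q = (1 + \<epsilon>) * r + (1 + 1 / \<epsilon>) / w"
  have \<epsilon>: "\<epsilon> > 0" "1 + 1 / \<epsilon> > 0"
    using r by (simp_all add: \<epsilon>_def add_pos_pos)
  have w: "w \<ge> 1"
  proof -
    have "1 - r \<le> 4 * (1 + 1 / \<epsilon>)"
      using r \<epsilon>(1) by (simp add: add_increasing2)
    then show ?thesis
      using r by (simp add: w_def)
  qed
  have "k / (4 * k / (1 - r)) = (1 - r) / 4" if "k > 0" for k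
    using that by simp
  from this [OF \<epsilon>(2)] have q_eq: "q = (1 + \<epsilon>) * r + (1 - r) / 4"
    unfolding q_def w_def by (rule arg_cong)
  have "(1 + \<epsilon>) * r \<le> (1 + r) / 2"
    using mult_right_mono [of r 1 "(1 - r) / 2"] r by (simp add: \<epsilon>_def algebra_simps)
  then have "q \<le> (1 + r) / 2 + (1 - r) / 4"
    unfolding q_eq by (rule add_right_mono)
  then have q: "q < 1"
    using r(2) by (simp add: field_simps)
  have q0: "0 \<le> q"
    unfolding q_eq using r \<epsilon> by (intro add_nonneg_nonneg mult_nonneg_nonneg) simp_all
  show ?thesis
  proof (rule that [OF w q0 q])
    fix h :: "'e fock" assume h: "h \<in> fock_upto N l"
    let ?W = "words_less N (Suc l)" and ?g = "\<lambda>\<tau>. w ^ length \<tau> * (norm (coord h \<tau>))\<^sup>2"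
    \<comment> \<open>Appending a letter is injective on pairs, so each word is counted at most
      once, and it raises the weight by a factor \<open>w\<close>. Words longer than
      \<open>l\<close> drop out.\<close>
    have shift: "w * (\<Sum>a=1..N. \<Sum>\<sigma>\<in>?W. w ^ length \<sigma> * (norm (coord h (\<sigma> @ [a])))\<^sup>2) \<le> weighted_sq N l w h"
    proof -
      have inj: "inj_on (\<lambda>(a, \<sigma>). \<sigma> @ [a]) ({1..N} \<times> ?W)"
        by (auto simp: inj_on_def)
      have "w * (\<Sum>a=1..N. \<Sum>\<sigma>\<in>?W. w ^ length \<sigma> * (norm (coord h (\<sigma> @ [a])))\<^sup>2)
          = (\<Sum>(a, \<sigma>)\<in>{1..N} \<times> ?W. ?g (\<sigma> @ [a]))"
        by (simp add: sum_distrib_left sum.cartesian_product [symmetric] mult_ac)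
      also have "\<dots> = (\<Sum>\<tau>\<in>(\<lambda>(a, \<sigma>). \<sigma> @ [a]) ` ({1..N} \<times> ?W). ?g \<tau>)"
        using inj by (simp add: sum.reindex case_prod_unfold comp_def)
      also have "\<dots> = (\<Sum>\<tau>\<in>(\<lambda>(a, \<sigma>). \<sigma> @ [a]) ` ({1..N} \<times> ?W) \<inter> ?W. ?g \<tau>)"
        using h by (intro sum.mono_neutral_right) (auto simp: fock_upto_eq sum_space_def)
      also have "\<dots> \<le> (\<Sum>\<tau>\<in>?W. ?g \<tau>)"
        using w by (intro sum_mono2) auto
      finally show ?thesis by (simp add: weighted_sq_def)
    qed
    have "(\<Sum>a=1..N. weighted_sq N l w (F_adj Z a h))
        \<le> (\<Sum>a=1..N. \<Sum>\<sigma>\<in>?W. w ^ length \<sigma> *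
            ((1 + \<epsilon>) * (norm (Z a (coord h \<sigma>)))\<^sup>2 + (1 + 1 / \<epsilon>) * (norm (coord h (\<sigma> @ [a])))\<^sup>2))"
      unfolding weighted_sq_def using w
      by (intro sum_mono mult_left_mono) (simp_all add: coord_F_adj [OF _ h] norm_add_sq_le [OF \<epsilon>(1)])
    also have "\<dots> = (1 + \<epsilon>) * (\<Sum>a=1..N. \<Sum>\<sigma>\<in>?W. w ^ length \<sigma> * (norm (Z a (coord h \<sigma>)))\<^sup>2)
        + (1 + 1 / \<epsilon>) * (\<Sum>a=1..N. \<Sum>\<sigma>\<in>?W. w ^ length \<sigma> * (norm (coord h (\<sigma> @ [a])))\<^sup>2)"
      by (simp add: sum_distrib_left sum.distrib [symmetric] distrib_left mult_ac)
    also have "(\<Sum>a=1..N. \<Sum>\<sigma>\<in>?W. w ^ length \<sigma> * (norm (Z a (coord h \<sigma>)))\<^sup>2)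
        = (\<Sum>\<sigma>\<in>?W. w ^ length \<sigma> * (\<Sum>a=1..N. (norm (Z a (coord h \<sigma>)))\<^sup>2))"
      by (subst sum.swap) (simp add: sum_distrib_left)
    also have "\<dots> \<le> (\<Sum>\<sigma>\<in>?W. w ^ length \<sigma> * (r * (norm (coord h \<sigma>))\<^sup>2))"
      using w by (intro sum_mono mult_left_mono r(3)) auto
    also have "\<dots> = r * weighted_sq N l w h"
      by (simp add: weighted_sq_def sum_distrib_left mult_ac)
    finally have "(\<Sum>a=1..N. weighted_sq N l w (F_adj Z a h)) \<le> (1 + \<epsilon>) * (r * weighted_sq N l w h)
        + (1 + 1 / \<epsilon>) * (\<Sum>a=1..N. \<Sum>\<sigma>\<in>?W. w ^ length \<sigma> * (norm (coord h (\<sigma> @ [a])))\<^sup>2)"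
      using \<epsilon>(1) by (simp add: mult_left_mono)
    also have "\<dots> \<le> (1 + \<epsilon>) * (r * weighted_sq N l w h) + (1 + 1 / \<epsilon>) * (weighted_sq N l w h / w)"
      using \<epsilon>(2) w shift by (intro add_left_mono mult_left_mono) (auto simp: field_simps)
    also have "\<dots> = q * weighted_sq N l w h"
      by (simp add: q_def algebra_simps add_divide_distrib)
    finally show "(\<Sum>a=1..N. weighted_sq N l w (F_adj Z a h)) \<le> q * weighted_sq N l w h" .
  qed
qed

text \<open>One step along the orbit multiplies the total weighted square by at most
  \<open>q < 1\<close>, so a geometric series bounds the sum over all words. Bounding finite partial
  sums gives, by \<open>square_summable_bounded\<close>, both summability and the norm
  bound.\<close>

lemma observe_bound:
  assumes g: "g \<in> bounded_ops (fock_upto N l) R"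
  shows "\<exists>C. \<forall>h\<in>fock_upto N l. \<forall>A. finite A \<longrightarrow>
    L2_set (\<lambda>\<sigma>. norm (if \<sigma> \<in> words N then g (F_adj_word Z \<sigma> h) else 0)) A \<le> C * norm h"
proof -
  obtain w q where w: "w \<ge> 1" and q: "0 \<le> q" "q < 1"
    and step: "\<And>h. h \<in> fock_upto N l \<Longrightarrow>
      (\<Sum>a=1..N. weighted_sq N l w (F_adj Z a h)) \<le> q * weighted_sq N l w h"
    using weighted_sq_F_adj by metis
  obtain K where K: "K \<ge> 1" "\<And>x. x \<in> fock_upto N l \<Longrightarrow> norm (g x) \<le> K * norm x"
    using bounded_ops_bound [OF g] by metis
  let ?Q = "weighted_sq N l w"
  \<comment> \<open>The factor \<open>1 / (1 - q)\<close> is the fixed point of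
    \<open>b = 1 + q * b\<close>, so the bound reproduces itself in the induction.\<close>
  have sum_Q: "(\<Sum>\<sigma>\<in>words_less N n. ?Q (F_adj_word Z \<sigma> h)) \<le> ?Q h / (1 - q)" if "h \<in> fock_upto N l" for n h
    using that
  proof (induction n arbitrary: h)
    case 0
    have "0 \<le> ?Q h"
      using w by (auto simp: weighted_sq_def intro!: sum_nonneg)
    then show ?case using q by simp
  next
    case (Suc n)
    have "(\<Sum>\<sigma>\<in>words_less N (Suc n). ?Q (F_adj_word Z \<sigma> h)) \<le> ?Q h + (\<Sum>a=1..N. ?Q (F_adj Z a h) / (1 - q))"
      unfolding sum_words_less_Suc F_adj_word_simps
      by (intro add_left_mono sum_mono Suc.IH F_adj_mem Suc.prems) auto
    also have "\<dots> \<le> ?Q h + q * ?Q h / (1 - q)"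
      using step [OF Suc.prems] q by (simp add: sum_divide_distrib [symmetric] divide_right_mono)
    also have "\<dots> = ?Q h / (1 - q)"
      using q by (simp add: field_simps)
    finally show ?case .
  qed
  have Q_ge: "(norm h)\<^sup>2 \<le> ?Q h" if "h \<in> fock_upto N l" for h :: "'e fock"
  proof -
    have "(norm h)\<^sup>2 = (\<Sum>\<sigma>\<in>words_less N (Suc l). 1 * (norm (coord h \<sigma>))\<^sup>2)"
      using that by (subst norm_ell2_sq_eq_sum [of "words_less N (Suc l)"]) (auto simp: fock_upto_eq sum_space_def)
    also have "\<dots> \<le> ?Q h"
      unfolding weighted_sq_def using w by (intro sum_mono mult_right_mono) auto
    finally show ?thesis .
  qed
  have Q_le: "?Q h \<le> w ^ l * (norm h)\<^sup>2" for h :: "'e fock"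
  proof -
    have "?Q h \<le> (\<Sum>\<sigma>\<in>words_less N (Suc l). w ^ l * (norm (coord h \<sigma>))\<^sup>2)"
      unfolding weighted_sq_def
      using w by (intro sum_mono mult_right_mono power_increasing) (auto simp: words_less_def)
    also have "\<dots> \<le> w ^ l * (norm h)\<^sup>2"
      using w by (simp add: sum_distrib_left [symmetric] mult_left_mono sum_coord_sq_le)
    finally show ?thesis .
  qed
  show ?thesis
  \<comment> \<open>Here \<open>K\<close> bounds \<open>g\<close>, \<open>w ^ l\<close> compares the
    weighted square with the usual one, and \<open>1 / (1 - q)\<close> sums the orbit.\<close>
  proof (intro exI [of _ "K * sqrt (w ^ l / (1 - q))"] ballI allI impI)
    fix h :: "'e fock" and A :: "nat list set" assume h: "h \<in> fock_upto N l" and A: "finite A"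
    obtain n where n: "A \<inter> words N \<subseteq> words_less N n"
      using words_less_subset [of "A \<inter> words N" N] A by auto
    have "(\<Sum>\<sigma>\<in>A. (norm (if \<sigma> \<in> words N then g (F_adj_word Z \<sigma> h) else 0))\<^sup>2)
        = (\<Sum>\<sigma>\<in>A \<inter> words N. (norm (g (F_adj_word Z \<sigma> h)))\<^sup>2)"
      using A by (intro sum.mono_neutral_cong_right) auto
    also have "\<dots> \<le> (\<Sum>\<sigma>\<in>words_less N n. (norm (g (F_adj_word Z \<sigma> h)))\<^sup>2)"
      using n by (intro sum_mono2) auto
    also have "\<dots> \<le> (\<Sum>\<sigma>\<in>words_less N n. K\<^sup>2 * ?Q (F_adj_word Z \<sigma> h))"
    proof (rule sum_mono)
      fix \<sigma> assume "\<sigma> \<in> words_less N n"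
      then have mem: "F_adj_word Z \<sigma> h \<in> fock_upto N l"
        using h by (intro F_adj_word_mem) (auto simp: words_less_def)
      have "(norm (g (F_adj_word Z \<sigma> h)))\<^sup>2 \<le> (K * norm (F_adj_word Z \<sigma> h))\<^sup>2"
        by (intro power_mono K mem) auto
      also have "\<dots> \<le> K\<^sup>2 * ?Q (F_adj_word Z \<sigma> h)"
        unfolding power_mult_distrib by (intro mult_left_mono Q_ge mem) auto
      finally show "(norm (g (F_adj_word Z \<sigma> h)))\<^sup>2 \<le> K\<^sup>2 * ?Q (F_adj_word Z \<sigma> h)" .
    qed
    also have "\<dots> \<le> K\<^sup>2 * (?Q h / (1 - q))"
      unfolding sum_distrib_left [symmetric] by (intro mult_left_mono sum_Q h) auto
    also have "\<dots> \<le> K\<^sup>2 * (w ^ l * (norm h)\<^sup>2 / (1 - q))"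
      using q by (intro mult_left_mono divide_right_mono Q_le) auto
    also have "\<dots> = (K * sqrt (w ^ l / (1 - q)) * norm h)\<^sup>2"
      using q w by (simp add: power_mult_distrib)
    finally show "L2_set (\<lambda>\<sigma>. norm (if \<sigma> \<in> words N then g (F_adj_word Z \<sigma> h) else 0)) A
        \<le> K * sqrt (w ^ l / (1 - q)) * norm h"
      unfolding L2_set_def using K(1) q w by (intro real_le_lsqrt) (auto intro: sum_nonneg)
  qed
qed

lemma coord_observe:
  assumes g: "g \<in> bounded_ops (fock_upto N l) R" and h: "h \<in> fock_upto N l"
  shows "coord (observe N Z g h) \<sigma> = (if \<sigma> \<in> words N then g (F_adj_word Z \<sigma> h) else 0)"
proof -
  obtain C where C: "\<And>h A. h \<in> fock_upto N l \<Longrightarrow> finite A \<Longrightarrow>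
      L2_set (\<lambda>\<sigma>. norm (if \<sigma> \<in> words N then g (F_adj_word Z \<sigma> h) else 0)) A \<le> C * norm h"
    using observe_bound [OF g] by blast
  from square_summable_bounded(1) [OF C [OF h]] show ?thesis
    by (simp add: observe_def Abs_ell2_inverse)
qed

lemma observe_bounded_ops:
  assumes g: "g \<in> bounded_ops (fock_upto N l) R"
  shows "observe N Z g \<in> bounded_ops (fock_upto N l) (fock N)"
proof -
  obtain C where C: "\<And>h A. h \<in> fock_upto N l \<Longrightarrow> finite A \<Longrightarrow>
      L2_set (\<lambda>\<sigma>. norm (if \<sigma> \<in> words N then g (F_adj_word Z \<sigma> h) else 0)) A \<le> C * norm h"
    using observe_bound [OF g] by blast
  note lin = bounded_ops_clinear_on [OF g]
  show ?thesis
  proof (rule bounded_opsI [where K = C])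
    fix h :: "'e fock" assume h: "h \<in> fock_upto N l"
    show "observe N Z g h \<in> fock N"
      by (simp add: fock_def sum_space_def coord_observe [OF g h])
    show "norm (observe N Z g h) \<le> C * norm h"
      unfolding norm_ell2_def [of "observe N Z g h"] coord_observe [OF g h]
      by (rule square_summable_bounded(2) [OF C [OF h]])
  next
    show "clinear_on (fock_upto N l) (observe N Z g)"
      by (intro clinear_onI ell2_eqI)
        (simp_all add: coord_observe [OF g] csubspace_add [OF csubspace_fock(3)]
          csubspace_scaleC [OF csubspace_fock(3)] coord_scaleC F_adj_word_mem clinear_on_add [OF F_adj_word_lin]
          clinear_on_scaleC [OF F_adj_word_lin] clinear_on_add [OF lin] clinear_on_scaleC [OF lin])
  qed
qed

text \<open>\<open>F_adj_word\<close> consumes letters from the front, so stripping the first letter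
  means moving \<open>h\<close> one step along its orbit.\<close>

lemma comp_proj_observe:
  assumes g: "g \<in> bounded_ops (fock_upto N l) R" and h: "h \<in> fock_upto N l" and a: "a \<in> {1..N}"
  shows "comp_proj a (observe N Z g h) = observe N Z g (F_adj Z a h)"
  using a by (intro ell2_eqI) (simp add: coord_observe [OF g h] coord_observe [OF g F_adj_mem [OF a h]])

end

section \<open>The operators \<open>U\<^sub>\<infinity>\<close> and \<open>V\<^sub>\<infinity>\<close>\<close>

lemma Nil_in_words_len [simp]: "[] \<in> words_len N k \<longleftrightarrow> k = 0"
  by (auto simp: words_len_def)

lemma Cons_in_words_len_Suc [simp]:
  "a # \<sigma> \<in> words_len N (Suc k) \<longleftrightarrow> a \<in> {1..N} \<and> \<sigma> \<in> words_len N k"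
  by (auto simp: words_len_def)

lemma Cons_in_words_len_0 [simp]: "a # \<sigma> \<notin> words_len N 0"
  by (auto simp: words_len_def)

text \<open>Each \<open>ampl\<close> leaves the outermost letter in place, so the entry
  \<open>E\<^sub>k\<close> acts after all letters are peeled off: it appends \<open>k\<close> at the
  end of the word. Hence \<open>last\<close> and \<open>butlast\<close>.\<close>

lemma coord_F_entry:
  assumes "k \<in> {1..N}"
  shows "coord (F_entry N Z k i j x) \<sigma> =
    (if \<sigma> \<in> words_len N i then
      if i = j then adj UNIV (Z k) (coord x \<sigma>)
      else if i = Suc j \<and> last \<sigma> = k then coord x (butlast \<sigma>) else 0
    else 0)"
  using assms
proof (induction N Z k i j x arbitrary: \<sigma> rule: F_entry.induct)
  case (1 N Z k x)
  then show ?case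
    by (cases \<sigma>) (auto simp: coord_single)
next
  case (2 N Z k x)
  show ?case
  proof (cases \<sigma>)
    case (Cons a \<tau>)
    then show ?thesis
      using 2 by (cases \<tau>) (auto simp: coord_single words_len_def)
  qed (simp add: coord_single)
next
  case (3 N Z k i x)
  then show ?case by simp
next
  case (4 N Z k j x)
  then show ?case by simp
next
  case (5 N Z k i j x)
  show ?case
  proof (cases \<sigma>)
    case (Cons a \<tau>)
    have "i = 0 \<longleftrightarrow> \<tau> = []" if "\<tau> \<in> words_len N i"
      using that by (auto simp: words_len_def)
    then show ?thesis
      using 5 Cons by (auto simp: coord_ampl)
  qed (simp add: coord_ampl)
qed

lemma coord_F_op:
  assumes k: "k \<in> {1..N}"
  shows "coord (F_op N l Z k x) \<sigma> =
    (if \<sigma> \<in> words_less N (Suc l) then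
      adj UNIV (Z k) (coord x \<sigma>) + (if \<sigma> \<noteq> [] \<and> last \<sigma> = k then coord x (butlast \<sigma>) else 0)
    else 0)"
proof (cases "\<sigma> \<in> words_less N (Suc l)")
  case False
  then have "\<sigma> \<notin> words_len N i" if "i \<le> l" for i
    using that by (auto simp: words_less_def words_len_def)
  then show ?thesis
    using False by (simp add: F_op_def coord_sum coord_F_entry [OF k])
next
  case True
  define n where "n = length \<sigma>"
  let ?f = "\<lambda>i j. coord (F_entry N Z k i j (restrict_to (words_len N j) x)) \<sigma>"
  have \<sigma>: "\<sigma> \<in> words_len N i \<longleftrightarrow> i = n" for i
    using True by (auto simp: words_len_def words_less_def n_def)
  have n: "n \<le> l"
    using True by (simp add: words_less_def n_def)
  have "coord (F_op N l Z k x) \<sigma> = (\<Sum>j\<le>l. \<Sum>i\<le>l. ?f i j)"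
    unfolding F_op_def coord_sum by (rule sum.swap)
  also have "\<dots> = (\<Sum>j\<le>l. ?f n j)"
  proof (rule sum.cong [OF refl])
    fix j
    show "(\<Sum>i\<le>l. ?f i j) = ?f n j"
      using n by (subst sum.remove [of _ n]) (auto simp: coord_F_entry [OF k] \<sigma>)
  qed
  \<comment> \<open>In row \<open>n\<close> only the diagonal entry and the one to its left
    survive.\<close>
  also have "\<dots> = (\<Sum>j\<in>{..l} \<inter> {j. j = n \<or> n = Suc j}. ?f n j)"
    by (intro sum.mono_neutral_right) (auto simp: coord_F_entry [OF k])
  also have "\<dots> = adj UNIV (Z k) (coord x \<sigma>) + (if \<sigma> \<noteq> [] \<and> last \<sigma> = k then coord x (butlast \<sigma>) else 0)"
  proof (cases "\<sigma> = []")
    case True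
    then have "n = 0"
      by (simp add: n_def)
    then have "{..l} \<inter> {j. j = n \<or> n = Suc j} = {0}"
      by auto
    then show ?thesis
      using True \<open>n = 0\<close> by (simp add: coord_single coord_restrict_to)
  next
    case False
    then have "n > 0"
      by (simp add: n_def)
    then have eq: "{..l} \<inter> {j. j = n \<or> n = Suc j} = {n, n - 1}" "n \<noteq> n - 1" "n = Suc (n - 1)"
      using n by auto
    have "butlast \<sigma> \<in> words_len N (n - 1)"
      using True by (auto simp: words_len_def words_less_def n_def words_def dest: in_set_butlastD)
    then show ?thesis
      unfolding eq(1) using eq(2,3) False
      by (subst sum.insert) (auto simp: coord_F_entry [OF k] \<sigma> coord_restrict_to)
  qed
  finally show ?thesis
    using True by simp
qed

context
  fixes N l :: nat and Z :: "nat \<Rightarrow> 'e::complex_hilbert_space \<Rightarrow> 'e"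
  assumes Z: "Z \<in> op_ball N"
begin

lemma F_op_mem: "k \<in> {1..N} \<Longrightarrow> F_op N l Z k x \<in> fock_upto N l"
  by (simp add: fock_upto_eq sum_space_def coord_F_op)

lemma cinner_F_op:
  assumes k: "k \<in> {1..N}" and x: "x \<in> fock_upto N l" and h: "h \<in> fock_upto N l"
  shows "cinner (F_op N l Z k x) h = cinner x (F_adj Z k h)"
proof -
  let ?W = "words_less N (Suc l)"
  have "cinner (F_op N l Z k x) h = (\<Sum>\<sigma>\<in>?W. cinner (coord (F_op N l Z k x) \<sigma>) (coord h \<sigma>))"
    using h by (intro cinner_ell2_eq_sum) (auto simp: fock_upto_eq sum_space_def)
  also have "\<dots> = (\<Sum>\<sigma>\<in>?W. cinner (coord x \<sigma>) (Z k (coord h \<sigma>)))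
      + (\<Sum>\<sigma>\<in>?W. if \<sigma> \<noteq> [] \<and> last \<sigma> = k then cinner (coord x (butlast \<sigma>)) (coord h \<sigma>) else 0)"
    unfolding sum.distrib [symmetric]
    by (intro sum.cong refl)
      (simp add: coord_F_op [OF k] cinner_add_left
        cinner_adj_left [OF csubspace_UNIV closed_UNIV Z_op [OF Z k]])
  \<comment> \<open>Words ending in \<open>k\<close> are reindexed by what precedes the final
    letter, which has length below \<open>l\<close>.\<close>
  also have "(\<Sum>\<sigma>\<in>?W. if \<sigma> \<noteq> [] \<and> last \<sigma> = k then cinner (coord x (butlast \<sigma>)) (coord h \<sigma>) else 0)
      = (\<Sum>\<sigma>\<in>(\<lambda>\<tau>. \<tau> @ [k]) ` words_less N l. cinner (coord x (butlast \<sigma>)) (coord h \<sigma>))"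
  proof (rule sum.mono_neutral_cong_right)
    show "(\<lambda>\<tau>. \<tau> @ [k]) ` words_less N l \<subseteq> ?W"
      using k by (auto simp: words_less_def)
    have "\<sigma> \<in> (\<lambda>\<tau>. \<tau> @ [k]) ` words_less N l" if "\<sigma> \<in> ?W" "\<sigma> \<noteq> []" "last \<sigma> = k" for \<sigma>
    proof (rule image_eqI [of _ _ "butlast \<sigma>"])
      show "\<sigma> = butlast \<sigma> @ [k]"
        using that append_butlast_last_id by force
      then show "butlast \<sigma> \<in> words_less N l"
        using that by (metis (no_types, lifting) append_in_words length_append_singleton mem_Collect_eq
            not_less_eq words_less_def)
    qed
    then show "\<forall>\<sigma>\<in>?W - (\<lambda>\<tau>. \<tau> @ [k]) ` words_less N l.
        (if \<sigma> \<noteq> [] \<and> last \<sigma> = k then cinner (coord x (butlast \<sigma>)) (coord h \<sigma>) else 0) = 0"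
      by auto
  qed auto
  also have "\<dots> = (\<Sum>\<tau>\<in>words_less N l. cinner (coord x \<tau>) (coord h (\<tau> @ [k])))"
    by (subst sum.reindex) (auto simp: inj_on_def)
  \<comment> \<open>Words of length exactly \<open>l\<close> may be added: one more letter leads to
    length \<open>l + 1\<close>, where \<open>h\<close> vanishes.\<close>
  also have "\<dots> = (\<Sum>\<tau>\<in>?W. cinner (coord x \<tau>) (coord h (\<tau> @ [k])))"
    by (rule sum.mono_neutral_left [OF finite_words_less])
      (use h in \<open>auto simp: fock_upto_eq sum_space_def words_less_def\<close>)
  also have "(\<Sum>\<sigma>\<in>?W. cinner (coord x \<sigma>) (Z k (coord h \<sigma>))) + \<dots>
      = (\<Sum>\<sigma>\<in>?W. cinner (coord x \<sigma>) (coord (F_adj Z k h) \<sigma>))"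
    by (simp add: coord_F_adj [OF Z k h] cinner_add_right sum.distrib)
  also have "\<dots> = cinner x (F_adj Z k h)"
    using x by (intro cinner_ell2_eq_sum [symmetric]) (auto simp: fock_upto_eq sum_space_def)
  finally show ?thesis .
qed

lemma F_word_mem:
  "\<sigma> \<in> words N \<Longrightarrow> x \<in> fock_upto N l \<Longrightarrow> F_word N l Z \<sigma> x \<in> fock_upto N l"
  by (induction \<sigma>) (simp_all add: F_word_def F_op_mem)

lemma cinner_F_word:
  "\<sigma> \<in> words N \<Longrightarrow> x \<in> fock_upto N l \<Longrightarrow> h \<in> fock_upto N l \<Longrightarrow>
    cinner (F_word N l Z \<sigma> x) h = cinner x (F_adj_word Z \<sigma> h)"
proof (induction \<sigma> arbitrary: h)
  case (Cons a \<sigma>)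
  then show ?case
    using cinner_F_op [of a "F_word N l Z \<sigma> x" h] F_word_mem [of \<sigma> x]
    by (simp add: F_word_def F_adj_mem [OF Z])
qed (simp add: F_word_def)

text \<open>The bounded adjoint of \<open>observe\<close> is applied termwise to the expansion of
  the input in its coordinates. This both proves convergence of the infinite sum in
  \<open>F_row\<close> and evaluates it.\<close>

lemma F_row_eq_adj:
  assumes g: "g \<in> bounded_ops (fock_upto N l) UNIV"
    and G: "\<And>e. G e \<in> fock_upto N l"
    and gG: "\<And>e h. h \<in> fock_upto N l \<Longrightarrow> cinner (G e) h = cinner e (g h)"
  shows "F_row N l Z G x = adj (fock_upto N l) (observe N Z g) (restrict_to (words N) x)"
proof -
  let ?S = "fock_upto N l"
  have op: "observe N Z g \<in> bounded_ops ?S (fock N)"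
    by (rule observe_bounded_ops [OF Z g])
  note adj = adj_bounded_ops [OF csubspace_fock(3) closed_fock(3) op]
  have G0: "G 0 = 0"
    by (rule cinner_ext_left [of ?S]) (simp_all add: gG G)
  have single: "adj ?S (observe N Z g) (single \<sigma> e) = F_word N l Z \<sigma> (G e)" if \<sigma>: "\<sigma> \<in> words N" for \<sigma> e
  proof (rule adj_eqI [OF csubspace_fock(3) F_word_mem [OF \<sigma> G]])
    fix h :: "'e fock" assume h: "h \<in> ?S"
    have "cinner h (F_word N l Z \<sigma> (G e)) = cnj (cinner e (g (F_adj_word Z \<sigma> h)))"
      using cinner_commute [of h] cinner_F_word [OF \<sigma> G h, of e] gG [OF F_adj_word_mem [OF Z \<sigma> h]]
      by simp
    also have "\<dots> = cinner (g (F_adj_word Z \<sigma> h)) e"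
      by (metis cinner_commute)
    finally show "cinner (observe N Z g h) (single \<sigma> e) = cinner h (F_word N l Z \<sigma> (G e))"
      by (simp add: cinner_single_right coord_observe [OF Z g h] \<sigma>)
  qed
  have "((\<lambda>\<sigma>. adj ?S (observe N Z g) (single \<sigma> (coord (restrict_to (words N) x) \<sigma>)))
      has_sum adj ?S (observe N Z g) (restrict_to (words N) x)) UNIV"
    by (rule has_sum_bounded_linear [OF bounded_ops_bounded_linear [OF adj] has_sum_single, unfolded comp_def])
  then have "((\<lambda>\<sigma>. F_word N l Z \<sigma> (G (coord x \<sigma>)))
      has_sum adj ?S (observe N Z g) (restrict_to (words N) x)) (words N)"
  proof (rule has_sum_cong_neutral [THEN iffD1, rotated -1])
    fix \<sigma> assume "\<sigma> \<in> UNIV - words N"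
    moreover have "adj ?S (observe N Z g) (single \<sigma> 0) = 0" for \<sigma>
      by (rule adj_eqI [OF csubspace_fock(3) csubspace_zero [OF csubspace_fock(3)]]) (simp add: cinner_single_right)
    ultimately show "adj ?S (observe N Z g) (single \<sigma> (coord (restrict_to (words N) x) \<sigma>)) = 0"
      by (simp add: coord_restrict_to)
  qed (simp_all add: coord_restrict_to single)
  then show ?thesis
    unfolding F_row_def by (rule infsumI)
qed

lemma cinner_F_row:
  assumes "g \<in> bounded_ops (fock_upto N l) UNIV" "\<And>e. G e \<in> fock_upto N l"
    and "\<And>e h. h \<in> fock_upto N l \<Longrightarrow> cinner (G e) h = cinner e (g h)"
    and h: "h \<in> fock_upto N l" and x: "x \<in> fock N"
  shows "cinner (F_row N l Z G x) h = cinner x (observe N Z g h)"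
proof -
  have "restrict_to (words N) x = x"
    using x by (intro ell2_eqI) (auto simp: coord_restrict_to fock_def sum_space_def)
  then show ?thesis
    using cinner_adj_left [OF csubspace_fock(3) closed_fock(3) observe_bounded_ops [OF Z assms(1)] h, of x]
    by (simp add: F_row_eq_adj [OF assms(1-3)])
qed

lemma adj_F_row:
  assumes "g \<in> bounded_ops (fock_upto N l) UNIV" "\<And>e. G e \<in> fock_upto N l"
    and "\<And>e h. h \<in> fock_upto N l \<Longrightarrow> cinner (G e) h = cinner e (g h)"
    and h: "h \<in> fock_upto N l"
  shows "adj (fock N) (F_row N l Z G) h = observe N Z g h"
  using bounded_ops_mem [OF observe_bounded_ops [OF Z assms(1)] h] cinner_F_row [OF assms]
  by (intro adj_eqI [OF csubspace_fock(1)]) auto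

end

section \<open>The interpolation theorem\<close>

text \<open>Operators are total functions that matter only on their domains; \<open>U_inf\<close>
  and \<open>V_inf\<close> are identified with \<open>observe_U\<close> and \<open>observe_V\<close>
  on \<open>fock_upto N l\<close> only.\<close>

lemma adj_cong: "(\<And>x. x \<in> S \<Longrightarrow> A x = A' x) \<Longrightarrow> adj S A = adj S A'"
  by (simp add: adj_def fun_eq_iff cong: conj_cong ball_cong)

lemma positive_op_cong:
  assumes "csubspace S" "\<And>x. x \<in> S \<Longrightarrow> A x = A' x"
  shows "positive_op S A \<longleftrightarrow> positive_op S A'"
  using assms unfolding positive_op_def bounded_ops_def csubspace_def by auto

lemma bounded_ops_sum:
  assumes "\<And>i. i \<in> I \<Longrightarrow> A i \<in> bounded_ops S R" "csubspace R"
  shows "(\<lambda>x. \<Sum>i\<in>I. A i x) \<in> bounded_ops S R"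
  using assms(1)
proof (induction I rule: infinite_finite_induct)
  case (insert i I)
  have zero: "(\<lambda>x. 0) \<in> bounded_ops S R"
    using assms(2) by (auto intro!: bounded_opsI [where K = 0] clinear_onI csubspace_zero)
  \<comment> \<open>Addition is written as a double difference so that
    \<open>bounded_ops_diff\<close> covers it.\<close>
  have "(\<lambda>x. (\<Sum>i\<in>I. A i x) - (0 - A i x)) \<in> bounded_ops S R"
    by (intro bounded_ops_diff zero insert assms(2)) auto
  then show ?case
    using insert by (simp add: add.commute)
qed (use assms(2) in \<open>auto intro!: bounded_opsI [where K = 0] clinear_onI csubspace_zero\<close>)

text \<open>The quadratic form of a difference of Gram operators is a difference of squared norms.
  This turns operator positivity into a norm inequality.\<close>

lemma positive_op_gram_diff:
  assumes S: "csubspace S" "closed S" and u: "u \<in> bounded_ops S Q" and v: "v \<in> bounded_ops S R"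
  shows "positive_op S (\<lambda>x. adj S u (u x) - adj S v (v x)) \<longleftrightarrow> (\<forall>x\<in>S. norm (v x) \<le> norm (u x))"
    and "x \<in> S \<Longrightarrow> Re (cinner (adj S u (u x) - adj S v (v x)) x) = (norm (u x))\<^sup>2 - (norm (v x))\<^sup>2"
proof -
  let ?D = "\<lambda>x. adj S u (u x) - adj S v (v x)"
  have eq: "cinner (?D x) x = complex_of_real ((norm (u x))\<^sup>2 - (norm (v x))\<^sup>2)" if "x \<in> S" for x
    using that by (simp add: cinner_diff_left cinner_adj_left [OF S u] cinner_adj_left [OF S v] cinner_self)
  have "u \<in> bounded_ops S UNIV" "v \<in> bounded_ops S UNIV"
    using u v by (auto simp: bounded_ops_iff)
  then have "?D \<in> bounded_ops S S"
    by (intro bounded_ops_diff bounded_ops_compose [OF _ adj_bounded_ops [OF S u]]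
        bounded_ops_compose [OF _ adj_bounded_ops [OF S v]] S)
  then show "positive_op S ?D \<longleftrightarrow> (\<forall>x\<in>S. norm (v x) \<le> norm (u x))"
    by (auto simp: positive_op_def eq abs_le_square_iff [symmetric] simp del: of_real_diff of_real_power)
  show "x \<in> S \<Longrightarrow> Re (cinner (?D x) x) = (norm (u x))\<^sup>2 - (norm (v x))\<^sup>2"
    by (simp only: eq Re_complex_of_real)
qed

lemma restrict_to_bounded_ops: "restrict_to W \<in> bounded_ops S (sum_space W)"
proof (rule bounded_opsI [where K = 1])
  show "clinear_on S (restrict_to W)"
    by (intro clinear_onI ell2_eqI) (simp_all add: coord_restrict_to coord_scaleC)
qed (simp_all add: norm_restrict_to_le sum_space_def coord_restrict_to)

lemma cinner_restrict_to:
  assumes "x \<in> sum_space W"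
  shows "cinner x (restrict_to W y) = cinner x y"
proof -
  have "cinner (coord x i) (coord (restrict_to W y) i) = cinner (coord x i) (coord y i)" for i
    using assms by (auto simp: coord_restrict_to sum_space_def)
  then show ?thesis
    by (simp add: cinner_ell2_def)
qed

text \<open>The row operator \<open>[B\<^sub>0 ... B\<^sub>l]\<close>, adjoint to
  \<open>V_col\<close>.\<close>

definition data_functional :: "nat \<Rightarrow> nat \<Rightarrow> (nat \<Rightarrow> 'e fock \<Rightarrow> 'e) \<Rightarrow> 'e::complex_hilbert_space fock \<Rightarrow> 'e"
  where "data_functional N l B h = (\<Sum>m\<le>l. B m (restrict_to (words_len N m) h))"

lemma coord_bounded_ops: "(\<lambda>h. coord h []) \<in> bounded_ops S UNIV"
  by (rule bounded_opsI [where K = 1]) (simp_all add: clinear_on_coord norm_coord_le)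

abbreviation observe_U :: "nat \<Rightarrow> (nat \<Rightarrow> 'e \<Rightarrow> 'e) \<Rightarrow> 'e::complex_hilbert_space fock \<Rightarrow> 'e fock"
  where "observe_U N Z \<equiv> observe N Z (\<lambda>h. coord h [])"

abbreviation observe_V ::
    "nat \<Rightarrow> nat \<Rightarrow> (nat \<Rightarrow> 'e \<Rightarrow> 'e) \<Rightarrow> (nat \<Rightarrow> 'e fock \<Rightarrow> 'e) \<Rightarrow>
      'e::complex_hilbert_space fock \<Rightarrow> 'e fock"
  where "observe_V N l Z B \<equiv> observe N Z (data_functional N l B)"

section \<open>Reduction of the interpolation problem to an intertwining equation\<close>

context
  fixes N l :: nat and Z :: "nat \<Rightarrow> 'e::complex_hilbert_space \<Rightarrow> 'e" and B :: "nat \<Rightarrow> 'e fock \<Rightarrow> 'e"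
  assumes Z: "Z \<in> op_ball N"
    and B: "\<And>k. k \<le> l \<Longrightarrow> B k \<in> bounded_ops (level N k) UNIV"
begin

lemma level_subset_fock_upto: "k \<le> l \<Longrightarrow> level N k \<subseteq> fock_upto N l"
  unfolding level_def fock_upto_def by (rule sum_space_mono) (auto simp: words_len_def)

lemma data_functional_bounded_ops: "data_functional N l B \<in> bounded_ops S UNIV"
  unfolding data_functional_def [abs_def]
proof (rule bounded_ops_sum)
  fix m assume "m \<in> {..l}"
  then show "(\<lambda>h. B m (restrict_to (words_len N m) h)) \<in> bounded_ops S UNIV"
    by (intro bounded_ops_compose [OF restrict_to_bounded_ops B [unfolded level_def]]) simp
qed simp

lemma adj_B_mem: "k \<le> l \<Longrightarrow> adj (level N k) (B k) e \<in> level N k"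
  by (rule adj_mem [OF csubspace_fock(2) closed_fock(2) B])

lemma V_col_mem: "V_col N l B e \<in> fock_upto N l"
  unfolding V_col_def using adj_B_mem level_subset_fock_upto
  by (intro csubspace_sum [OF csubspace_fock(3)]) auto

lemma cinner_V_col: "cinner (V_col N l B e) h = cinner e (data_functional N l B h)"
proof -
  have "cinner (adj (level N m) (B m) e) h = cinner e (B m (restrict_to (words_len N m) h))" if "m \<le> l" for m
  proof -
    have "restrict_to (words_len N m) h \<in> level N m"
      unfolding level_def by (rule bounded_ops_mem [OF restrict_to_bounded_ops UNIV_I])
    then have "cinner (adj (level N m) (B m) e) (restrict_to (words_len N m) h)
        = cinner e (B m (restrict_to (words_len N m) h))"
      by (rule cinner_adj_left [OF csubspace_fock(2) closed_fock(2) B [OF that]])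
    then show ?thesis
      using adj_B_mem [OF that] by (simp add: cinner_restrict_to level_def)
  qed
  then show ?thesis
    by (simp add: V_col_def data_functional_def cinner_sum_left cinner_sum_right)
qed

text \<open>The level \<open>k\<close> is free because \<open>L_row\<close> is truncated at
  \<open>length \<tau>\<close> rather than at \<open>l\<close>.\<close>

lemma u_bounded_ops: "observe_U N Z \<in> bounded_ops (fock_upto N k) (fock N)"
  and v_bounded_ops: "observe_V N l Z B \<in> bounded_ops (fock_upto N k) (fock N)"
  by (rule observe_bounded_ops [OF Z coord_bounded_ops] observe_bounded_ops [OF Z data_functional_bounded_ops])+

lemma U_inf_eq: "h \<in> fock_upto N l \<Longrightarrow> U_inf N l Z h = observe_U N Z h"
  unfolding U_inf_def
  by (rule adj_F_row [OF Z coord_bounded_ops])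
    (simp_all add: U_col_def cinner_single_left fock_upto_eq words_less_def single_in_sum_space)

lemma V_inf_eq: "h \<in> fock_upto N l \<Longrightarrow> V_inf N l Z B h = observe_V N l Z B h"
  unfolding V_inf_def
  by (rule adj_F_row [OF Z data_functional_bounded_ops]) (simp_all add: V_col_mem cinner_V_col)

text \<open>The adjoint of \<open>L_row N Z \<tau>\<close> is the column of \<open>U_inf\<close> at
  \<tau>. As \<open>observe_U\<close> carries no truncation, this column is the same for every
  truncation from \<open>length \<tau>\<close> on.\<close>

lemma partial_deriv_eq:
  assumes "\<tau> \<in> words N"
  shows "partial_deriv N Z T \<tau> e = coord (T (observe_U N Z (single \<tau> e))) []"
proof -
  have mem: "single \<tau> e \<in> fock_upto N (length \<tau>)"
    using assms by (simp add: fock_upto_def single_in_sum_space)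
  have "adj (fock N) (L_row N Z \<tau>) e = observe_U N Z (single \<tau> e)"
  proof (rule adj_eqI [OF csubspace_fock(1) bounded_ops_mem [OF u_bounded_ops mem]])
    fix x :: "'e fock" assume x: "x \<in> fock N"
    have "cinner (L_row N Z \<tau> x) e = cinner (F_row N (length \<tau>) Z U_col x) (single \<tau> e)"
      by (simp add: L_row_def cinner_single_right)
    also have "\<dots> = cinner x (observe_U N Z (single \<tau> e))"
      by (rule cinner_F_row [OF Z coord_bounded_ops _ _ mem x])
        (simp_all add: U_col_def cinner_single_left fock_upto_eq words_less_def single_in_sum_space)
    finally show "cinner (L_row N Z \<tau> x) e = cinner x (observe_U N Z (single \<tau> e))" .
  qed
  then show ?thesis
    by (simp add: partial_deriv_def)
qed

lemma deriv_row_eq: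
  assumes T: "T \<in> bounded_ops (fock N) (fock N)" and x: "x \<in> level N k"
  shows "deriv_row N Z T k x = coord (T (observe_U N Z x)) []"
proof -
  have lin: "clinear_on (fock_upto N k) (\<lambda>h. coord (T (observe_U N Z h)) [])"
    by (rule bounded_ops_clinear_on [OF bounded_ops_compose [OF bounded_ops_compose [OF u_bounded_ops T] coord_bounded_ops]])
  have mem: "single \<sigma> (coord x \<sigma>) \<in> fock_upto N k" if "\<sigma> \<in> words_len N k" for \<sigma>
    using that by (simp add: fock_upto_def words_len_def single_in_sum_space)
  have "deriv_row N Z T k x = (\<Sum>\<sigma>\<in>words_len N k. coord (T (observe_U N Z (single \<sigma> (coord x \<sigma>)))) [])"
    unfolding deriv_row_def by (intro sum.cong refl partial_deriv_eq) (simp add: words_len_def)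
  also have "\<dots> = coord (T (observe_U N Z (\<Sum>\<sigma>\<in>words_len N k. single \<sigma> (coord x \<sigma>)))) []"
    by (rule clinear_on_sum [OF csubspace_fock(3) lin mem, symmetric])
  also have "(\<Sum>\<sigma>\<in>words_len N k. single \<sigma> (coord x \<sigma>)) = x"
    using x sum_space_decompose [of "words_len N k" x] by (simp add: level_def)
  finally show ?thesis .
qed

text \<open>Both sides are linear, so an identity on each level is the same as one on the finite sum
  of the levels.\<close>

lemma deriv_rows_eq_iff:
  assumes T: "T \<in> bounded_ops (fock N) (fock N)"
  shows "(\<forall>k\<le>l. \<forall>x\<in>level N k. deriv_row N Z T k x = B k x) \<longleftrightarrow>
    (\<forall>h\<in>fock_upto N l. coord (T (observe_U N Z h)) [] = data_functional N l B h)"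
proof (intro iffI ballI allI impI)
  fix h :: "'e fock"
  assume B_eq: "\<forall>k\<le>l. \<forall>x\<in>level N k. deriv_row N Z T k x = B k x" and h: "h \<in> fock_upto N l"
  have lin: "clinear_on (fock_upto N l) (\<lambda>h. coord (T (observe_U N Z h)) [])"
    by (rule bounded_ops_clinear_on [OF bounded_ops_compose [OF bounded_ops_compose [OF u_bounded_ops T] coord_bounded_ops]])
  have level: "restrict_to (words_len N k) h \<in> level N k" for k
    unfolding level_def by (rule bounded_ops_mem [OF restrict_to_bounded_ops UNIV_I])
  have "h = (\<Sum>k\<le>l. restrict_to (words_len N k) h)"
  proof (rule ell2_eqI)
    fix \<sigma>
    have "coord (\<Sum>k\<le>l. restrict_to (words_len N k) h) \<sigma>
        = (\<Sum>k\<le>l. if k = length \<sigma> then if \<sigma> \<in> words N then coord h \<sigma> else 0 else 0)"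
      unfolding coord_sum by (intro sum.cong refl) (auto simp: coord_restrict_to words_len_def)
    also have "\<dots> = coord h \<sigma>"
      using h by (auto simp: fock_upto_def sum_space_def)
    finally show "coord h \<sigma> = coord (\<Sum>k\<le>l. restrict_to (words_len N k) h) \<sigma>" ..
  qed
  then have "coord (T (observe_U N Z h)) [] = coord (T (observe_U N Z (\<Sum>k\<le>l. restrict_to (words_len N k) h))) []"
    by simp
  also have "\<dots> = (\<Sum>k\<le>l. coord (T (observe_U N Z (restrict_to (words_len N k) h))) [])"
    using level level_subset_fock_upto by (intro clinear_on_sum [OF csubspace_fock(3) lin]) blast
  also have "\<dots> = data_functional N l B h"
    unfolding data_functional_def using B_eq level
    by (intro sum.cong refl) (simp add: deriv_row_eq [OF T level, symmetric])
  finally show "coord (T (observe_U N Z h)) [] = data_functional N l B h" .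
next
  fix k and x :: "'e fock"
  assume h: "\<forall>h\<in>fock_upto N l. coord (T (observe_U N Z h)) [] = data_functional N l B h" and k: "k \<le> l" and x: "x \<in> level N k"
  have "B m (restrict_to (words_len N m) x) = (if m = k then B k x else 0)" if "m \<le> l" for m
  proof (cases "m = k")
    case False
    then have "restrict_to (words_len N m) x = 0"
      using x by (intro ell2_eqI) (auto simp: coord_restrict_to level_def sum_space_def words_len_def)
    then show ?thesis
      using False clinear_on_zero [OF bounded_ops_clinear_on [OF B [OF that]] csubspace_zero [OF csubspace_fock(2)]]
      by simp
  qed (simp add: restrict_to_level x)
  then have "data_functional N l B x = (\<Sum>m\<le>l. if m = k then B k x else 0)"
    unfolding data_functional_def by (intro sum.cong) auto
  then show "deriv_row N Z T k x = B k x"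
    using h k subsetD [OF level_subset_fock_upto [OF k] x] by (simp add: deriv_row_eq [OF T x])
qed

text \<open>Induction on the word at which the two sides are compared: stripping its first letter
  replaces \<open>h\<close> by \<open>F_adj Z a h\<close>, until \<open>base\<close>
  applies.\<close>

lemma intertwining_eq:
  assumes T: "T \<in> bounded_ops (fock N) (fock N)"
    and comm: "\<And>a x. a \<in> {1..N} \<Longrightarrow> x \<in> fock N \<Longrightarrow> comp_proj a (T x) = T (comp_proj a x)"
    and base: "\<And>h. h \<in> fock_upto N l \<Longrightarrow> coord (T (observe_U N Z h)) [] = data_functional N l B h"
    and h: "h \<in> fock_upto N l"
  shows "T (observe_U N Z h) = observe_V N l Z B h"
proof (rule ell2_eqI)
  fix \<sigma>
  note coord_V = coord_observe [OF Z data_functional_bounded_ops]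
  show "coord (T (observe_U N Z h)) \<sigma> = coord (observe_V N l Z B h) \<sigma>"
  proof (cases "\<sigma> \<in> words N")
    case False
    then show ?thesis
      using bounded_ops_mem [OF T bounded_ops_mem [OF u_bounded_ops h]] coord_V [OF h]
      by (simp add: fock_def sum_space_def)
  next
    case True
    then show ?thesis
      using h
    proof (induction \<sigma> arbitrary: h)
      case Nil
      then show ?case by (simp add: base coord_V)
    next
      case (Cons a \<sigma>)
      then have a: "a \<in> {1..N}" and \<sigma>: "\<sigma> \<in> words N" by auto
      have "coord (T (observe_U N Z h)) (a # \<sigma>) = coord (T (comp_proj a (observe_U N Z h))) \<sigma>"
        using comm [OF a bounded_ops_mem [OF u_bounded_ops Cons.prems(2)]] by (metis coord_comp_proj)
      also have "\<dots> = coord (observe_V N l Z B (F_adj Z a h)) \<sigma>"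
        using Cons.IH [OF \<sigma> F_adj_mem [OF Z a Cons.prems(2)]]
        by (simp only: comp_proj_observe [OF Z coord_bounded_ops Cons.prems(2) a])
      also have "\<dots> = coord (observe_V N l Z B h) (a # \<sigma>)"
        by (simp only: comp_proj_observe [OF Z data_functional_bounded_ops Cons.prems(2) a, symmetric] coord_comp_proj)
      finally show ?case .
    qed
  qed
qed

lemma norm_observe_sq:
  assumes g: "g \<in> bounded_ops (fock_upto N l) UNIV" and h: "h \<in> fock_upto N l"
  shows "(norm (observe N Z g h))\<^sup>2 = (norm (g h))\<^sup>2 + (\<Sum>a=1..N. (norm (observe N Z g (F_adj Z a h)))\<^sup>2)"
proof -
  have "(\<Sum>a=1..N. (norm (comp_proj a (observe N Z g h)))\<^sup>2) = (\<Sum>a=1..N. (norm (observe N Z g (F_adj Z a h)))\<^sup>2)"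
    by (rule sum.cong [OF refl]) (simp only: comp_proj_observe [OF Z g h])
  then show ?thesis
    using norm_fock_sq [OF bounded_ops_mem [OF observe_bounded_ops [OF Z g] h]]
    by (simp add: coord_observe [OF Z g h])
qed

lemma interpolation_iff:
  "(\<exists>T\<in>schur_class N. \<forall>h\<in>fock_upto N l. coord (T (observe_U N Z h)) [] = data_functional N l B h) \<longleftrightarrow>
    (\<forall>h\<in>fock_upto N l. norm (observe_V N l Z B h) \<le> norm (observe_U N Z h))"
proof
  assume "\<exists>T\<in>schur_class N. \<forall>h\<in>fock_upto N l. coord (T (observe_U N Z h)) [] = data_functional N l B h"
  then obtain T where T: "T \<in> upper_triangular_ops N" "\<And>x. x \<in> fock N \<Longrightarrow> norm (T x) \<le> norm x"
    and base: "\<And>h. h \<in> fock_upto N l \<Longrightarrow> coord (T (observe_U N Z h)) [] = data_functional N l B h"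
    by (auto simp: schur_class_def)
  have op: "T \<in> bounded_ops (fock N) (fock N)"
    using T(1) by (simp add: upper_triangular_ops_def)
  show "\<forall>h\<in>fock_upto N l. norm (observe_V N l Z B h) \<le> norm (observe_U N Z h)"
  proof
    fix h :: "'e fock" assume h: "h \<in> fock_upto N l"
    have "T (observe_U N Z h) = observe_V N l Z B h"
      using upper_triangular_ops_iff [OF op] T(1) by (intro intertwining_eq [OF op _ base h]) auto
    then show "norm (observe_V N l Z B h) \<le> norm (observe_U N Z h)"
      using T(2) [OF bounded_ops_mem [OF u_bounded_ops h]] by simp
  qed
next
  assume le: "\<forall>h\<in>fock_upto N l. norm (observe_V N l Z B h) \<le> norm (observe_U N Z h)"
  let ?S = "fock_upto N l :: 'e fock set"
  let ?D = "\<lambda>x. adj ?S (observe_U N Z) (observe_U N Z x) - adj ?S (observe_V N l Z B) (observe_V N l Z B x)"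
  note gram = positive_op_gram_diff [OF csubspace_fock(3) closed_fock(3) u_bounded_ops v_bounded_ops]
  have "positive_op ?S ?D"
    using gram(1) le by blast
  then obtain \<Gamma> :: "'e fock \<Rightarrow> (nat, 'e fock) ell2" where \<Gamma>: "clinear_on ?S \<Gamma>"
    and \<Gamma>_norm: "\<And>x. x \<in> ?S \<Longrightarrow> (norm (\<Gamma> x))\<^sup>2 = Re (cinner (?D x) x)"
    using positive_op_factor [OF csubspace_fock(3)] by blast
  have \<Gamma>_sq: "(norm (\<Gamma> h))\<^sup>2 = (norm (observe_U N Z h))\<^sup>2 - (norm (observe_V N l Z B h))\<^sup>2" if "h \<in> ?S" for h
    using \<Gamma>_norm [OF that] gram(2) [OF that] by simp
  \<comment> \<open>The bound that makes the truncated states converge to \<Gamma> h in the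
    realisation.\<close>
  have \<Gamma>_le: "norm (\<Gamma> h) \<le> norm (observe_U N Z h)" if "h \<in> ?S" for h
    by (rule power2_le_imp_le) (simp_all add: \<Gamma>_sq that)
  \<comment> \<open>The difference of the Stein equations for \<open>observe_U\<close> and
    \<open>observe_V\<close>; equality holds, and the contraction needs only this direction.\<close>
  have energy: "(norm (\<Gamma> h))\<^sup>2 + (norm (data_functional N l B h))\<^sup>2
      \<le> (\<Sum>a=1..N. (norm (\<Gamma> (F_adj Z a h)))\<^sup>2) + (norm (coord h []))\<^sup>2" if h: "h \<in> ?S" for h
  proof -
    have "(\<Sum>a=1..N. (norm (\<Gamma> (F_adj Z a h)))\<^sup>2)
        = (\<Sum>a=1..N. (norm (observe_U N Z (F_adj Z a h)))\<^sup>2) - (\<Sum>a=1..N. (norm (observe_V N l Z B (F_adj Z a h)))\<^sup>2)"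
      unfolding sum_subtractf [symmetric] by (intro sum.cong refl \<Gamma>_sq F_adj_mem [OF Z _ h])
    then show ?thesis
      using norm_observe_sq [OF coord_bounded_ops h] norm_observe_sq [OF data_functional_bounded_ops h]
      by (simp add: \<Gamma>_sq [OF h])
  qed
  obtain T where T: "T \<in> bounded_ops (fock N) (fock N)" "\<And>x. x \<in> fock N \<Longrightarrow> norm (T x) \<le> norm x"
    "\<And>a x. a \<in> {1..N} \<Longrightarrow> x \<in> fock N \<Longrightarrow> comp_proj a (T x) = T (comp_proj a x)"
    "\<And>h. h \<in> ?S \<Longrightarrow> coord (T (observe_U N Z h)) [] = data_functional N l B h"
  proof (rule contraction_realization [of ?S \<Gamma> "\<lambda>h. coord h []" "data_functional N l B" N "F_adj Z" "observe_U N Z"])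
    show "csubspace ?S"
      by (rule csubspace_fock)
    show "clinear_on ?S \<Gamma>" "clinear_on ?S (\<lambda>h. coord h [])" "clinear_on ?S (data_functional N l B)"
      by (rule \<Gamma> clinear_on_coord bounded_ops_clinear_on [OF data_functional_bounded_ops])+
    fix a and h :: "'e fock"
    show "a \<in> {1..N} \<Longrightarrow> clinear_on ?S (F_adj Z a)"
      by (rule F_adj_lin [OF Z])
    assume h: "h \<in> ?S"
    show "a \<in> {1..N} \<Longrightarrow> F_adj Z a h \<in> ?S"
      by (rule F_adj_mem [OF Z _ h])
    show "observe_U N Z h \<in> fock N"
      by (rule bounded_ops_mem [OF u_bounded_ops h])
    show "coord (observe_U N Z h) [] = coord h []"
      by (simp add: coord_observe [OF Z coord_bounded_ops h])
    show "a \<in> {1..N} \<Longrightarrow> comp_proj a (observe_U N Z h) = observe_U N Z (F_adj Z a h)"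
      by (rule comp_proj_observe [OF Z coord_bounded_ops h])
  qed (use \<Gamma>_le energy in blast)+
  have "T \<in> schur_class N"
    using T(2,3) upper_triangular_ops_iff [OF T(1)] by (simp add: schur_class_def)
  with T(4) show "\<exists>T\<in>schur_class N. \<forall>h\<in>?S. coord (T (observe_U N Z h)) [] = data_functional N l B h"
    by blast
qed

end

theorem theorem4p3:
  fixes N l :: nat
    and Z :: "nat \<Rightarrow> 'e::complex_hilbert_space \<Rightarrow> 'e"
    and B :: "nat \<Rightarrow> 'e fock \<Rightarrow> 'e"
  assumes "N \<ge> 1" and "l \<ge> 1"
    and "Z \<in> op_ball N"
    and "\<And>k. k \<le> l \<Longrightarrow> B k \<in> bounded_ops (level N k) UNIV"
  shows "(\<exists>T\<in>schur_class N. \<forall>k\<le>l. \<forall>x\<in>level N k. deriv_row N Z T k x = B k x) \<longleftrightarrow>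
    positive_op (fock_upto N l)
      (\<lambda>x. adj (fock_upto N l) (U_inf N l Z) (U_inf N l Z x)
         - adj (fock_upto N l) (V_inf N l Z B) (V_inf N l Z B x))"
proof -
  let ?S = "fock_upto N l :: 'e fock set"
  let ?u = "observe_U N Z" and ?v = "observe_V N l Z B"
  note Z = assms(3) and B = assms(4)
  have "adj ?S (U_inf N l Z) = adj ?S ?u" "adj ?S (V_inf N l Z B) = adj ?S ?v"
    by (intro adj_cong U_inf_eq [OF Z B] V_inf_eq [OF Z B]; assumption)+
  then have "positive_op ?S (\<lambda>x. adj ?S (U_inf N l Z) (U_inf N l Z x) - adj ?S (V_inf N l Z B) (V_inf N l Z B x))
      \<longleftrightarrow> positive_op ?S (\<lambda>x. adj ?S ?u (?u x) - adj ?S ?v (?v x))"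
    using U_inf_eq [OF Z B] V_inf_eq [OF Z B] by (intro positive_op_cong csubspace_fock) simp
  also have "\<dots> \<longleftrightarrow> (\<forall>h\<in>?S. norm (?v h) \<le> norm (?u h))"
    by (rule positive_op_gram_diff [OF csubspace_fock(3) closed_fock(3) u_bounded_ops [OF Z B] v_bounded_ops [OF Z B]])
  also have "\<dots> \<longleftrightarrow> (\<exists>T\<in>schur_class N. \<forall>h\<in>?S. coord (T (?u h)) [] = data_functional N l B h)"
    by (rule interpolation_iff [OF Z B, symmetric])
  also have "\<dots> \<longleftrightarrow> (\<exists>T\<in>schur_class N. \<forall>k\<le>l. \<forall>x\<in>level N k. deriv_row N Z T k x = B k x)"
    using deriv_rows_eq_iff [OF Z B] by (auto simp: schur_class_def upper_triangular_ops_def)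
  finally show ?thesis ..
qed

end
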